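(* Let $d\in\mathbb N$ and let $\mathcal Q\colon\mathbb R^d\to\mathbb R^d$ be a mapping. Then the following statements are equivalent: (i) $\mathcal Q$ is a convex $Q$-operator. (ii) $\mathcal Q$ is convex, satisfies the positive maximum principle, and $\mathcal Q\alpha=0$ for all $\alpha\in\mathbb R$. (iii) There exist a set $\mathcal P\subset\mathbb R^{d\times d}$ of $Q$-matrices and a family $f=(f_q)_{q\in\mathcal P}\subset\mathbb R^d$ with $\sup_{q\in\mathcal P}f_q=f_{q_0}=0$ for some $q_0\in\mathcal P$ such that $\mathcal Q u_0=\sup_{q\in\mathcal P}(qu_0+f_q)$ for all $u_0\in\mathbb R^d$ (suprema componentwise). (iv) There exists a uniformly continuous convex Markovian semigroup $\mathscr S=(\mathscr S(t))_{t\ge0}$ on $\mathbb R^d$ with $\mathcal Q u_0=\lim_{h\searrow0}\frac{\mathscr S(h)u_0-u_0}{h}$ for all $u_0\in\mathbb R^d$. (v) There exists a convex Markov chain $(\Omega,\mathcal F,\mathcal E,(X_t)_{t\ge0})$ such that $\mathcal Q u_0=\lim_{h\searrow0}\frac{\mathcal E(u_0(X_h))-u_0}{h}$ for all $u_0\in\mathbb R^d$. Moreover, in this case, for every convex Markov chain as in (v), every semigroup $\mathscr S$ as in (iv), every pair $(\mathcal P,f)$ as in (iii) and every $u_0\in\mathbb R^d$, the function $u\colon[0,\infty)\to\mathbb R^d$, $u(t):=\mathcal E(u_0(X_t))$, is the unique classical solution $u\in C^1([0,\infty);\mathbb R^d)$ of the initial value problem $u'(t)=\mathcal Q u(t)=\sup_{q\in\mathcal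 P}(qu(t)+f_q)$ for $t\ge0$, $u(0)=u_0$; furthermore $u(t)=\mathscr S(t)u_0$ for all $t\ge0$, and $\mathscr S$ is the semigroup envelope of $(\mathcal P,f)$.
   Context: Vectors $u\in\mathbb R^d$ are identified with functions $\{1,\dots,d\}\to\mathbb R$, $u_i=u(i)$; $\|u\|_\infty=\max_i|u_i|$; a real number $\alpha$ is identified with the constant vector $(\alpha,\dots,\alpha)^T$; $e_i$ is the $i$-th unit vector. Inequalities, suprema and maxima of vectors are componentwise. A map $F\colon\mathbb R^d\to\mathbb R^d$ is convex if each component $F_i$ is convex. A $Q$-matrix is a matrix $q\in\mathbb R^{d\times d}$ with $q_{ii}\le0$ for all $i$, $q_{ij}\ge0$ for $i\ne j$, and $\sum_{j}q_{ij}=0$ for all $i$. A map $\mathcal Q\colon\mathbb R^d\to\mathbb R^d$ is a $Q$-operator if (a) $(\mathcal Q(\lambda e_i))_i\le0$ for all $\lambda>0$ and all $i$; (b) $(\mathcal Q(-\lambda e_j))_i\le0$ for all $\lambda>0$ and all $i\neq j$; (c) $\mathcal Q\alpha=0$ for all $\alpha\in\mathbb R$. $\mathcal Q$ satisfies the positive maximum principle if for all $u\in\mathbb R^d$ and $i$: $(\mathcal Qu)_i\le0$ whenever $u_i\ge u_j$ for all $j$. A kernel is a map $\mathcal E\colon\mathbb R^d\to\mathbb R^d$ that is monotone ($u\le v\Rightarrow \mathcal E u\le\mathcal E v$) and preserves constants ($\mathcal E\alpha=\alpha$ for $\alpha\in\mathbb R$). A semigroup is a family $(\mathscr S(t))_{t\ge0}$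 of maps $\mathbb R^d\to\mathbb R^d$ with $\mathscr S(0)=I$ and $\mathscr S(s+t)=\mathscr S(s)\circ\mathscr S(t)$; it is uniformly continuous if $\mathscr S(h)\to I$ uniformly on compact sets as $h\searrow0$, Markovian if each $\mathscr S(t)$ is a kernel, convex if each $\mathscr S(t)$ is convex. For a set $\mathcal P$ of $Q$-matrices and $f=(f_q)_{q\in\mathcal P}$ with $\sup_q f_q=f_{q_0}=0$ for some $q_0\in\mathcal P$, put $S_q(t)u_0:=e^{tq}u_0+\int_0^te^{sq}f_q\,ds$ for $t\ge0$, $u_0\in\mathbb R^d$. The semigroup envelope of $(\mathcal P,f)$ is the semigroup $\mathscr S$ with $\mathscr S(t)u_0\ge S_q(t)u_0$ for all $t,u_0,q\in\mathcal P$, and such that $\mathscr S(t)u_0\le\mathscr T(t)u_0$ for all $t,u_0$ for every other semigroup $\mathscr T$ with this domination property. A convex expectation space is a triple $(\Omega,\mathcal F,\mathcal E)$ with $(\Omega,\mathcal F)$ measurable and $\mathcal E(X)=\sup_{\mathbb P\in\mathcal P}(\mathbb E_{\mathbb P}(X)-\alpha_{\mathbb P})$ for all bounded measurable $X$, for some set $\mathcal P$ of probability measures on $(\Omega,\mathcal F)$ and $(\alpha_{\mathbb P})\subset[0,\infty)$ with $\inf_{\mathbb P}\alpha_{\mathbb P}=0$. A convex Markov chain is a quadruple $(\Omega,\mathcal F,\mathcal E,(X_t)_{t\ge0})$ where $(\Omega,\mathcal F)$ is a measurable space, each $X_t\colon\Omega\to\{1,\dots,d\}$ is measurable, $\mathcal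 E=(\mathcal E_1,\dots,\mathcal E_d)^T$ with each $(\Omega,\mathcal F,\mathcal E_i)$ a convex expectation space, writing $\mathcal E(Y):=(\mathcal E_1(Y),\dots,\mathcal E_d(Y))^T$, such that $\mathcal E(u_0(X_0))=u_0$ for all $u_0\in\mathbb R^d$, and the Markov property holds: for all $s,t\ge0$, $n\in\mathbb N$, $0\le t_1<\dots<t_n\le s$ and all $v_0\colon\{1,\dots,d\}^{n+1}\to\mathbb R$, with $Y:=(X_{t_1},\dots,X_{t_n})$ and $\mathcal E_{i,t}(w):=\mathcal E_i(w(X_t))$ for $w\in\mathbb R^d$, one has $\mathcal E(v_0(Y,X_{s+t}))=\mathcal E\big[\omega\mapsto\mathcal E_{X_s(\omega),t}(v_0(Y(\omega),\cdot))\big]$. *)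

theory Defs
  imports "HOL-Analysis.Analysis" "HOL-Probability.Probability"
begin

text \<open>The state space {1,...,d} is modelled by a finite type 'd; vectors in R^d are
  real^'d, matrices are real^'d^'d. Orders on real^'d are componentwise (library).\<close>

definition Q_matrix :: "real^'d::finite^'d \<Rightarrow> bool" where
  "Q_matrix q \<longleftrightarrow> (\<forall>i. q$i$i \<le> 0) \<and> (\<forall>i j. i \<noteq> j \<longrightarrow> q$i$j \<ge> 0)
                 \<and> (\<forall>i. (\<Sum>j\<in>UNIV. q$i$j) = 0)"

definition convex_map :: "(real^'d::finite \<Rightarrow> real^'d) \<Rightarrow> bool" where
  "convex_map F \<longleftrightarrow> (\<forall>i. convex_on UNIV (\<lambda>u. F u $ i))"

definition Q_operator :: "(real^'d::finite \<Rightarrow> real^'d) \<Rightarrow> bool" where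
  "Q_operator Q \<longleftrightarrow>
     (\<forall>c>0. \<forall>i. Q (c *\<^sub>R axis i 1) $ i \<le> 0) \<and>
     (\<forall>c>0. \<forall>i j. i \<noteq> j \<longrightarrow> Q (- (c *\<^sub>R axis j 1)) $ i \<le> 0) \<and>
     (\<forall>\<alpha>::real. Q (vec \<alpha>) = 0)"

definition positive_max_principle :: "(real^'d::finite \<Rightarrow> real^'d) \<Rightarrow> bool" where
  "positive_max_principle Q \<longleftrightarrow> (\<forall>u i. (\<forall>j. u$j \<le> u$i) \<longrightarrow> Q u $ i \<le> 0)"

definition kernel :: "(real^'d::finite \<Rightarrow> real^'d) \<Rightarrow> bool" where
  "kernel E \<longleftrightarrow> (\<forall>u v. u \<le> v \<longrightarrow> E u \<le> E v) \<and> (\<forall>\<alpha>::real. E (vec \<alpha>) = vec \<alpha>)"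

text \<open>Semigroup indexed by t \<ge> 0 (values at negative times are irrelevant).\<close>
definition semigroup :: "(real \<Rightarrow> real^'d::finite \<Rightarrow> real^'d) \<Rightarrow> bool" where
  "semigroup S \<longleftrightarrow> S 0 = (\<lambda>u. u) \<and> (\<forall>s t. 0 \<le> s \<longrightarrow> 0 \<le> t \<longrightarrow> S (s + t) = S s \<circ> S t)"

definition unif_cont_semigroup :: "(real \<Rightarrow> real^'d::finite \<Rightarrow> real^'d) \<Rightarrow> bool" where
  "unif_cont_semigroup S \<longleftrightarrow> (\<forall>K. compact K \<longrightarrow> uniform_limit K S (\<lambda>u. u) (at_right 0))"

definition markovian_semigroup :: "(real \<Rightarrow> real^'d::finite \<Rightarrow> real^'d) \<Rightarrow> bool" where
  "markovian_semigroup S \<longleftrightarrow> (\<forall>t\<ge>0. kernel (S t))"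

definition convex_semigroup :: "(real \<Rightarrow> real^'d::finite \<Rightarrow> real^'d) \<Rightarrow> bool" where
  "convex_semigroup S \<longleftrightarrow> (\<forall>t\<ge>0. convex_map (S t))"

text \<open>Matrix powers and the matrix exponential.\<close>
definition mat_pow :: "real^'d::finite^'d \<Rightarrow> nat \<Rightarrow> real^'d^'d" where
  "mat_pow A k = (((**) A) ^^ k) (mat 1)"

definition mat_exp :: "real^'d::finite^'d \<Rightarrow> real^'d^'d" where
  "mat_exp A = (\<Sum>k. (1 / fact k) *\<^sub>R mat_pow A k)"

text \<open>S_q(t) u0 = e^{tq} u0 + \<integral>_0^t e^{sq} f_q ds\<close>
definition affine_sg :: "real^'d::finite^'d \<Rightarrow> real^'d \<Rightarrow> real \<Rightarrow> real^'d \<Rightarrow> real^'d" where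
  "affine_sg q fq t u0 = mat_exp (t *\<^sub>R q) *v u0 + integral {0..t} (\<lambda>s. mat_exp (s *\<^sub>R q) *v fq)"

definition semigroup_envelope ::
  "(real^'d::finite^'d) set \<Rightarrow> (real^'d^'d \<Rightarrow> real^'d) \<Rightarrow> (real \<Rightarrow> real^'d \<Rightarrow> real^'d) \<Rightarrow> bool" where
  "semigroup_envelope P f S \<longleftrightarrow>
     semigroup S \<and>
     (\<forall>t\<ge>0. \<forall>u0. \<forall>q\<in>P. affine_sg q (f q) t u0 \<le> S t u0) \<and>
     (\<forall>T. semigroup T \<and> (\<forall>t\<ge>0. \<forall>u0. \<forall>q\<in>P. affine_sg q (f q) t u0 \<le> T t u0)
          \<longrightarrow> (\<forall>t\<ge>0. \<forall>u0. S t u0 \<le> T t u0))"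

text \<open>(iii): representation as a supremum of affine maps q u + f_q.\<close>
definition sup_representation ::
  "(real^'d::finite \<Rightarrow> real^'d) \<Rightarrow> (real^'d^'d) set \<Rightarrow> (real^'d^'d \<Rightarrow> real^'d) \<Rightarrow> bool" where
  "sup_representation Q P f \<longleftrightarrow>
     (\<forall>q\<in>P. Q_matrix q) \<and>
     (\<exists>q0\<in>P. f q0 = 0) \<and> (\<forall>q\<in>P. f q \<le> 0) \<and>
     (\<forall>u i. bdd_above ((\<lambda>q. (q *v u + f q) $ i) ` P) \<and>
            Q u $ i = (SUP q\<in>P. (q *v u + f q) $ i))"

text \<open>Convex expectation space on the measurable space M (the sigma-algebra sets M).\<close>
definition convex_expectation :: "'w measure \<Rightarrow> (('w \<Rightarrow> real) \<Rightarrow> real) \<Rightarrow> bool" where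
  "convex_expectation M E \<longleftrightarrow>
     (\<exists>\<P> :: 'w measure set. \<exists>\<alpha> :: 'w measure \<Rightarrow> real.
        \<P> \<noteq> {} \<and> (\<forall>P\<in>\<P>. prob_space P \<and> sets P = sets M) \<and>
        (\<forall>P\<in>\<P>. 0 \<le> \<alpha> P) \<and> (INF P\<in>\<P>. \<alpha> P) = 0 \<and>
        (\<forall>X. X \<in> borel_measurable M \<and> bounded (X ` space M) \<longrightarrow>
             E X = (SUP P\<in>\<P>. integral\<^sup>L P X - \<alpha> P)))"

text \<open>Convex Markov chain (Omega, F, E, X): M encodes (Omega, F); E i is the expectation
  E_i; X t is the state at time t.\<close>
definition convex_markov_chain ::
  "'w measure \<Rightarrow> ('d::finite \<Rightarrow> ('w \<Rightarrow> real) \<Rightarrow> real) \<Rightarrow> (real \<Rightarrow> 'w \<Rightarrow> 'd) \<Rightarrow> bool" where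
  "convex_markov_chain M E X \<longleftrightarrow>
     (\<forall>t. X t \<in> measurable M (count_space UNIV)) \<and>
     (\<forall>i. convex_expectation M (E i)) \<and>
     (\<forall>u0::real^'d. \<forall>i. E i (\<lambda>\<omega>. u0 $ X 0 \<omega>) = u0 $ i) \<and>
     (\<forall>s t. \<forall>ts :: real list. \<forall>v0 :: 'd list \<Rightarrow> 'd \<Rightarrow> real.
        0 \<le> s \<and> 0 \<le> t \<and> ts \<noteq> [] \<and> sorted_wrt (<) ts \<and> (\<forall>r\<in>set ts. 0 \<le> r \<and> r \<le> s) \<longrightarrow>
        (\<forall>i. E i (\<lambda>\<omega>. v0 (map (\<lambda>r. X r \<omega>) ts) (X (s + t) \<omega>)) =
             E i (\<lambda>\<omega>. E (X s \<omega>) (\<lambda>\<omega>'. v0 (map (\<lambda>r. X r \<omega>) ts) (X t \<omega>')))))"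

text \<open>u(t) = E(u0(X_t))\<close>
definition chain_value ::
  "('d::finite \<Rightarrow> ('w \<Rightarrow> real) \<Rightarrow> real) \<Rightarrow> (real \<Rightarrow> 'w \<Rightarrow> 'd) \<Rightarrow> real^'d \<Rightarrow> real \<Rightarrow> real^'d" where
  "chain_value E X u0 t = (\<chi> i. E i (\<lambda>\<omega>. u0 $ X t \<omega>))"

text \<open>Classical solution u in C^1([0,\<infinity>); R^d) of u' = Q u, u(0) = u0.\<close>
definition classical_solution ::
  "(real^'d::finite \<Rightarrow> real^'d) \<Rightarrow> real^'d \<Rightarrow> (real \<Rightarrow> real^'d) \<Rightarrow> bool" where
  "classical_solution Q u0 u \<longleftrightarrow>
     u 0 = u0 \<and>
     (\<forall>t\<ge>0. (u has_vector_derivative Q (u t)) (at t within {0..})) \<and>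
     continuous_on {0..} (\<lambda>t. Q (u t))"

end

theory Submission
  imports Defs
begin

text \<open>A row of a subgradient of a convex \<open>Q\<close> satisfying the maximum principle is a row of a
  \<open>Q\<close>-matrix, so at an index where \<open>v - w\<close> is maximal one has \<open>Q v \<le> Q w\<close>. This yields a comparison
  principle for \<open>u' = Q u\<close>, from which uniqueness, monotonicity, convexity and domination of the affine
  semigroups \<open>S\<^sub>q\<close> all follow. Existence is Picard iteration for \<open>Q\<close> composed with a clamp to a cube,
  which the maximum principle shows to be invariant. Conversely, a convex kernel commutes with adding
  constants and is therefore nonexpansive, so orbits of a convex Markovian semigroup are continuous with
  continuous right derivative \<open>Q\<close>, i.e. they are classical solutions.

  For a chain, the semigroup determines a convex functional on cylinder functions of the path space.
  By Hahn-Banach this functional has a subgradient at each cylinder function; a subgradient is a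
  positive normalised linear functional, which extends to a probability measure because decreasing
  cylinder sets with empty intersection are eventually empty. These measures, penalised by the convex
  conjugate, represent the expectation.\<close>

section \<open>Subgradients of convex functionals\<close>

text \<open>A pair \<open>(P, f)\<close> representing \<open>Q\<close> is arbitrary, so its supremum
  need not be attained. Comparison therefore works with subgradients, which touch \<open>Q\<close>
  exactly at the point in question, while a given pair enters only through the inequality
  \<open>q *v u + f q \<le> Q u\<close> and through near-maximisers. One fact ties together all
  objects of the final claim: chain values and orbits of convex Markovian semigroups are classical
  solutions of the same initial value problem, and these are unique. For the chain, the derivative
  condition and the Markov property evaluate the expectation only at functions of finitely many
  coordinates. It is thus enough that the supremum over penalised measures reproduces, on cylinder
  functions, the value computed backwards in time by the semigroup. Hahn-Banach is stated for sets
  of real functions so that one statement covers both vectors, read as functions on the states, and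
  cylinder functions on paths.\<close>

definition fun_subspace :: "('x \<Rightarrow> real) set \<Rightarrow> bool" where
  "fun_subspace V \<longleftrightarrow> (\<forall>f\<in>V. \<forall>g\<in>V. (\<lambda>x. f x + g x) \<in> V) \<and> (\<forall>f\<in>V. \<forall>c. (\<lambda>x. c * f x) \<in> V)"

text \<open>Homogeneity is only asked as an inequality, which is what the infimum constructions
  yield; rescaling by \<open>1/c\<close> recovers equality, and \<open>c = 0\<close> makes the value
  at the zero function nonpositive.\<close>

definition sublinear_on :: "('x \<Rightarrow> real) set \<Rightarrow> (('x \<Rightarrow> real) \<Rightarrow> real) \<Rightarrow> bool" where
  "sublinear_on V p \<longleftrightarrow> (\<forall>f\<in>V. \<forall>g\<in>V. p (\<lambda>x. f x + g x) \<le> p f + p g)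
                     \<and> (\<forall>f\<in>V. \<forall>c\<ge>0. p (\<lambda>x. c * f x) \<le> c * p f)"

definition linear_on_fun :: "('x \<Rightarrow> real) set \<Rightarrow> (('x \<Rightarrow> real) \<Rightarrow> real) \<Rightarrow> bool" where
  "linear_on_fun V L \<longleftrightarrow> (\<forall>f\<in>V. \<forall>g\<in>V. L (\<lambda>x. f x + g x) = L f + L g)
                      \<and> (\<forall>f\<in>V. \<forall>c. L (\<lambda>x. c * f x) = c * L f)"

lemma fun_subspaceD:
  assumes "fun_subspace V"
  shows "f \<in> V \<Longrightarrow> g \<in> V \<Longrightarrow> (\<lambda>x. f x + g x) \<in> V" "f \<in> V \<Longrightarrow> (\<lambda>x. c * f x) \<in> V"
    "f \<in> V \<Longrightarrow> (\<lambda>x. - f x) \<in> V" "f \<in> V \<Longrightarrow> g \<in> V \<Longrightarrow> (\<lambda>x. f x + c * g x) \<in> V"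
proof -
  show a: "f \<in> V \<Longrightarrow> g \<in> V \<Longrightarrow> (\<lambda>x. f x + g x) \<in> V" for f g
    using assms by (auto simp: fun_subspace_def)
  show b: "f \<in> V \<Longrightarrow> (\<lambda>x. c * f x) \<in> V" for c f
    using assms by (auto simp: fun_subspace_def)
  show "f \<in> V \<Longrightarrow> (\<lambda>x. - f x) \<in> V" using b[of f "-1"] by simp
  show "f \<in> V \<Longrightarrow> g \<in> V \<Longrightarrow> (\<lambda>x. f x + c * g x) \<in> V" using a b by blast
qed

lemma sublinear_on_props:
  assumes V: "fun_subspace V" and p: "sublinear_on V p"
  shows "f \<in> V \<Longrightarrow> g \<in> V \<Longrightarrow> p (\<lambda>x. f x + g x) \<le> p f + p g"
    and "f \<in> V \<Longrightarrow> 0 \<le> c \<Longrightarrow> p (\<lambda>x. c * f x) = c * p f"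
    and "f \<in> V \<Longrightarrow> - p (\<lambda>x. - f x) \<le> p f"
proof -
  have sub: "\<And>f g. f \<in> V \<Longrightarrow> g \<in> V \<Longrightarrow> p (\<lambda>x. f x + g x) \<le> p f + p g"
    and hom: "\<And>f c. f \<in> V \<Longrightarrow> 0 \<le> c \<Longrightarrow> p (\<lambda>x. c * f x) \<le> c * p f"
    using p by (auto simp: sublinear_on_def)
  show "f \<in> V \<Longrightarrow> g \<in> V \<Longrightarrow> p (\<lambda>x. f x + g x) \<le> p f + p g" by (rule sub)
  have zero: "p (\<lambda>x. 0) = 0" if "f \<in> V" for f
  proof -
    have z: "(\<lambda>x. 0) \<in> V" using fun_subspaceD(2)[OF V that, of 0] by simp
    show ?thesis using hom[OF z, of 0] sub[OF z z] by simp
  qed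
  show h: "p (\<lambda>x. c * f x) = c * p f" if f: "f \<in> V" and c: "0 \<le> c" for c f
  proof (cases "c = 0")
    case True then show ?thesis using zero[OF f] by simp
  next
    case False
    then have "p f \<le> (1/c) * p (\<lambda>x. c * f x)"
      using hom[OF fun_subspaceD(2)[OF V f, of c], of "1/c"] c by simp
    then show ?thesis using hom[OF f c] False c by (simp add: field_simps)
  qed
  show "f \<in> V \<Longrightarrow> - p (\<lambda>x. - f x) \<le> p f"
    using sub[of f "\<lambda>x. - f x"] fun_subspaceD(3)[OF V, of f] zero[of f] by auto
qed

lemma Chains_relation_ofD:
  assumes "C \<in> Chains (relation_of P A)"
  shows "C \<subseteq> A" "a \<in> C \<Longrightarrow> b \<in> C \<Longrightarrow> P a b \<or> P b a"
  using assms by (auto simp: Chains_def relation_of_def)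

text \<open>Of two members of a chain the smaller one bounds both terms of \<open>p f + q g\<close>,
  so the infimum stays subadditive. The common majorant \<open>D\<close> keeps it finite, since
  -D(-f) \<le> -p(-f) \<le> p(f).\<close>

lemma sublinear_on_inf_chain:
  assumes V: "fun_subspace V" and ne: "C \<noteq> {}"
    and C: "\<And>p. p \<in> C \<Longrightarrow> sublinear_on V p"
    and D: "\<And>p f. p \<in> C \<Longrightarrow> f \<in> V \<Longrightarrow> p f \<le> D f"
    and ch: "\<And>p q. p \<in> C \<Longrightarrow> q \<in> C \<Longrightarrow> (\<forall>f\<in>V. p f \<le> q f) \<or> (\<forall>f\<in>V. q f \<le> p f)"
  shows "sublinear_on V (\<lambda>f. INF p\<in>C. p f)" and "p \<in> C \<Longrightarrow> f \<in> V \<Longrightarrow> (INF p\<in>C. p f) \<le> p f"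
proof -
  have bdd: "bdd_below ((\<lambda>p. p f) ` C)" if f: "f \<in> V" for f
  proof (rule bdd_belowI2)
    fix p assume p: "p \<in> C"
    show "- D (\<lambda>x. - f x) \<le> p f"
      using sublinear_on_props(3)[OF V C[OF p] f] D[OF p fun_subspaceD(3)[OF V f]] by linarith
  qed
  show le: "p \<in> C \<Longrightarrow> f \<in> V \<Longrightarrow> (INF p\<in>C. p f) \<le> p f" for p f
    by (rule cINF_lower[OF bdd])
  show "sublinear_on V (\<lambda>f. INF p\<in>C. p f)"
    unfolding sublinear_on_def
  proof (intro conjI ballI allI impI)
    fix f g assume f: "f \<in> V" and g: "g \<in> V"
    let ?u = "\<lambda>f. INF p\<in>C. p f"
    have *: "?u (\<lambda>x. f x + g x) \<le> p f + q g" if p: "p \<in> C" and q: "q \<in> C" for p q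
    proof -
      obtain r where r: "r \<in> C" "r f \<le> p f" "r g \<le> q g" using ch[OF p q] p q f g by blast
      show ?thesis
        using le[OF r(1) fun_subspaceD(1)[OF V f g]] sublinear_on_props(1)[OF V C[OF r(1)] f g] r
        by linarith
    qed
    have "?u (\<lambda>x. f x + g x) - p f \<le> ?u g" if p: "p \<in> C" for p
      by (rule cINF_greatest[OF ne]) (use *[OF p] in \<open>simp add: algebra_simps\<close>)
    then have "?u (\<lambda>x. f x + g x) - ?u g \<le> p f" if "p \<in> C" for p using that by force
    then have "?u (\<lambda>x. f x + g x) - ?u g \<le> ?u f" by (intro cINF_greatest[OF ne])
    then show "?u (\<lambda>x. f x + g x) \<le> ?u f + ?u g" by linarith
  next
    fix f c assume f: "f \<in> V" and c: "(0::real) \<le> c"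
    let ?u = "\<lambda>f. INF p\<in>C. p f"
    have *: "?u (\<lambda>x. c * f x) \<le> c * p f" if p: "p \<in> C" for p
      using le[OF p fun_subspaceD(2)[OF V f, of c]] sublinear_on_props(2)[OF V C[OF p] f c] by simp
    show "?u (\<lambda>x. c * f x) \<le> c * ?u f"
    proof (cases "c = 0")
      case True then show ?thesis using * ne by auto
    next
      case False
      then have "?u (\<lambda>x. c * f x) / c \<le> ?u f"
        by (intro cINF_greatest[OF ne]) (use * c in \<open>simp add: field_simps\<close>)
      then show ?thesis using False c by (simp add: field_simps)
    qed
  qed
qed

text \<open>For a minimal sublinear \<open>p\<close> and fixed \<open>g\<close>, the functional
  \<open>f \<mapsto> inf {p (f + t g) - t p g | t \<ge> 0}\<close> is again sublinear and below \<open>p\<close>, hence equals \<open>p\<close>;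
  taking \<open>t = 1\<close> yields superadditivity.\<close>
lemma minimal_sublinear_additive:
  assumes V: "fun_subspace V" and p: "sublinear_on V p"
    and min: "\<And>p'. sublinear_on V p' \<Longrightarrow> (\<forall>f\<in>V. p' f \<le> p f) \<Longrightarrow> \<forall>f\<in>V. p' f = p f"
  shows "linear_on_fun V p"
proof -
  note S = sublinear_on_props[OF V p] and W = fun_subspaceD[OF V]
  have add: "p (\<lambda>x. f x + g x) = p f + p g" if f: "f \<in> V" and g: "g \<in> V" for f g
  proof -
    define P where "P f t = p (\<lambda>x. f x + t * g x) - t * p g" for f t
    define q where "q f = (INF t\<in>{0..}. P f t)" for f
    have bdd: "bdd_below (P h ` {0..})" if h: "h \<in> V" for h
    proof (rule bdd_belowI2)
      fix t :: real assume t: "t \<in> {0..}"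
      have "p (\<lambda>x. (h x + t * g x) + (- h x)) \<le> p (\<lambda>x. h x + t * g x) + p (\<lambda>x. - h x)"
        by (rule S(1)) (use h g W in auto)
      then show "- p (\<lambda>x. - h x) \<le> P h t" using S(2)[OF g, of t] t by (simp add: P_def)
    qed
    have le: "q h \<le> P h t" if "h \<in> V" "0 \<le> t" for h t
      unfolding q_def by (rule cINF_lower[OF bdd]) (use that in auto)
    have ge: "x \<le> q h" if "\<And>t. 0 \<le> t \<Longrightarrow> x \<le> P h t" for x h
      unfolding q_def by (rule cINF_greatest) (use that in auto)
    have q0: "q h \<le> p h" if h: "h \<in> V" for h using le[OF h, of 0] by (simp add: P_def)
    have "sublinear_on V q" unfolding sublinear_on_def
    proof (intro conjI ballI allI impI)
      fix a b assume a: "a \<in> V" and b: "b \<in> V"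
      have *: "q (\<lambda>x. a x + b x) \<le> P a s + P b t" if st: "0 \<le> s" "0 \<le> t" for s t
      proof -
        have "p (\<lambda>x. (a x + s * g x) + (b x + t * g x)) \<le> p (\<lambda>x. a x + s * g x) + p (\<lambda>x. b x + t * g x)"
          by (rule S(1)) (use a b g W in auto)
        then have "P (\<lambda>x. a x + b x) (s + t) \<le> P a s + P b t"
          by (simp add: P_def algebra_simps)
        then show ?thesis using le[OF W(1)[OF a b], of "s+t"] st by simp
      qed
      have "q (\<lambda>x. a x + b x) - P a s \<le> q b" if "0 \<le> s" for s
        by (rule ge) (use *[OF that] in \<open>simp add: algebra_simps\<close>)
      then have "q (\<lambda>x. a x + b x) - q b \<le> q a" by (intro ge) (simp add: algebra_simps)
      then show "q (\<lambda>x. a x + b x) \<le> q a + q b" by simp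
    next
      fix a c assume a: "a \<in> V" and c: "(0::real) \<le> c"
      show "q (\<lambda>x. c * a x) \<le> c * q a"
      proof (cases "c = 0")
        case True
        then show ?thesis using q0[OF W(2)[OF a, of 0]] S(2)[OF a, of 0] by simp
      next
        case False
        have "q (\<lambda>x. c * a x) \<le> c * P a t" if t: "0 \<le> t" for t
        proof -
          have "p (\<lambda>x. c * (a x + t * g x)) = c * p (\<lambda>x. a x + t * g x)"
            by (rule S(2)) (use a g W c in auto)
          then have "P (\<lambda>x. c * a x) (c * t) = c * P a t"
            by (simp add: P_def algebra_simps)
          then show ?thesis using le[OF W(2)[OF a], of "c*t" c] c t by simp
        qed
        then have "q (\<lambda>x. c * a x) / c \<le> q a"
          by (intro ge) (use False c in \<open>simp add: field_simps\<close>)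
        then show ?thesis using False c by (simp add: field_simps)
      qed
    qed
    then have "p f = q f" using min q0 f by metis
    then have "p f \<le> P f 1" using le[OF f, of 1] by simp
    then show ?thesis using S(1)[OF f g] by (simp add: P_def)
  qed
  have "p (\<lambda>x. c * f x) = c * p f" if f: "f \<in> V" for c f
  proof (cases "0 \<le> c")
    case True then show ?thesis by (rule S(2)[OF f])
  next
    case False
    have "p (\<lambda>x. c * f x + (- c) * f x) = p (\<lambda>x. c * f x) + p (\<lambda>x. (- c) * f x)"
      by (rule add) (use f W in auto)
    moreover have "p (\<lambda>x. 0 * f x) = 0" using S(2)[OF f, of 0] by simp
    ultimately show ?thesis using S(2)[OF f, of "-c"] False by simp
  qed
  then show ?thesis using add by (auto simp: linear_on_fun_def)
qed

text \<open>A minimal sublinear functional below \<open>D\<close> is linear, so Zorn's lemma is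
  applied to sublinear functionals on all of \<open>V\<close> instead of linear functionals on
  growing subspaces.\<close>

lemma Hahn_Banach_fun:
  assumes V: "fun_subspace V" and D: "sublinear_on V D"
  shows "\<exists>L. linear_on_fun V L \<and> (\<forall>f\<in>V. L f \<le> D f)"
proof -
  \<comment> \<open>Values outside \<open>V\<close> are pinned to 0: otherwise they could always be
    lowered and no minimal element would exist. \<open>R\<close> reverses the pointwise order
    because Zorn's lemma delivers maximal elements.\<close>
  define A where "A = {p. sublinear_on V p \<and> (\<forall>f\<in>V. p f \<le> D f) \<and> (\<forall>f. f \<notin> V \<longrightarrow> p f = 0)}"
  define R where "R = (\<lambda>p q :: ('a \<Rightarrow> real) \<Rightarrow> real. \<forall>f. q f \<le> p f)"
  have cut: "sublinear_on V (\<lambda>f. if f \<in> V then p f else 0)" if "sublinear_on V p" for p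
    using that fun_subspaceD[OF V] by (auto simp: sublinear_on_def)
  have "\<exists>m\<in>A. \<forall>a\<in>A. R m a \<longrightarrow> a = m"
  proof (rule predicate_Zorn)
    show "partial_order_on A (relation_of R A)"
      by (auto simp: partial_order_on_def preorder_on_def refl_on_def trans_def antisym_def
          relation_of_def R_def intro: order_trans) (metis antisym ext)
  next
    fix C assume C: "C \<in> Chains (relation_of R A)"
    show "\<exists>u\<in>A. \<forall>a\<in>C. R a u"
    proof (cases "C = {}")
      case True
      then show ?thesis using cut[OF D] by (intro bexI[of _ "\<lambda>f. if f \<in> V then D f else 0"]) (auto simp: A_def)
    next
      case False
      have CA: "C \<subseteq> A" by (rule Chains_relation_ofD[OF C])
      have 1: "sublinear_on V p" if "p \<in> C" for p using CA that by (auto simp: A_def)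
      have 2: "p f \<le> D f" if "p \<in> C" "f \<in> V" for p f using CA that by (auto simp: A_def)
      have 3: "(\<forall>f\<in>V. p f \<le> q f) \<or> (\<forall>f\<in>V. q f \<le> p f)" if "p \<in> C" "q \<in> C" for p q
        using Chains_relation_ofD(2)[OF C that] by (auto simp: R_def)
      have I1: "sublinear_on V (\<lambda>f. INF p\<in>C. p f)"
        by (rule sublinear_on_inf_chain(1)[where D = D, OF V False]) (use 1 2 3 in blast)+
      let ?u = "\<lambda>f. if f \<in> V then (INF p\<in>C. p f) else 0"
      have low: "(INF p\<in>C. p f) \<le> p f" if "p \<in> C" "f \<in> V" for p f by (rule sublinear_on_inf_chain(2)[where D = D, OF V False]) (use 1 2 3 that in blast)+
      have "(INF p\<in>C. p f) \<le> D f" if "f \<in> V" for f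
        using low 2 False that by (metis ex_in_conv order_trans)
      then have "?u \<in> A" using cut[OF I1] by (auto simp: A_def)
      moreover have "R p ?u" if "p \<in> C" for p using low that CA by (auto simp: R_def A_def)
      ultimately show ?thesis by blast
    qed
  qed
  then obtain m where m: "m \<in> A" and min: "\<And>a. a \<in> A \<Longrightarrow> R m a \<Longrightarrow> a = m" by blast
  have "linear_on_fun V m"
  proof (rule minimal_sublinear_additive[OF V])
    show "sublinear_on V m" using m by (auto simp: A_def)
    fix p assume p: "sublinear_on V p" "\<forall>f\<in>V. p f \<le> m f"
    let ?p = "\<lambda>f. if f \<in> V then p f else 0"
    have "?p \<in> A" using cut[OF p(1)] m p(2) by (auto simp: A_def intro: order_trans)
    moreover have "R m ?p" using m p(2) by (auto simp: A_def R_def)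
    ultimately have "?p = m" by (rule min)
    then show "\<forall>f\<in>V. p f = m f" using fun_cong[of ?p m] by fastforce
  qed
  then show ?thesis using m by (auto simp: A_def)
qed

text \<open>\<open>D w\<close> is the one-sided directional derivative of \<open>E\<close> at
  \<open>v\<close>, written as the infimum of difference quotients. It is sublinear, and a linear
  functional below it is a subgradient, as the quotient with step length 1 shows.\<close>

theorem convex_subgradient_fun:
  assumes V: "fun_subspace V" and v: "v \<in> V"
    and conv: "\<And>f g t. f \<in> V \<Longrightarrow> g \<in> V \<Longrightarrow> 0 < t \<Longrightarrow> t < 1 \<Longrightarrow>
        E (\<lambda>x. (1 - t) * f x + t * g x) \<le> (1 - t) * E f + t * E g"
  shows "\<exists>L. linear_on_fun V L \<and> (\<forall>w\<in>V. L w \<le> E (\<lambda>x. v x + w x) - E v)"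
proof -
  note W = fun_subspaceD[OF V]
  define d where "d w l = (E (\<lambda>x. v x + l * w x) - E v) / l" for w l
  define D where "D w = (INF l\<in>{0<..}. d w l)" for w
  have bdd: "bdd_below (d w ` {0<..})" if w: "w \<in> V" for w
  proof (rule bdd_belowI2)
    fix l :: real assume l: "l \<in> {0<..}"
    \<comment> \<open>With this weight \<open>v\<close> is a convex combination of v - w and v + l
      w, which bounds the quotients below by E(v) - E(v - w).\<close>
    let ?t = "1 / (1 + l)"
    have eq: "(\<lambda>x. (1 - ?t) * (v x + (-1) * w x) + ?t * (v x + l * w x)) = v"
      using l by (auto simp: fun_eq_iff divide_simps) (simp add: algebra_simps)
    have "E (\<lambda>x. (1 - ?t) * (v x + (-1) * w x) + ?t * (v x + l * w x))
       \<le> (1 - ?t) * E (\<lambda>x. v x + (-1) * w x) + ?t * E (\<lambda>x. v x + l * w x)"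
      by (rule conv[OF W(4)[OF v w] W(4)[OF v w]]) (use l in auto)
    then have "E v * (1 + l) \<le> l * E (\<lambda>x. v x + (-1) * w x) + E (\<lambda>x. v x + l * w x)"
    proof -
      have t: "1 - ?t = l * ?t" using l by (simp add: field_simps)
      assume "E (\<lambda>x. (1 - ?t) * (v x + (-1) * w x) + ?t * (v x + l * w x))
       \<le> (1 - ?t) * E (\<lambda>x. v x + (-1) * w x) + ?t * E (\<lambda>x. v x + l * w x)"
      then have "E v \<le> ?t * (l * E (\<lambda>x. v x + (-1) * w x) + E (\<lambda>x. v x + l * w x))"
        unfolding eq unfolding t by (simp only: distrib_left mult.assoc mult.left_commute[of l])
      then show ?thesis using l by (simp add: field_simps)
    qed
    then show "E v - E (\<lambda>x. v x + (-1) * w x) \<le> d w l"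
      using l by (simp add: d_def field_simps)
  qed
  have le: "D h \<le> d h t" if "h \<in> V" "0 < t" for h t
    unfolding D_def by (rule cINF_lower[OF bdd]) (use that in auto)
  have ge: "x \<le> D h" if "\<And>t. 0 < t \<Longrightarrow> x \<le> d h t" for x h
    unfolding D_def by (rule cINF_greatest) (use that in auto)
  have "sublinear_on V D" unfolding sublinear_on_def
  proof (intro conjI ballI allI impI)
    fix a b assume a: "a \<in> V" and b: "b \<in> V"
    have *: "D (\<lambda>x. a x + b x) \<le> d a s + d b t" if st: "0 < s" "0 < t" for s t
    proof -
      \<comment> \<open>The weights solve (1 - r) s = r t, so both directions receive the same
        factor \<open>?n\<close> and the combination is v + n (a + b).\<close>
      let ?r = "s / (s + t)" and ?n = "s * t / (s + t)"
      have eq: "(\<lambda>x. (1 - ?r) * (v x + s * a x) + ?r * (v x + t * b x)) = (\<lambda>x. v x + ?n * (a x + b x))"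
      proof
        fix x
        have e: "1 - ?r = t / (s + t)" using st by (simp add: field_simps)
        have *: "p * (y + s * a') + q * (y + t * b') = y + n * (a' + b')"
          if "p + q = 1" "n = s * p" "n = t * q" for p q n y a' b' :: real
        proof -
          have "p * (y + s * a') + q * (y + t * b') = (p + q) * y + (s * p) * a' + (t * q) * b'"
            by (simp add: algebra_simps)
          then show ?thesis unfolding that(1) that(2)[symmetric] that(3)[symmetric]
            by (simp add: algebra_simps)
        qed
        show "(1 - ?r) * (v x + s * a x) + ?r * (v x + t * b x) = v x + ?n * (a x + b x)"
        proof (rule *)
          show "?n = s * (1 - ?r)" unfolding e by simp
        qed simp_all
      qed
      have "E (\<lambda>x. (1 - ?r) * (v x + s * a x) + ?r * (v x + t * b x))
         \<le> (1 - ?r) * E (\<lambda>x. v x + s * a x) + ?r * E (\<lambda>x. v x + t * b x)"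
        by (rule conv[OF W(4)[OF v a] W(4)[OF v b]]) (use st in auto)
      then have "E (\<lambda>x. v x + ?n * (a x + b x)) - E v
          \<le> (1 - ?r) * (E (\<lambda>x. v x + s * a x) - E v) + ?r * (E (\<lambda>x. v x + t * b x) - E v)"
        unfolding eq by (simp add: algebra_simps)
      also have "\<dots> = ?n * (d a s + d b t)"
      proof -
        have "1 - ?r = t / (s + t)" using st by (simp add: field_simps)
        then have "?n * (A / s) = (1 - ?r) * A" "?n * (A / t) = ?r * A" for A
          using st by simp_all
        then show ?thesis by (simp only: d_def distrib_left)
      qed
      finally have "d (\<lambda>x. a x + b x) ?n \<le> (?n * (d a s + d b t)) / ?n"
        unfolding d_def[of "\<lambda>x. a x + b x"] by (rule divide_right_mono) (use st in simp)
      then have "d (\<lambda>x. a x + b x) ?n \<le> d a s + d b t" using st by simp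
      then show ?thesis using le[OF W(1)[OF a b], of ?n] st by simp
    qed
    have "D (\<lambda>x. a x + b x) - d a s \<le> D b" if "0 < s" for s
      by (rule ge) (use *[OF that] in \<open>simp add: algebra_simps\<close>)
    then have "D (\<lambda>x. a x + b x) - D b \<le> D a" by (intro ge) (simp add: algebra_simps)
    then show "D (\<lambda>x. a x + b x) \<le> D a + D b" by simp
  next
    fix a c assume a: "a \<in> V" and c: "(0::real) \<le> c"
    show "D (\<lambda>x. c * a x) \<le> c * D a"
    proof (cases "c = 0")
      case True
      then show ?thesis using le[OF W(2)[OF a, of 0], of 1] by (simp add: d_def)
    next
      case False
      have "D (\<lambda>x. c * a x) \<le> c * d a t" if t: "0 < t" for t
        using le[OF W(2)[OF a, of c], of "t / c"] t False c by (simp add: d_def field_simps)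
      then have "D (\<lambda>x. c * a x) / c \<le> D a"
        by (intro ge) (use False c in \<open>simp add: field_simps\<close>)
      then show ?thesis using False c by (simp add: field_simps)
    qed
  qed
  then obtain L where "linear_on_fun V L" "\<forall>f\<in>V. L f \<le> D f" using Hahn_Banach_fun[OF V] by blast
  moreover have "D w \<le> E (\<lambda>x. v x + w x) - E v" if "w \<in> V" for w
    using le[OF that, of 1] by (simp add: d_def)
  ultimately show ?thesis by (meson order_trans)
qed

text \<open>Vectors are read as functions on the index type; the subgradient functional is then
  determined by its values at the unit vectors, which form \<open>r\<close>.\<close>

lemma convex_on_subgradient:
  fixes F :: "real^'d::finite \<Rightarrow> real"
  assumes F: "convex_on UNIV F"
  shows "\<exists>r::real^'d. \<forall>v. F u + r \<bullet> (v - u) \<le> F v"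
proof -
  have "\<exists>L. linear_on_fun UNIV L \<and> (\<forall>w\<in>UNIV. L w \<le> F (\<chi> i. u $ i + w i) - F (\<chi> i. u $ i))"
  proof (rule convex_subgradient_fun)
    fix f g :: "'d \<Rightarrow> real" and t :: real assume "0 < t" "t < 1"
    then have "F ((1 - t) *\<^sub>R (\<chi> i. f i) + t *\<^sub>R (\<chi> i. g i)) \<le> (1 - t) * F (\<chi> i. f i) + t * F (\<chi> i. g i)"
      by (intro convex_onD[OF F]) auto
    moreover have "(1 - t) *\<^sub>R (\<chi> i. f i) + t *\<^sub>R (\<chi> i. g i) = (\<chi> i. (1 - t) * f i + t * g i)"
      by (simp add: vec_eq_iff)
    ultimately show "F (\<chi> i. (1 - t) * f i + t * g i) \<le> (1 - t) * F (\<chi> i. f i) + t * F (\<chi> i. g i)" by simp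
  qed (auto simp: fun_subspace_def)
  then obtain L where lin: "linear_on_fun UNIV L" and L: "\<And>w. L w \<le> F (\<chi> i. u $ i + w i) - F u"
    by auto
  define r :: "real^'d" where "r = (\<chi> j. L (\<lambda>i. if i = j then 1 else 0))"
  have sum: "L (\<lambda>i. \<Sum>j\<in>A. w j * (if i = j then 1 else 0)) = (\<Sum>j\<in>A. w j * r $ j)"
    if "finite A" for A and w :: "'d \<Rightarrow> real"
    using that
  proof (induction A rule: finite_induct)
    case empty
    have "L (\<lambda>x. c * f x) = c * L f" for c f using lin unfolding linear_on_fun_def by blast
    from this[of 0] show ?case by simp
  next
    case (insert a A)
    have add: "\<And>f g. L (\<lambda>x. f x + g x) = L f + L g" and hom: "\<And>f c. L (\<lambda>x. c * f x) = c * L f"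
      using lin unfolding linear_on_fun_def by blast+
    have "L (\<lambda>i. \<Sum>j\<in>insert a A. w j * (if i = j then 1 else 0))
        = L (\<lambda>i. w a * (if i = a then 1 else 0) + (\<Sum>j\<in>A. w j * (if i = j then 1 else 0)))"
      using insert(1,2) by simp
    also have "\<dots> = w a * r $ a + (\<Sum>j\<in>A. w j * r $ j)"
      unfolding add hom insert.IH by (simp add: r_def)
    finally show ?case using insert(1,2) by simp
  qed
  have L_r: "L w = (\<Sum>j\<in>UNIV. w j * r $ j)" for w
    using sum[of UNIV w] by (simp add: if_distrib cong: if_cong)
  have "F u + r \<bullet> (v - u) \<le> F v" for v
    using L[of "\<lambda>i. v $ i - u $ i"] unfolding L_r by (simp add: inner_vec_def mult.commute)
  then show ?thesis by blast
qed

section \<open>Generators and the comparison principle\<close>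

text \<open>The hub of the equivalences: each of the other characterisations is linked to this
  one.\<close>

definition convex_generator :: "(real^'d::finite \<Rightarrow> real^'d) \<Rightarrow> bool" where
  "convex_generator Q \<longleftrightarrow> convex_map Q \<and> positive_max_principle Q \<and> (\<forall>\<alpha>::real. Q (vec \<alpha>) = 0)"

text \<open>Averaging: u is the mean of n vectors, the constant n u_i and, for each j other than i,
  the vector -n (u_i - u_j) e_j. In component i, \<open>Q\<close> vanishes at the first and is
  nonpositive at the others, so convexity gives the claim.\<close>

lemma Q_operator_imp_positive_max_principle:
  fixes Q :: "real^'d::finite \<Rightarrow> real^'d"
  assumes conv: "convex_map Q" and Q: "Q_operator Q"
  shows "positive_max_principle Q"
  unfolding positive_max_principle_def
proof (intro allI impI)
  fix u :: "real^'d" and i assume max: "\<forall>j. u $ j \<le> u $ i"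
  define n where "n = real CARD('d)"
  have n: "n > 0" by (simp add: n_def)
  define y where "y j = (if j = i then vec (n * u $ i) else - ((n * (u $ i - u $ j)) *\<^sub>R axis j 1))"
    for j :: 'd
  have c: "convex_on UNIV (\<lambda>u. Q u $ i)" using conv by (simp add: convex_map_def)
  have "Q (\<Sum>j\<in>UNIV. (1/n) *\<^sub>R y j) $ i \<le> (\<Sum>j\<in>UNIV. (1/n) * Q (y j) $ i)"
    by (rule convex_on_sum[OF _ _ c]) (use n in \<open>auto simp: n_def\<close>)
  also have "\<dots> \<le> 0"
  proof (rule sum_nonpos)
    fix j
    have "Q (y j) $ i \<le> 0"
    proof (cases "j = i")
      case True
      then show ?thesis using Q by (simp add: y_def Q_operator_def)
    next
      case False
      show ?thesis
      proof (cases "u $ i = u $ j")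
        case True
        have "Q (vec 0) = 0" using Q by (simp only: Q_operator_def)
        moreover have "vec 0 = (0::real^'d)" by (simp add: vec_eq_iff)
        ultimately show ?thesis using True False by (simp add: y_def)
      next
        case ne: False
        then have "n * (u $ i - u $ j) > 0" using max n by (simp add: less_le)
        then show ?thesis using Q False unfolding Q_operator_def y_def by simp
      qed
    qed
    then show "(1/n) * Q (y j) $ i \<le> 0" using n by (simp add: mult_nonneg_nonpos divide_nonpos_pos)
  qed
  also have "(\<Sum>j\<in>UNIV. (1/n) *\<^sub>R y j) = u"
  proof (subst vec_eq_iff, intro allI)
    fix k
    have "(\<Sum>j\<in>UNIV. (1/n) *\<^sub>R y j) $ k = (\<Sum>j\<in>UNIV. (1/n) * y j $ k)"
      by (simp add: sum_component)
    also have "\<dots> = (1/n) * y i $ k + (\<Sum>j\<in>UNIV-{i}. (1/n) * y j $ k)"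
      by (simp add: sum.remove)
    also have "(\<Sum>j\<in>UNIV-{i}. (1/n) * y j $ k) = (\<Sum>j\<in>UNIV-{i}. if j = k then u $ j - u $ i else 0)"
      by (rule sum.cong) (use n in \<open>auto simp: y_def axis_def field_simps\<close>)
    also have "\<dots> = (if k = i then 0 else u $ k - u $ i)"
      by (subst sum.delta) auto
    also have "(1/n) * y i $ k = u $ i" using n by (simp add: y_def)
    finally show "(\<Sum>j\<in>UNIV. (1/n) *\<^sub>R y j) $ k = u $ k" by (auto split: if_splits)
  qed
  finally show "Q u $ i \<le> 0" .
qed

lemma positive_max_principle_imp_Q_operator:
  fixes Q :: "real^'d::finite \<Rightarrow> real^'d"
  assumes "positive_max_principle Q" and "\<forall>\<alpha>::real. Q (vec \<alpha>) = 0"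
  shows "Q_operator Q"
  using assms by (auto simp: Q_operator_def positive_max_principle_def axis_def)

lemma convex_Q_operator_iff_generator:
  "convex_map Q \<and> Q_operator Q \<longleftrightarrow> convex_generator Q"
  using Q_operator_imp_positive_max_principle positive_max_principle_imp_Q_operator
  unfolding convex_generator_def Q_operator_def by metis

section \<open>Affine minorants and Q-matrices\<close>

lemma affine_nonpos_imp_slope_nonpos:
  fixes c s :: real
  assumes "\<And>a. a > 0 \<Longrightarrow> c + a * s \<le> 0"
  shows "s \<le> 0"
proof (rule ccontr)
  assume s: "\<not> s \<le> 0"
  have "c + ((\<bar>c\<bar> + 1) / s) * s \<le> 0" using s by (intro assms) auto
  then show False using s by simp
qed

text \<open>Along a ray on which component \<open>i\<close> of \<open>Q\<close> stays nonpositive,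
  an affine minorant of it has nonpositive slope. The rays through e_i, -e_j and the two constant
  directions yield the three properties of a row of a Q-matrix.\<close>

lemma affine_minorant_row:
  fixes Q :: "real^'d::finite \<Rightarrow> real^'d" and r :: "real^'d"
  assumes Q: "positive_max_principle Q" "\<forall>\<alpha>::real. Q (vec \<alpha>) = 0"
    and minor: "\<And>v. c + r \<bullet> v \<le> Q v $ i"
  shows "r $ i \<le> 0" "j \<noteq> i \<Longrightarrow> 0 \<le> r $ j" "(\<Sum>j\<in>UNIV. r $ j) = 0"
proof -
  have ax: "r \<bullet> (a *\<^sub>R axis j 1) = a * r $ j" for a j
    by (simp add: inner_axis)
  show "r $ i \<le> 0"
  proof (rule affine_nonpos_imp_slope_nonpos)
    fix a :: real assume "a > 0"
    then have "Q (a *\<^sub>R axis i 1) $ i \<le> 0" using Q(1) by (auto simp: positive_max_principle_def axis_def)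
    then show "c + a * r $ i \<le> 0" using minor[of "a *\<^sub>R axis i 1"] by (simp only: ax)
  qed
  show "0 \<le> r $ j" if "j \<noteq> i"
  proof -
    have "- (r $ j) \<le> 0"
    proof (rule affine_nonpos_imp_slope_nonpos)
      fix a :: real assume "a > 0"
      then have "Q ((-a) *\<^sub>R axis j 1) $ i \<le> 0"
        using Q(1) that by (auto simp: positive_max_principle_def axis_def)
      then show "c + a * (- (r $ j)) \<le> 0" using minor[of "(-a) *\<^sub>R axis j 1"] unfolding ax by simp
    qed
    then show ?thesis by simp
  qed
  have vec: "c + a * (\<Sum>j\<in>UNIV. r $ j) \<le> 0" for a
  proof -
    have "r \<bullet> vec a = a * (\<Sum>j\<in>UNIV. r $ j)" by (simp add: inner_vec_def sum_distrib_left mult.commute)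
    then show ?thesis using minor[of "vec a"] Q(2) by simp
  qed
  have "(\<Sum>j\<in>UNIV. r $ j) \<le> 0" by (rule affine_nonpos_imp_slope_nonpos[of c]) (rule vec)
  moreover have "- (\<Sum>j\<in>UNIV. r $ j) \<le> 0"
    by (rule affine_nonpos_imp_slope_nonpos[of c]) (use vec[of "- a" for a] in simp)
  ultimately show "(\<Sum>j\<in>UNIV. r $ j) = 0" by simp
qed

lemma matrix_vector_mult_inner_row:
  "((q :: real^'n^'m) *v v) $ i = q $ i \<bullet> v"
  by (simp add: matrix_vector_mult_def inner_vec_def)

lemma Q_matrix_argmax:
  assumes q: "Q_matrix q" and max: "\<forall>j. u $ j \<le> u $ i"
  shows "(q *v u) $ i \<le> 0"
proof -
  have "(q *v u) $ i = (\<Sum>j\<in>UNIV. q $ i $ j * (u $ j - u $ i))"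
    using q by (simp add: matrix_vector_mult_def Q_matrix_def right_diff_distrib sum_subtractf
        flip: sum_distrib_right)
  also have "\<dots> \<le> 0"
  proof (rule sum_nonpos)
    fix j show "q $ i $ j * (u $ j - u $ i) \<le> 0"
      using q max by (cases "j = i") (auto simp: Q_matrix_def intro!: mult_nonneg_nonpos)
  qed
  finally show ?thesis .
qed

lemma Q_matrix_vec: "Q_matrix q \<Longrightarrow> q *v vec a = 0"
  by (simp add: vec_eq_iff matrix_vector_mult_def Q_matrix_def flip: sum_distrib_right)

lemma generator_subgradient:
  fixes Q :: "real^'d::finite \<Rightarrow> real^'d"
  assumes Q: "convex_generator Q"
  shows "\<exists>q. Q_matrix q \<and> (\<forall>v. Q u + q *v (v - u) \<le> Q v)"
proof -
  have "\<forall>i. \<exists>r::real^'d. \<forall>v. Q u $ i + r \<bullet> (v - u) \<le> Q v $ i"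
    using Q convex_on_subgradient unfolding convex_generator_def convex_map_def by metis
  then obtain r :: "'d \<Rightarrow> real^'d" where r: "\<And>i v. Q u $ i + r i \<bullet> (v - u) \<le> Q v $ i" by metis
  have m: "(Q u $ i - r i \<bullet> u) + r i \<bullet> v \<le> Q v $ i" for i v
    using r[of i v] by (simp add: inner_diff_right)
  have pm: "positive_max_principle Q" "\<forall>\<alpha>::real. Q (vec \<alpha>) = 0"
    using Q by (auto simp: convex_generator_def)
  have "Q_matrix (\<chi> i. r i)"
    using affine_minorant_row[OF pm m] unfolding Q_matrix_def by auto
  moreover have "Q u + (\<chi> i. r i) *v (v - u) \<le> Q v" for v
    using r by (simp add: less_eq_vec_def matrix_vector_mult_inner_row)
  ultimately show ?thesis by blast
qed

text \<open>Componentwise, \<open>f q\<close> is the negative of the convex conjugate of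
  \<open>Q\<close> at \<open>q\<close>, and \<open>P\<close> collects the Q-matrices at which it is
  finite. The subgradient at \<open>u\<close> attains the supremum at \<open>u\<close>; the one at 0
  supplies a matrix with \<open>f q0 = 0\<close>.\<close>

lemma generator_imp_sup_representation:
  fixes Q :: "real^'d::finite \<Rightarrow> real^'d"
  assumes Q: "convex_generator Q"
  shows "\<exists>P f. sup_representation Q P f"
proof -
  define P where "P = {q. Q_matrix q \<and> (\<exists>c. \<forall>v. c + q *v v \<le> Q v)}"
  define f :: "real^'d^'d \<Rightarrow> real^'d" where "f q = (\<chi> i. INF v. (Q v - q *v v) $ i)" for q
  have lower: "f q $ i \<le> (Q v - q *v v) $ i" if q: "q \<in> P" for q v i
  proof -
    obtain c where c: "\<And>v. c + q *v v \<le> Q v" using q by (auto simp: P_def)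
    have "bdd_below (range (\<lambda>v. (Q v - q *v v) $ i))"
    proof (rule bdd_belowI2)
      fix v show "c $ i \<le> (Q v - q *v v) $ i"
        using c[of v] by (auto simp: less_eq_vec_def le_diff_eq)
    qed
    then show ?thesis unfolding f_def vec_lambda_beta by (rule cINF_lower) simp
  qed
  have le: "(q *v v + f q) $ i \<le> Q v $ i" if "q \<in> P" for q v i
    using lower[OF that, of i v] by simp
  have Q0: "Q 0 = 0"
  proof -
    have "Q (vec 0) = 0" using Q by (simp only: convex_generator_def)
    moreover have "vec 0 = (0::real^'d)" by (simp add: vec_eq_iff)
    ultimately show ?thesis by simp
  qed
  have attain: "\<exists>q\<in>P. f q = Q u - q *v u" for u
  proof -
    obtain q where q: "Q_matrix q" and s: "\<And>v. Q u + q *v (v - u) \<le> Q v"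
      using generator_subgradient[OF Q] by blast
    have s': "(Q u - q *v u) + q *v v \<le> Q v" for v
      using s[of v] by (simp add: matrix_vector_mult_diff_distrib algebra_simps)
    then have qP: "q \<in> P" using q by (auto simp: P_def)
    have "f q $ i = (Q u - q *v u) $ i" for i
    proof (rule antisym[OF lower[OF qP]])
      show "(Q u - q *v u) $ i \<le> f q $ i"
        unfolding f_def vec_lambda_beta
        by (rule cINF_greatest) (use s' in \<open>auto simp: less_eq_vec_def le_diff_eq\<close>)
    qed
    then show ?thesis using qP by (auto simp: vec_eq_iff)
  qed
  have "sup_representation Q P f"
    unfolding sup_representation_def
  proof (intro conjI allI ballI)
    show "Q_matrix q" if "q \<in> P" for q using that by (simp add: P_def)
    show "\<exists>q0\<in>P. f q0 = 0" using attain[of 0] Q0 by auto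
    show "f q \<le> 0" if "q \<in> P" for q using le[OF that, of 0] Q0 by (simp add: less_eq_vec_def)
    fix u i
    show bdd: "bdd_above ((\<lambda>q. (q *v u + f q) $ i) ` P)" using le by (rule bdd_aboveI2)
    obtain q where q: "q \<in> P" "f q = Q u - q *v u" using attain by blast
    show "Q u $ i = (SUP q\<in>P. (q *v u + f q) $ i)"
    proof (rule antisym)
      show "Q u $ i \<le> (SUP q\<in>P. (q *v u + f q) $ i)"
        using cSUP_upper[OF q(1) bdd] q(2) by simp
      show "(SUP q\<in>P. (q *v u + f q) $ i) \<le> Q u $ i"
        by (rule cSUP_least) (use q le in auto)
    qed
  qed
  then show ?thesis by blast
qed

lemma sup_representation_le:
  "sup_representation Q P f \<Longrightarrow> q \<in> P \<Longrightarrow> (q *v u + f q) $ i \<le> Q u $ i"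
  unfolding sup_representation_def by (metis (no_types, lifting) cSUP_upper)

lemma sup_representation_least:
  "sup_representation Q P f \<Longrightarrow> (\<And>q. q \<in> P \<Longrightarrow> (q *v u + f q) $ i \<le> b) \<Longrightarrow> Q u $ i \<le> b"
  unfolding sup_representation_def by (metis (no_types, lifting) cSUP_least empty_iff)

lemma sup_representation_imp_generator:
  fixes Q :: "real^'d::finite \<Rightarrow> real^'d"
  assumes Q: "sup_representation Q P f"
  shows "convex_generator Q"
proof -
  have qm: "Q_matrix q" and f: "f q $ i \<le> 0" if "q \<in> P" for q i
    using Q that by (auto simp: sup_representation_def less_eq_vec_def)
  note le = sup_representation_le[OF Q] and least = sup_representation_least[OF Q]
  have "convex_on UNIV (\<lambda>u. Q u $ i)" for i
    unfolding convex_on_def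
  proof (intro conjI ballI allI impI)
    fix x y :: "real^'d" and u v :: real assume uv: "0 \<le> u" "0 \<le> v" "u + v = 1"
    show "Q (u *\<^sub>R x + v *\<^sub>R y) $ i \<le> u * Q x $ i + v * Q y $ i"
    proof (rule least)
      fix q assume q: "q \<in> P"
      have "f q $ i = u * f q $ i + v * f q $ i" using uv by (metis distrib_right mult_1)
      then have "(q *v (u *\<^sub>R x + v *\<^sub>R y) + f q) $ i = u * (q *v x + f q) $ i + v * (q *v y + f q) $ i"
        by (simp add: matrix_vector_right_distrib vector_scaleR_matrix_ac matrix_vector_mult_scaleR algebra_simps)
      also have "\<dots> \<le> u * Q x $ i + v * Q y $ i"
        by (intro add_mono mult_left_mono le q uv)
      finally show "(q *v (u *\<^sub>R x + v *\<^sub>R y) + f q) $ i \<le> u * Q x $ i + v * Q y $ i" .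
    qed
  qed simp
  moreover have "Q u $ i \<le> 0" if "\<forall>j. u $ j \<le> u $ i" for u i
    by (rule least) (use Q_matrix_argmax[OF qm that] f in \<open>fastforce intro: add_nonpos_nonpos\<close>)
  moreover have "Q (vec a) = 0" for a
  proof (subst vec_eq_iff, intro allI antisym)
    obtain q0 where q0: "q0 \<in> P" "f q0 = 0" using Q by (auto simp: sup_representation_def)
    fix i
    show "Q (vec a) $ i \<le> 0 $ i" by (rule least) (use f qm in \<open>simp add: Q_matrix_vec\<close>)
    show "0 $ i \<le> Q (vec a) $ i" using le[OF q0(1), of "vec a" i] q0 qm by (simp add: Q_matrix_vec)
  qed
  ultimately show ?thesis by (auto simp: convex_generator_def convex_map_def positive_max_principle_def)
qed

lemma generator_argmax_le:
  fixes Q :: "real^'d::finite \<Rightarrow> real^'d"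
  assumes Q: "convex_generator Q" and max: "\<forall>j. (v - w) $ j \<le> (v - w) $ i"
  shows "Q v $ i \<le> Q w $ i"
proof -
  obtain q where q: "Q_matrix q" "\<And>w. Q v + q *v (w - v) \<le> Q w"
    using generator_subgradient[OF Q] by blast
  have "Q v $ i + (q *v (w - v)) $ i \<le> Q w $ i" using q(2)[of w] by (simp add: less_eq_vec_def)
  moreover have "q *v (w - v) = - (q *v (v - w))"
    by (simp add: matrix_vector_mult_diff_distrib)
  ultimately show ?thesis using Q_matrix_argmax[OF q(1) max] by simp
qed

section \<open>Maximum and comparison principles for differential equations\<close>

lemma ex_vec_argmax: "\<exists>l. \<forall>j. (u :: real^'d::finite) $ j \<le> u $ l"
proof -
  have "Max (range (\<lambda>j. u $ j)) \<in> range (\<lambda>j. u $ j)" by (rule Max_in) auto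
  then obtain l where "u $ l = Max (range (\<lambda>j. u $ j))" by force
  then have "u $ j \<le> u $ l" for j by (metis Max_ge finite finite_imageI rangeI)
  then show ?thesis by blast
qed

text \<open>The barrier \<open>c\<close> is tilted to c + e (1 + s). At the first time at which some
  component reaches it, the largest component has derivative below \<open>e\<close>, so it was
  strictly above the barrier shortly before, a contradiction.\<close>

lemma ode_max_principle:
  fixes z :: "real \<Rightarrow> real^'d::finite"
  assumes der: "\<And>t. 0 \<le> t \<Longrightarrow> (z has_vector_derivative z' t) (at t within {0..})"
    and max: "\<And>t i. 0 < t \<Longrightarrow> (\<forall>j. z t $ j \<le> z t $ i) \<Longrightarrow> z' t $ i \<le> 0"
    and init: "\<And>i. z 0 $ i \<le> c" and t: "0 \<le> t"
  shows "z t $ i \<le> c"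
proof (rule ccontr)
  assume "\<not> z t $ i \<le> c"
  then have gt: "z t $ i > c" by simp
  \<comment> \<open>The total tilt \<open>e * (1 + t)\<close> is half the assumed excess, so the
    barrier is still exceeded at time \<open>t\<close>.\<close>
  define e where "e = (z t $ i - c) / 2 / (1 + t)"
  have e: "e > 0" using gt t by (simp add: e_def)
  define g where "g k s = z s $ k - c - e * (1 + s)" for k s
  have der_g: "(g k has_real_derivative z' s $ k - e) (at s within {0..})" if "0 \<le> s" for k s
  proof -
    have "((\<lambda>s. z s $ k) has_real_derivative z' s $ k) (at s within {0..})"
      using bounded_linear.has_vector_derivative[OF bounded_linear_vec_nth der[OF that], of k]
      by (simp add: has_real_derivative_iff_has_vector_derivative)
    then show ?thesis unfolding g_def by (auto intro!: derivative_eq_intros)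
  qed
  have cont: "continuous_on {0..t} (g k)" for k
    by (rule DERIV_continuous_on[where D = "\<lambda>s. z' s $ k - e"], rule DERIV_subset[OF der_g]) auto
  define A where "A = (\<Union>k. {s\<in>{0..t}. 0 \<le> g k s})"
  have "compact ({0..t} \<inter> g k -` {0..})" for k
    using continuous_closed_preimage[OF cont, of "{0..}"]
    by (auto simp: compact_eq_bounded_closed intro: bounded_subset[OF bounded_closed_interval[of 0 t]])
  moreover have "A = (\<Union>k. {0..t} \<inter> g k -` {0..})" by (auto simp: A_def)
  ultimately have "compact A" by (metis compact_UN finite)
  moreover have "g i t \<ge> 0"
  proof -
    have "1 + t \<noteq> 0" using t by simp
    then have "e * (1 + t) = (z t $ i - c) / 2" 
      unfolding e_def by (metis nonzero_mult_div_cancel_right times_divide_eq_left)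
    then show ?thesis using gt by (simp add: g_def)
  qed
  then have "t \<in> A" using t by (auto simp: A_def)
  ultimately obtain s where s: "s \<in> A" "\<And>r. r \<in> A \<Longrightarrow> s \<le> r"
    by (metis compact_attains_inf empty_iff)
  have s0: "0 \<le> s" "s \<le> t" using s(1) by (auto simp: A_def)
  obtain k where k: "g k s \<ge> 0" using s(1) by (auto simp: A_def)
  obtain l where l: "\<And>j. z s $ j \<le> z s $ l" using ex_vec_argmax by blast
  have gl: "g l s \<ge> 0" using k l[of k] by (simp add: g_def)
  \<comment> \<open>The 1 in \<open>1 + s\<close> lifts the barrier strictly above \<open>c\<close>
    at time 0, so the first crossing leaves room to its left.\<close>
  have "s \<noteq> 0" using gl init[of l] e by (auto simp: g_def)
  then have sp: "s > 0" using s0 by simp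
  have "z' s $ l - e < 0" using max[OF sp, of l] l e by force
  from has_real_derivative_neg_dec_left[OF der_g[OF s0(1)] this]
  obtain d where d: "d > 0" "\<And>h. 0 < h \<Longrightarrow> s - h \<in> {0..} \<Longrightarrow> h < d \<Longrightarrow> g l s < g l (s - h)" by blast
  define h where "h = min (d/2) s"
  have h: "0 < h" "h < d" "h \<le> s" using d(1) sp by (auto simp: h_def)
  then have "g l (s - h) > 0" using d(2)[of h] gl by simp
  then have "s - h \<in> A" using s0 h by (auto simp: A_def intro: less_imp_le)
  then show False using s(2)[of "s - h"] h by simp
qed

text \<open>At an index where v - w is largest, v' - w' \<le> Q(v) - Q(w) \<le> 0 in that component.
  The maximum principle carries the initial bound \<open>c\<close> along: \<open>c = 0\<close> gives
  monotonicity, other values give compatibility with adding constants.\<close>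

lemma generator_comparison:
  fixes Q :: "real^'d::finite \<Rightarrow> real^'d"
  assumes Q: "convex_generator Q"
    and v: "\<And>t. 0 \<le> t \<Longrightarrow> (v has_vector_derivative v' t) (at t within {0..})"
    and w: "\<And>t. 0 \<le> t \<Longrightarrow> (w has_vector_derivative w' t) (at t within {0..})"
    and sub: "\<And>t. 0 \<le> t \<Longrightarrow> v' t \<le> Q (v t)" and super: "\<And>t. 0 \<le> t \<Longrightarrow> Q (w t) \<le> w' t"
    and init: "\<And>i. v 0 $ i \<le> w 0 $ i + c" and t: "0 \<le> t"
  shows "v t $ i \<le> w t $ i + c"
proof -
  have "(v t - w t) $ i \<le> c"
  proof (rule ode_max_principle[where z' = "\<lambda>t. v' t - w' t" and z = "\<lambda>t. v t - w t"])
    fix t :: real and i assume "0 < t" and max: "\<forall>j. (v t - w t) $ j \<le> (v t - w t) $ i"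
    then show "(v' t - w' t) $ i \<le> 0"
      using generator_argmax_le[OF Q max] sub[of t] super[of t]
      by (simp add: less_eq_vec_def) (meson order_trans)
  qed (use v w init t in \<open>auto intro!: derivative_intros simp: algebra_simps\<close>)
  then show ?thesis by simp
qed

section \<open>The semigroup generated by the differential equation\<close>

lemma has_vector_derivative_vec_iff:
  fixes f :: "real \<Rightarrow> real^'d::finite"
  shows "(f has_vector_derivative D) (at x within S) \<longleftrightarrow>
    (\<forall>i. ((\<lambda>t. f t $ i) has_real_derivative D $ i) (at x within S))"
proof
  assume "(f has_vector_derivative D) (at x within S)"
  then show "\<forall>i. ((\<lambda>t. f t $ i) has_real_derivative D $ i) (at x within S)"
    using bounded_linear.has_vector_derivative[OF bounded_linear_vec_nth, of f D "at x within S"]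
    by (simp add: has_real_derivative_iff_has_vector_derivative)
next
  assume *: "\<forall>i. ((\<lambda>t. f t $ i) has_real_derivative D $ i) (at x within S)"
  show "(f has_vector_derivative D) (at x within S)"
    unfolding has_vector_derivative_def
  proof (subst has_derivative_componentwise_within, intro ballI)
    fix b :: "real^'d" assume "b \<in> Basis"
    then obtain i where "b = axis i 1" by (auto simp: Basis_vec_def)
    then show "((\<lambda>t. f t \<bullet> b) has_derivative (\<lambda>t. (t *\<^sub>R D) \<bullet> b)) (at x within S)"
      using * by (simp add: inner_axis has_field_derivative_def mult.commute[of _ "D $ i"])
  qed
qed

lemma has_vector_derivative_right_iff:
  fixes f :: "real \<Rightarrow> real^'d::finite"
  shows "(f has_vector_derivative D) (at x within {x..}) \<longleftrightarrow>
    ((\<lambda>h. (1 / h) *\<^sub>R (f (x + h) - f x)) \<longlongrightarrow> D) (at_right 0)"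
proof -
  have "at x within {x..} = at_right x"
    by (rule at_within_nhd[of _ UNIV]) auto
  then have "(f has_vector_derivative D) (at x within {x..}) \<longleftrightarrow>
      (\<forall>i. ((\<lambda>y. (f y $ i - f x $ i) / (y - x)) \<longlongrightarrow> D $ i) (at_right x))"
    by (simp add: has_vector_derivative_vec_iff has_field_derivative_iff)
  also have "\<dots> \<longleftrightarrow> (\<forall>i. ((\<lambda>h. (f (x + h) $ i - f x $ i) / h) \<longlongrightarrow> D $ i) (at_right 0))"
    by (subst at_right_to_0) (simp add: filterlim_filtermap add.commute)
  also have "\<dots> \<longleftrightarrow> ((\<lambda>h. (1 / h) *\<^sub>R (f (x + h) - f x)) \<longlongrightarrow> D) (at_right 0)"
    by (auto intro: vec_tendstoI dest: tendsto_vec_nth)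
  finally show ?thesis .
qed

lemma has_vector_derivative_within_atLeast:
  fixes f :: "real \<Rightarrow> 'a::real_normed_vector"
  assumes "(f has_vector_derivative D) (at t within {a..b})" "t < b"
  shows "(f has_vector_derivative D) (at t within {a..})"
proof -
  have "at t within {a..} = at t within {a..b}"
    by (rule at_within_nhd[of _ "{..<b}"]) (use assms in auto)
  then show ?thesis using assms by simp
qed

lemma integral_has_vector_derivative_atLeast:
  fixes k :: "real \<Rightarrow> 'a::banach"
  assumes "continuous_on {0..} k" "0 \<le> t"
  shows "((\<lambda>t. integral {0..t} k) has_vector_derivative k t) (at t within {0..})"
  by (rule has_vector_derivative_within_atLeast[where b = "t + 1"], rule integral_has_vector_derivative)
    (use assms in \<open>auto intro: continuous_on_subset\<close>)

lemma continuous_on_atLeast_if: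
  fixes f :: "real \<Rightarrow> 'a::topological_space"
  assumes "\<And>T. 0 < T \<Longrightarrow> continuous_on {0..T} f"
  shows "continuous_on {0..} f"
  unfolding continuous_on_eq_continuous_within
proof
  fix t :: real assume t: "t \<in> {0..}"
  have "at t within {0..} = at t within {0..t+1}"
    by (rule at_within_nhd[of _ "{..<t+1}"]) auto
  then show "continuous (at t within {0..}) f"
    using assms[of "t+1"] t by (auto simp: continuous_on_eq_continuous_within)
qed

text \<open>One integration in the Picard estimate: the bound of order \<open>n\<close> reproduces
  itself at order \<open>Suc n\<close>.\<close>

lemma has_integral_scaled_power:
  assumes "0 \<le> (t::real)"
  shows "((\<lambda>s. L * (M * (L * s) ^ n / fact n)) has_integral M * (L * t) ^ Suc n / fact (Suc n)) {0..t}"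
proof -
  have "((\<lambda>s. L * (M * (L * s) ^ n / fact n)) has_integral
      M * (L * t) ^ Suc n / fact (Suc n) - M * (L * 0) ^ Suc n / fact (Suc n)) {0..t}"
  proof (rule fundamental_theorem_of_calculus[OF assms])
    fix s :: real
    have "((\<lambda>s. M * (L * s) ^ Suc n / fact (Suc n)) has_real_derivative
        M * (real (Suc n) * (L * s) ^ n * L) / fact (Suc n)) (at s within {0..t})"
      by (auto intro!: derivative_eq_intros simp del: power_Suc)
    also have "M * (real (Suc n) * (L * s) ^ n * L) / fact (Suc n) = L * (M * (L * s) ^ n / fact n)"
      by (simp add: field_simps del: of_nat_Suc)
    finally show "((\<lambda>s. M * (L * s) ^ Suc n / fact (Suc n)) has_vector_derivative
        L * (M * (L * s) ^ n / fact n)) (at s within {0..t})"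
      by (simp add: has_real_derivative_iff_has_vector_derivative)
  qed
  then show ?thesis by simp
qed

text \<open>Successive Picard iterates differ by at most a multiple of (L t)^n / n!, which is
  summable on every bounded interval, so the limit exists for all times without patching local
  solutions.\<close>

lemma lipschitz_ode_global_solution:
  fixes F :: "'a::banach \<Rightarrow> 'a"
  assumes lip: "\<And>x y. norm (F x - F y) \<le> L * norm (x - y)" and L: "0 \<le> L"
  shows "\<exists>u. u 0 = u0 \<and> (\<forall>t\<ge>0. (u has_vector_derivative F (u t)) (at t within {0..}))"
proof -
  define p where "p = rec_nat (\<lambda>t::real. u0) (\<lambda>n g t. u0 + integral {0..t} (\<lambda>s. F (g s)))"
  have p0: "p 0 = (\<lambda>t. u0)" and pS: "\<And>n. p (Suc n) = (\<lambda>t. u0 + integral {0..t} (\<lambda>s. F (p n s)))"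
    by (auto simp: p_def)
  have contF: "continuous_on UNIV F"
    by (rule lipschitz_on_continuous_on[of L], rule lipschitz_onI) (use lip L in \<open>auto simp: dist_norm\<close>)
  have contF': "continuous_on S (\<lambda>s. F (g s))" if "continuous_on S g" for S and g :: "real \<Rightarrow> 'a"
    using continuous_on_compose2[OF contF that] by auto
  have contp: "continuous_on {0..T} (p n)" for n T
  proof (induction n)
    case (Suc n)
    then show ?case unfolding pS
      by (intro continuous_intros indefinite_integral_continuous_1 integrable_continuous_real contF')
  qed (simp add: p0)
  have int: "(\<lambda>s. F (p n s)) integrable_on {0..t}" for n t
    by (rule integrable_continuous_real[OF contF'[OF contp]])
  \<comment> \<open>The factor \<open>T * norm (F u0)\<close> bounds the first increment, of size
    \<open>t * norm (F u0)\<close>, on all of \<open>{0..T}\<close>.\<close>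
  have bound: "norm (p (Suc n) t - p n t) \<le> (T * norm (F u0)) * (L * t) ^ n / fact n"
    if t: "0 \<le> t" "t \<le> T" for n t T
    using t
  proof (induction n arbitrary: t)
    case 0
    then show ?case by (simp add: pS p0 mult_right_mono)
  next
    case (Suc n)
    let ?M = "T * norm (F u0)"
    have "p (Suc (Suc n)) t - p (Suc n) t = integral {0..t} (\<lambda>s. F (p (Suc n) s) - F (p n s))"
      using integral_diff[OF int[of "Suc n" t] int[of n t]] fun_cong[OF pS, of "Suc n" t] fun_cong[OF pS, of n t] by simp
    moreover have "norm (integral {0..t} (\<lambda>s. F (p (Suc n) s) - F (p n s)))
        \<le> integral {0..t} (\<lambda>s. L * (?M * (L * s) ^ n / fact n))"
    proof (rule integral_norm_bound_integral)
      show "(\<lambda>s. F (p (Suc n) s) - F (p n s)) integrable_on {0..t}" by (intro integrable_diff int)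
      show "(\<lambda>s. L * (?M * (L * s) ^ n / fact n)) integrable_on {0..t}"
        using has_integral_scaled_power[OF Suc.prems(1)] by blast
      fix s assume "s \<in> {0..t}"
      then have "norm (p (Suc n) s - p n s) \<le> ?M * (L * s) ^ n / fact n" using Suc by simp
      then show "norm (F (p (Suc n) s) - F (p n s)) \<le> L * (?M * (L * s) ^ n / fact n)"
        using lip[of "p (Suc n) s" "p n s"] L by (meson mult_left_mono order_trans)
    qed
    moreover have "integral {0..t} (\<lambda>s. L * (?M * (L * s) ^ n / fact n)) = ?M * (L * t) ^ Suc n / fact (Suc n)"
      by (rule integral_unique[OF has_integral_scaled_power[OF Suc.prems(1)]])
    ultimately show ?case by simp
  qed
  define u where "u t = u0 + (\<Sum>n. p (Suc n) t - p n t)" for t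
  have tel: "p n t = u0 + (\<Sum>k<n. p (Suc k) t - p k t)" for n t
    by (subst sum_lessThan_telescope) (simp add: p0)
  have unif: "uniform_limit {0..T} p u sequentially" if T: "0 < T" for T
  proof -
    have "uniform_limit {0..T} (\<lambda>n t. \<Sum>k<n. p (Suc k) t - p k t) (\<lambda>t. \<Sum>k. p (Suc k) t - p k t) sequentially"
    proof (rule Weierstrass_m_test)
      fix n t assume "t \<in> {0..T}"
      then have t: "0 \<le> t" "t \<le> T" by auto
      have "(L * t) ^ n \<le> (L * T) ^ n" using t L by (intro power_mono mult_left_mono) auto
      then have "(T * norm (F u0)) * (L * t) ^ n / fact n \<le> (T * norm (F u0)) * (inverse (fact n) * (L * T) ^ n)"
        using T by (simp add: divide_simps mult_left_mono)
      then show "norm (p (Suc n) t - p n t) \<le> (T * norm (F u0)) * (inverse (fact n) * (L * T) ^ n)"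
        using bound[OF t, of n] by linarith
    next
      show "summable (\<lambda>n. (T * norm (F u0)) * (inverse (fact n) * (L * T) ^ n))"
        by (intro summable_mult summable_exp)
    qed
    then have "uniform_limit {0..T} (\<lambda>n t. u0 + (\<Sum>k<n. p (Suc k) t - p k t)) u sequentially"
      unfolding u_def by (intro uniform_limit_intros)
    then show ?thesis by (simp flip: tel)
  qed
  have contu: "continuous_on {0..} u"
    by (rule continuous_on_atLeast_if, rule uniform_limit_theorem[OF _ unif])
      (auto simp: contp)
  have eq: "u t = u0 + integral {0..t} (\<lambda>s. F (u s))" if t: "0 \<le> t" for t
  proof -
    have un: "uniform_limit {0..t} (\<lambda>n s. F (p n s)) (\<lambda>s. F (u s)) sequentially"
    proof (rule uniform_limitI)
      fix e :: real assume e: "e > 0"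
      have "\<forall>\<^sub>F n in sequentially. \<forall>s\<in>{0..t+1}. dist (p n s) (u s) < e / (L + 1)"
        using uniform_limitD[OF unif[of "t+1"], of "e / (L+1)"] e t L by simp
      then show "\<forall>\<^sub>F n in sequentially. \<forall>s\<in>{0..t}. dist (F (p n s)) (F (u s)) < e"
      proof (rule eventually_mono, intro ballI)
        fix n s assume *: "\<forall>s\<in>{0..t+1}. dist (p n s) (u s) < e / (L + 1)" and s: "s \<in> {0..t}"
        have "dist (F (p n s)) (F (u s)) \<le> L * dist (p n s) (u s)" using lip by (simp add: dist_norm)
        \<comment> \<open>Enlarging \<open>L\<close> to \<open>L + 1\<close> keeps the divisor in
          \<open>e / (L + 1)\<close> positive even for \<open>L = 0\<close>.\<close>
        also have "\<dots> \<le> (L + 1) * dist (p n s) (u s)" by (simp add: mult_right_mono)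
        also have "\<dots> < (L + 1) * (e / (L + 1))" using * s L by (intro mult_strict_left_mono) auto
        also have "\<dots> = e" using L by simp
        finally show "dist (F (p n s)) (F (u s)) < e" .
      qed
    qed
    from uniform_limit_integral[OF un contF'[OF contp]] obtain I J where
      I: "\<And>n. ((\<lambda>s. F (p n s)) has_integral I n) {0..t}" and J: "((\<lambda>s. F (u s)) has_integral J) {0..t}"
      and lim: "(I \<longlongrightarrow> J) sequentially" by auto
    have "p (Suc n) t = u0 + I n" for n using I[of n] by (simp add: pS integral_unique)
    then have "(\<lambda>n. p (Suc n) t) \<longlonglongrightarrow> u0 + J" using tendsto_add[OF tendsto_const lim] by simp
    moreover have "(\<lambda>n. p n t) \<longlonglongrightarrow> u t"
      using tendsto_uniform_limitI[OF unif[of "t+1"], of t] t by simp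
    ultimately have "u t = u0 + J" using LIMSEQ_Suc LIMSEQ_unique by blast
    then show ?thesis using J by (simp add: integral_unique)
  qed
  have "(u has_vector_derivative F (u t)) (at t within {0..})" if t: "0 \<le> t" for t
  proof -
    have "((\<lambda>t. u0 + integral {0..t} (\<lambda>s. F (u s))) has_vector_derivative 0 + F (u t)) (at t within {0..})"
      by (intro derivative_intros integral_has_vector_derivative_atLeast contF' contu t)
    then show ?thesis
      by (rule has_vector_derivative_transform[rotated 2, THEN has_vector_derivative_eq_rhs]) (use t eq in auto)
  qed
  moreover have "u 0 = u0" using eq[of 0] by simp
  ultimately show ?thesis by blast
qed

lemma generator_continuous:
  assumes "convex_generator Q"
  shows "continuous_on UNIV Q"
proof -
  have "continuous_on UNIV (\<lambda>u. Q u $ i)" for i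
    using assms by (intro convex_on_continuous) (auto simp: convex_generator_def convex_map_def)
  then show ?thesis using continuous_on_vec_lambda[of UNIV "\<lambda>i u. Q u $ i"] by (simp add: vec_nth_inverse)
qed

lemma generator_zero: "convex_generator Q \<Longrightarrow> Q 0 = 0"
proof -
  have "vec 0 = (0::real^'d)" by (simp add: vec_eq_iff)
  then show "convex_generator Q \<Longrightarrow> Q 0 = 0" unfolding convex_generator_def by metis
qed

lemma norm_le_card_bound:
  assumes "\<And>i. \<bar>(u :: real^'d::finite) $ i\<bar> \<le> B"
  shows "norm u \<le> real CARD('d) * B"
proof -
  have "norm u \<le> (\<Sum>i\<in>UNIV. \<bar>u $ i\<bar>)" by (rule norm_le_l1_cart)
  also have "\<dots> \<le> (\<Sum>i\<in>(UNIV::'d set). B)" by (intro sum_mono assms)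
  finally show ?thesis by simp
qed

lemma generator_bounded_on_ball:
  fixes Q :: "real^'d::finite \<Rightarrow> real^'d"
  assumes Q: "convex_generator Q"
  obtains C where "0 \<le> C" "\<And>u. norm u \<le> R \<Longrightarrow> norm (Q u) \<le> C"
proof -
  have "compact (Q ` cball 0 R)"
    by (rule compact_continuous_image[OF continuous_on_subset[OF generator_continuous[OF Q]]]) auto
  then obtain C where "\<And>x. x \<in> Q ` cball 0 R \<Longrightarrow> norm x \<le> C"
    using compact_imp_bounded bounded_iff by metis
  then have "norm (Q u) \<le> max 0 C" if "norm u \<le> R" for u using that by (fastforce simp: le_max_iff_disj)
  then show ?thesis using that[of "max 0 C"] by simp
qed

text \<open>A step of length 1 along a subgradient stays in the ball of radius \<open>R + 1\<close>,
  where \<open>Q\<close> is bounded by \<open>C\<close>; hence every subgradient on the smaller ball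
  has norm at most \<open>2 * C\<close>, a Lipschitz constant for each component.\<close>

lemma generator_lipschitz_on_ball:
  fixes Q :: "real^'d::finite \<Rightarrow> real^'d"
  assumes Q: "convex_generator Q"
  obtains L where "0 \<le> L" "\<And>u v. norm u \<le> R \<Longrightarrow> norm v \<le> R \<Longrightarrow> norm (Q u - Q v) \<le> L * norm (u - v)"
proof -
  obtain C where C: "0 \<le> C" "\<And>u. norm u \<le> R + 1 \<Longrightarrow> norm (Q u) \<le> C"
    using generator_bounded_on_ball[OF Q, of "R+1"] by metis
  have comp: "Q u $ i - Q v $ i \<le> (2 * C) * norm (u - v)" if u: "norm u \<le> R" for u v i
  proof -
    have "convex_on UNIV (\<lambda>u. Q u $ i)" using Q by (simp add: convex_generator_def convex_map_def)
    then obtain r where r: "\<And>w. Q u $ i + r \<bullet> (w - u) \<le> Q w $ i" using convex_on_subgradient by blast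
    have "norm r \<le> 2 * C"
    proof (cases "r = 0")
      case False
      let ?w = "u + (1 / norm r) *\<^sub>R r"
      have w: "norm ?w \<le> R + 1" using u False by (intro norm_triangle_le) simp
      have "r \<bullet> (?w - u) = norm r" using False by (simp add: dot_square_norm power2_eq_square)
      then have "norm r \<le> Q ?w $ i - Q u $ i" using r[of ?w] by simp
      moreover have "\<bar>Q ?w $ i\<bar> \<le> C" "\<bar>Q u $ i\<bar> \<le> C"
        using C(2)[OF w] C(2)[of u] u component_le_norm_cart[of "Q ?w" i] component_le_norm_cart[of "Q u" i]
        by linarith+
      ultimately show ?thesis by linarith
    qed (use C in simp)
    have "Q u $ i - Q v $ i \<le> r \<bullet> (u - v)" using r[of v] by (simp add: inner_diff_right)
    also have "\<dots> \<le> norm r * norm (u - v)" by (rule norm_cauchy_schwarz)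
    also have "\<dots> \<le> (2 * C) * norm (u - v)" by (rule mult_right_mono) (use \<open>norm r \<le> 2 * C\<close> in auto)
    finally show ?thesis .
  qed
  have "norm (Q u - Q v) \<le> (real CARD('d) * (2 * C)) * norm (u - v)" if "norm u \<le> R" "norm v \<le> R" for u v
    using norm_le_card_bound[of "Q u - Q v" "2 * C * norm (u - v)"] comp[OF that(1), of _ v] comp[OF that(2), of _ u]
    by (simp add: abs_le_iff norm_minus_commute[of v u] mult.assoc)
  then show ?thesis using that[of "real CARD('d) * (2 * C)"] C(1) by simp
qed

text \<open>\<open>Q\<close> may grow superlinearly; composed with the clamp it is globally Lipschitz.\<close>

lemma classical_solution_exists:
  fixes Q :: "real^'d::finite \<Rightarrow> real^'d"
  assumes Q: "convex_generator Q"
  shows "\<exists>u. classical_solution Q u0 u"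
proof -
  define R where "R = norm u0"
  define cl :: "real^'d \<Rightarrow> real^'d" where "cl u = (\<chi> i. max (- R) (min R (u $ i)))" for u
  have R: "0 \<le> R" by (simp add: R_def)
  have cl_norm: "norm (cl u) \<le> real CARD('d) * R" for u
    by (rule norm_le_card_bound) (use R in \<open>auto simp: cl_def\<close>)
  have cl_diff: "norm (cl u - cl v) \<le> norm (u - v)" for u v
    by (rule norm_le_componentwise_cart) (auto simp: cl_def max_def min_def)
  obtain L where L: "0 \<le> L"
    "\<And>u v. norm u \<le> real CARD('d) * R \<Longrightarrow> norm v \<le> real CARD('d) * R \<Longrightarrow> norm (Q u - Q v) \<le> L * norm (u - v)"
    using generator_lipschitz_on_ball[OF Q] by metis
  have "norm (Q (cl u) - Q (cl v)) \<le> L * norm (u - v)" for u v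
    using L(2)[OF cl_norm cl_norm, of u v] mult_left_mono[OF cl_diff L(1), of u v] by linarith
  from lipschitz_ode_global_solution[of "\<lambda>u. Q (cl u)", OF this L(1)]
  obtain u where u0: "u 0 = u0" and u: "\<And>t. 0 \<le> t \<Longrightarrow> (u has_vector_derivative Q (cl (u t))) (at t within {0..})"
    by blast
  \<comment> \<open>The clamp preserves the order of the entries, so an index maximal for
    \<open>u s\<close> is maximal for \<open>cl (u s)\<close> and the maximum principle still
    governs the modified equation.\<close>
  have cl_mono: "cl u $ i \<le> cl u $ j" if "u $ i \<le> u $ j" for u i j
    unfolding cl_def using that by (auto intro!: max.mono min.mono)
  have le: "\<bar>u0 $ i\<bar> \<le> R" for i unfolding R_def by (rule component_le_norm_cart)
  have upper: "u t $ i \<le> R" if "0 \<le> t" for t i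
  proof (rule ode_max_principle[OF u _ _ that])
    fix s j assume "\<forall>k. u s $ k \<le> u s $ j"
    then have "\<forall>k. cl (u s) $ k \<le> cl (u s) $ j" by (simp add: cl_mono)
    then show "Q (cl (u s)) $ j \<le> 0" using Q by (simp add: convex_generator_def positive_max_principle_def)
  qed (use le u0 in \<open>auto simp: abs_le_iff\<close>)
  have lower: "(- u t) $ i \<le> R" if "0 \<le> t" for t i
  proof (rule ode_max_principle[where z = "\<lambda>t. - u t", OF _ _ _ that])
    show "((\<lambda>t. - u t) has_vector_derivative - Q (cl (u t))) (at t within {0..})" if "0 \<le> t" for t
      by (intro derivative_intros u that)
    fix s j assume "\<forall>k. (- u s) $ k \<le> (- u s) $ j"
    \<comment> \<open>The maximum principle by itself bounds \<open>Q\<close> only from above. The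
      lower bound comes from comparing with 0: where \<open>- u s\<close> is maximal, the component
      of \<open>Q (cl (u s))\<close> is at least that of \<open>Q 0 = 0\<close>.\<close>
    then have "\<forall>k. (0 - cl (u s)) $ k \<le> (0 - cl (u s)) $ j" by (simp add: cl_mono)
    from generator_argmax_le[OF Q this] show "(- Q (cl (u s))) $ j \<le> 0" using generator_zero[OF Q] by simp
  qed (use le u0 in \<open>auto simp: abs_le_iff\<close>)
  have "cl (u t) = u t" if "0 \<le> t" for t
    using upper[OF that] lower[OF that] by (auto simp: cl_def vec_eq_iff max_def min_def)
      (smt (verit, best))+
  then have der: "(u has_vector_derivative Q (u t)) (at t within {0..})" if "0 \<le> t" for t
    using u[OF that] that by simp
  then have "continuous_on {0..} u"
    by (auto simp: continuous_on_eq_continuous_within intro: has_vector_derivative_continuous)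
  then have "continuous_on {0..} (\<lambda>t. Q (u t))"
    using continuous_on_compose2[OF generator_continuous[OF Q]] by auto
  then show ?thesis using der u0 by (auto simp: classical_solution_def)
qed

section \<open>The solution flow and its properties\<close>

lemma classical_solution_unique:
  assumes Q: "convex_generator Q" and u: "classical_solution Q u0 u" and v: "classical_solution Q u0 v"
    and t: "0 \<le> t"
  shows "u t = v t"
proof -
  have "u t $ i \<le> v t $ i + 0" "v t $ i \<le> u t $ i + 0" for i
    by (rule generator_comparison[OF Q]; use u v t in \<open>auto simp: classical_solution_def\<close>)+
  then show ?thesis by (simp add: vec_eq_iff order_antisym)
qed

text \<open>For a convex generator and nonnegative \<open>t\<close> the choice is unambiguous, by
  uniqueness of the classical solution.\<close>

definition generated_semigroup :: "(real^'d::finite \<Rightarrow> real^'d) \<Rightarrow> real \<Rightarrow> real^'d \<Rightarrow> real^'d" where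
  "generated_semigroup Q t u0 = (SOME u. classical_solution Q u0 u) t"

lemma generated_semigroup_solution:
  "convex_generator Q \<Longrightarrow> classical_solution Q u0 (\<lambda>t. generated_semigroup Q t u0)"
  unfolding generated_semigroup_def using someI_ex[OF classical_solution_exists] by auto

lemma generated_semigroup_eqI:
  "convex_generator Q \<Longrightarrow> classical_solution Q u0 u \<Longrightarrow> 0 \<le> t \<Longrightarrow> generated_semigroup Q t u0 = u t"
  using classical_solution_unique generated_semigroup_solution by blast

lemma classical_solution_shift:
  assumes u: "classical_solution Q u0 u" and t: "0 \<le> t"
  shows "classical_solution Q (u t) (\<lambda>s. u (s + t))"
proof -
  have "((\<lambda>s. u (s + t)) has_vector_derivative Q (u (s + t))) (at s within {0..})" if s: "0 \<le> s" for s
  proof -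
    have "(u has_vector_derivative Q (u (s + t))) (at (s + t) within (\<lambda>s. s + t) ` {0..})"
      by (rule has_vector_derivative_within_subset[of _ _ _ "{0..}"])
        (use u s t in \<open>auto simp: classical_solution_def\<close>)
    moreover have "((\<lambda>s. s + t) has_vector_derivative 1) (at s within {0..})"
      by (auto intro!: derivative_eq_intros)
    ultimately show ?thesis using vector_diff_chain_within[of "\<lambda>s. s + t" 1 s "{0..}" u] by (simp add: o_def)
  qed
  moreover have "continuous_on {0..} (\<lambda>s. Q (u (s + t)))"
    by (rule continuous_on_compose2[of "{0..}" "\<lambda>r. Q (u r)"])
      (use u t in \<open>auto simp: classical_solution_def intro!: continuous_intros\<close>)
  ultimately show ?thesis by (simp add: classical_solution_def)
qed

lemma generated_semigroup_semigroup:
  assumes Q: "convex_generator Q"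
  shows "semigroup (generated_semigroup Q)"
  unfolding semigroup_def
proof (intro conjI allI impI ext)
  let ?S = "generated_semigroup Q"
  note sol = generated_semigroup_solution[OF Q]
  show "?S 0 u = u" for u using sol[of u] by (simp add: classical_solution_def)
  fix s t :: real and u assume st: "0 \<le> s" "0 \<le> t"
  show "?S (s + t) u = (?S s \<circ> ?S t) u"
    using generated_semigroup_eqI[OF Q classical_solution_shift[OF sol st(2)] st(1)] by simp
qed

lemma generated_semigroup_mono_shift:
  assumes Q: "convex_generator Q" and t: "0 \<le> t" and le: "\<And>i. u $ i \<le> v $ i + c"
  shows "generated_semigroup Q t u $ i \<le> generated_semigroup Q t v $ i + c"
proof -
  note sol = generated_semigroup_solution[OF Q, unfolded classical_solution_def]
  show ?thesis
    by (rule generator_comparison[OF Q, of "\<lambda>t. generated_semigroup Q t u" _ "\<lambda>t. generated_semigroup Q t v"])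
      (use sol[of u] sol[of v] t le in auto)
qed

lemma generated_semigroup_markovian:
  assumes Q: "convex_generator Q"
  shows "markovian_semigroup (generated_semigroup Q)"
proof -
  have "generated_semigroup Q t (vec a) = vec a" if "0 \<le> t" for t a
    by (rule generated_semigroup_eqI[OF Q _ that])
      (use Q in \<open>auto simp: classical_solution_def convex_generator_def\<close>)
  moreover have "generated_semigroup Q t u \<le> generated_semigroup Q t v" if "0 \<le> t" "u \<le> v" for t u v
    using generated_semigroup_mono_shift[OF Q that(1), of u v 0] that(2) by (simp add: less_eq_vec_def)
  ultimately show ?thesis by (simp add: markovian_semigroup_def kernel_def)
qed

text \<open>By convexity of \<open>Q\<close>, a convex combination of two solutions is a
  supersolution started at the convex combination of the initial values.\<close>

lemma generated_semigroup_convex: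
  assumes Q: "convex_generator Q"
  shows "convex_semigroup (generated_semigroup Q)"
proof -
  let ?S = "generated_semigroup Q"
  note sol = generated_semigroup_solution[OF Q, unfolded classical_solution_def]
  have "?S t (a *\<^sub>R x + b *\<^sub>R y) $ i \<le> a * ?S t x $ i + b * ?S t y $ i"
    if t: "0 \<le> t" and ab: "0 \<le> a" "0 \<le> b" "a + b = 1" for t x y a b i
  proof -
    have "?S t (a *\<^sub>R x + b *\<^sub>R y) $ i \<le> (a *\<^sub>R ?S t x + b *\<^sub>R ?S t y) $ i + 0"
    proof (rule generator_comparison[OF Q, of "\<lambda>t. ?S t (a *\<^sub>R x + b *\<^sub>R y)" _ "\<lambda>t. a *\<^sub>R ?S t x + b *\<^sub>R ?S t y"])
      show "((\<lambda>t. a *\<^sub>R ?S t x + b *\<^sub>R ?S t y) has_vector_derivative a *\<^sub>R Q (?S t x) + b *\<^sub>R Q (?S t y))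
          (at t within {0..})" if "0 \<le> t" for t
        using sol[of x] sol[of y] that
        by (intro has_vector_derivative_add bounded_linear.has_vector_derivative[OF bounded_linear_scaleR_right]) auto
      show "Q (a *\<^sub>R ?S t x + b *\<^sub>R ?S t y) \<le> a *\<^sub>R Q (?S t x) + b *\<^sub>R Q (?S t y)" for t
        using Q ab unfolding convex_generator_def convex_map_def convex_on_def by (simp add: less_eq_vec_def)
    qed (use sol t in auto)
    then show ?thesis by simp
  qed
  then show ?thesis by (simp add: convex_semigroup_def convex_map_def convex_on_def)
qed

lemma generated_semigroup_deriv_0:
  assumes Q: "convex_generator Q"
  shows "((\<lambda>h. (1 / h) *\<^sub>R (generated_semigroup Q h u0 - u0)) \<longlongrightarrow> Q u0) (at_right 0)"
  using generated_semigroup_solution[OF Q, of u0] has_vector_derivative_right_iff[of "\<lambda>t. generated_semigroup Q t u0" "Q u0" 0]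
  by (simp add: classical_solution_def) (metis order_refl)

text \<open>Orbits from a compact set stay in one cube, because they lie between constant solutions.
  There \<open>Q\<close> is bounded by some \<open>C\<close>, so each component moves by at most
  \<open>C * t\<close>, uniformly in the starting point.\<close>

lemma generated_semigroup_unif_cont:
  fixes Q :: "real^'d::finite \<Rightarrow> real^'d"
  assumes Q: "convex_generator Q"
  shows "unif_cont_semigroup (generated_semigroup Q)"
  unfolding unif_cont_semigroup_def
proof (intro allI impI uniform_limitI)
  let ?S = "generated_semigroup Q"
  note sol = generated_semigroup_solution[OF Q, unfolded classical_solution_def]
  fix K :: "(real^'d) set" and e :: real assume K: "compact K" and e: "e > 0"
  obtain R where R: "\<And>u. u \<in> K \<Longrightarrow> norm u \<le> R" using compact_imp_bounded[OF K] by (auto simp: bounded_iff)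
  obtain C where C: "0 \<le> C" "\<And>u. norm u \<le> real CARD('d) * R \<Longrightarrow> norm (Q u) \<le> C"
    using generator_bounded_on_ball[OF Q] by metis
  have vec: "?S t (vec a) = vec a" if "0 \<le> t" for t a
    using generated_semigroup_markovian[OF Q] that by (simp add: markovian_semigroup_def kernel_def)
  have bound: "norm (Q (?S t u)) \<le> C" if u: "u \<in> K" and t: "0 \<le> t" for u t
  proof (rule C(2), rule norm_le_card_bound)
    fix i
    have "\<bar>u $ j\<bar> \<le> R" for j using R[OF u] component_le_norm_cart[of u j] by linarith
    then have *: "u $ j \<le> R" "- R \<le> u $ j" for j by (auto simp: abs_le_iff minus_le_iff)
    have "?S t u $ i \<le> ?S t (vec R) $ i + 0" by (rule generated_semigroup_mono_shift[OF Q t]) (simp add: *)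
    moreover have "?S t (vec (-R)) $ i \<le> ?S t u $ i + 0"
      by (rule generated_semigroup_mono_shift[OF Q t]) (use * in simp)
    ultimately show "\<bar>?S t u $ i\<bar> \<le> R" unfolding vec[OF t] by simp
  qed
  have incr: "norm (?S t u - u) \<le> real CARD('d) * (C * t)" if u: "u \<in> K" and t: "0 \<le> t" for u t
  proof (rule norm_le_card_bound)
    fix i
    have cb: "\<bar>Q (?S s u) $ j\<bar> \<le> C" if "0 \<le> s" for s j
      using bound[OF u that] component_le_norm_cart[of "Q (?S s u)" j] by linarith
    have der: "((\<lambda>t. ?S t u) has_vector_derivative Q (?S t u)) (at t within {0..})" if "0 \<le> t" for t
      using sol[of u] that by simp
    \<comment> \<open>The maximum principle serves as a mean value inequality here: every component
      of the derivative is nonpositive.\<close>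
    have "(?S t u - u - t *\<^sub>R vec C) $ i \<le> 0"
    proof (rule ode_max_principle[where z' = "\<lambda>t. Q (?S t u) - vec C" and z = "\<lambda>t. ?S t u - u - t *\<^sub>R vec C"])
      show "((\<lambda>t. ?S t u - u - t *\<^sub>R vec C) has_vector_derivative Q (?S t u) - vec C) (at t within {0..})"
        if "0 \<le> t" for t
        using der[OF that] by (auto intro!: derivative_eq_intros)
    qed (use sol[of u] cb t in \<open>auto simp: abs_le_iff less_imp_le\<close>)
    moreover have "(u - ?S t u - t *\<^sub>R vec C) $ i \<le> 0"
    proof (rule ode_max_principle[where z' = "\<lambda>t. - Q (?S t u) - vec C" and z = "\<lambda>t. u - ?S t u - t *\<^sub>R vec C"])
      show "((\<lambda>t. u - ?S t u - t *\<^sub>R vec C) has_vector_derivative - Q (?S t u) - vec C) (at t within {0..})"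
        if "0 \<le> t" for t
        using der[OF that] by (auto intro!: derivative_eq_intros)
      show "(- Q (?S s u) - vec C) $ j \<le> 0" if "0 < s" for s j
        using cb[of s j] that by (simp add: abs_le_iff)
    qed (use sol[of u] t in auto)
    ultimately show "\<bar>(?S t u - u) $ i\<bar> \<le> C * t" by (simp add: abs_le_iff mult.commute)
  qed
  define D where "D = real CARD('d) * C + 1"
  have D: "D > 0" using C(1) by (simp add: D_def add_nonneg_pos)
  have "\<forall>\<^sub>F t in at_right 0. t \<in> {0<..<e / D}"
    using e D by (intro eventually_at_right_real) simp
  then show "\<forall>\<^sub>F t in at_right 0. \<forall>u\<in>K. dist (?S t u) u < e"
  proof (rule eventually_mono, intro ballI)
    fix t u assume t: "t \<in> {0<..<e / D}" and u: "u \<in> K"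
    have "dist (?S t u) u \<le> D * t"
      using incr[OF u, of t] t by (simp add: dist_norm D_def algebra_simps)
    also have "\<dots> < e" using t D by (simp add: pos_less_divide_eq mult.commute)
    finally show "dist (?S t u) u < e" .
  qed
qed

section \<open>Convex Markovian semigroups solve the differential equation\<close>

text \<open>Real induction: the infimum of the counterexamples is not itself one, by
  \<open>zero\<close> or \<open>left\<close>, and \<open>right\<close> then excludes counterexamples
  just above it. This suits claims controlled by right-hand increments and left limits.\<close>

lemma real_induct_closed_open [consumes 1, case_names zero right left]:
  fixes P :: "real \<Rightarrow> bool"
  assumes t: "0 \<le> t" and zero: "P 0"
    and right: "\<And>s. 0 \<le> s \<Longrightarrow> P s \<Longrightarrow> \<exists>d>0. \<forall>h. 0 < h \<longrightarrow> h < d \<longrightarrow> P (s + h)"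
    and left: "\<And>s. 0 < s \<Longrightarrow> (\<And>r. 0 \<le> r \<Longrightarrow> r < s \<Longrightarrow> P r) \<Longrightarrow> P s"
  shows "P t"
proof (rule ccontr)
  assume "\<not> P t"
  define A where "A = {r. 0 \<le> r \<and> \<not> P r}"
  have tA: "t \<in> A" using t \<open>\<not> P t\<close> by (simp add: A_def)
  have bdd: "bdd_below A" by (rule bdd_belowI[of _ 0]) (auto simp: A_def)
  define s where "s = Inf A"
  have s0: "0 \<le> s" unfolding s_def by (rule cInf_greatest) (use tA in \<open>auto simp: A_def\<close>)
  have below: "P r" if "0 \<le> r" "r < s" for r
    using cInf_lower[OF _ bdd, of r] that by (fastforce simp: A_def s_def)
  have "P s"
  proof (cases "s = 0")
    case False
    then show ?thesis using left[of s] below s0 by simp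
  qed (use zero in simp)
  then obtain d where d: "d > 0" "\<And>h. 0 < h \<Longrightarrow> h < d \<Longrightarrow> P (s + h)" using right[OF s0] by blast
  obtain r where r: "r \<in> A" "r < s + d"
    using cInf_lessD[of A "s + d"] tA d(1) by (auto simp: s_def)
  have "P r"
  proof (cases "r \<le> s")
    case True
    then show ?thesis using below[of r] \<open>P s\<close> r by (cases "r = s") (auto simp: A_def)
  next
    case False
    then show ?thesis using d(2)[of "r - s"] r by simp
  qed
  then show False using r by (simp add: A_def)
qed

text \<open>Real induction on \<open>norm (g t - g 0) \<le> e * t\<close>: the right derivative
  carries the bound forward, continuity closes it at left limits, and \<open>e\<close> is
  arbitrary.\<close>

lemma zero_right_derivative_imp_constant:
  fixes g :: "real \<Rightarrow> 'a::real_normed_vector"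
  assumes cont: "continuous_on {0..} g"
    and der: "\<And>t. 0 \<le> t \<Longrightarrow> (g has_vector_derivative 0) (at t within {t..})"
    and t: "0 \<le> t"
  shows "g t = g 0"
proof -
  have "norm (g t - g 0) \<le> e * t" if e: "e > 0" for e
    using t
  proof (induction t rule: real_induct_closed_open)
    case zero
    then show ?case by simp
  next
    case (right s)
    have "(g has_derivative (\<lambda>x. 0)) (at s within {s..})"
      using der[OF right(1)] by (simp add: has_vector_derivative_def)
    then obtain d where d: "d > 0"
      "\<And>y. y \<in> {s..} \<Longrightarrow> norm (y - s) < d \<Longrightarrow> norm (g y - g s) \<le> e * norm (y - s)"
      using e unfolding has_derivative_within_alt by auto
    have "norm (g (s + h) - g 0) \<le> e * (s + h)" if h: "0 < h" "h < d" for h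
    proof -
      have "norm (g (s + h) - g 0) \<le> norm (g (s + h) - g s) + norm (g s - g 0)"
        by (metis diff_add_cancel add_diff_eq norm_triangle_ineq)
      then show ?thesis using d(2)[of "s + h"] h right(2) by (simp add: algebra_simps)
    qed
    then show ?case using d(1) by blast
  next
    case (left s)
    have "(g \<longlongrightarrow> g s) (at s within {0..})"
      using cont left(1) by (auto simp: continuous_on_def)
    then have "(g \<longlongrightarrow> g s) (at s within {0..<s})" by (rule tendsto_within_subset) auto
    moreover have "at s within {0..<s} = at_left s"
      by (rule at_within_nhd[of _ "{0<..}"]) (use left(1) in auto)
    ultimately have "((\<lambda>r. e * r - norm (g r - g 0)) \<longlongrightarrow> e * s - norm (g s - g 0)) (at_left s)"
      by (auto intro!: tendsto_intros)
    moreover have "\<forall>\<^sub>F r in at_left s. 0 \<le> e * r - norm (g r - g 0)"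
      using eventually_at_left_real[OF left(1)] by (rule eventually_mono) (use left(2) in auto)
    ultimately have "0 \<le> e * s - norm (g s - g 0)" by (rule tendsto_lowerbound) simp
    then show ?case by simp
  qed
  note bound = this
  show ?thesis
  proof (rule ccontr)
    assume "g t \<noteq> g 0"
    then have pos: "0 < norm (g t - g 0) / (t + 1)" using t by simp
    have "norm (g t - g 0) * (t + 1) \<le> norm (g t - g 0) * t"
      using bound[OF pos] t by (simp add: field_simps)
    then show False using pos t by (simp add: mult_le_cancel_left)
  qed
qed

text \<open>The difference of \<open>g\<close> and the integral of \<open>k\<close> is continuous
  with right derivative 0, hence constant.\<close>

lemma right_derivative_continuous_imp_derivative:
  fixes g :: "real \<Rightarrow> 'a::banach"
  assumes cont: "continuous_on {0..} g" and contk: "continuous_on {0..} k"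
    and der: "\<And>t. 0 \<le> t \<Longrightarrow> (g has_vector_derivative k t) (at t within {t..})"
    and t: "0 \<le> t"
  shows "(g has_vector_derivative k t) (at t within {0..})"
proof -
  let ?I = "\<lambda>t. integral {0..t} k"
  note I = integral_has_vector_derivative_atLeast[OF contk]
  have "continuous_on {0..} ?I"
    using I by (auto simp: continuous_on_eq_continuous_within intro: has_vector_derivative_continuous)
  have eq: "g s - ?I s = g 0 - ?I 0" if s: "0 \<le> s" for s
  proof (rule zero_right_derivative_imp_constant[OF _ _ s])
    show "continuous_on {0..} (\<lambda>s. g s - ?I s)" by (intro continuous_intros cont) fact
    show "((\<lambda>s. g s - ?I s) has_vector_derivative 0) (at r within {r..})" if r: "0 \<le> r" for r
    proof -
      have "(?I has_vector_derivative k r) (at r within {r..})"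
        by (rule has_vector_derivative_within_subset[OF I[OF r]]) (use r in auto)
      then show ?thesis using has_vector_derivative_diff[OF der[OF r]] by fastforce
    qed
  qed
  have "((\<lambda>s. g 0 + ?I s) has_vector_derivative 0 + k t) (at t within {0..})"
    by (intro derivative_intros I t)
  then have "((\<lambda>s. g 0 + ?I s) has_vector_derivative k t) (at t within {0..})" by simp
  then show ?thesis
  proof (rule has_vector_derivative_transform[rotated 2])
    show "g s = g 0 + ?I s" if "s \<in> {0..}" for s using eq[of s] that by (simp add: diff_eq_eq)
  qed (use t in simp)
qed

text \<open>Convexity gives \<open>E (u + \<alpha>) \<le> (1 - \<lambda>) E (u / (1 - \<lambda>)) + \<lambda> E (\<alpha> / \<lambda>)\<close>; now let \<open>\<lambda> \<rightarrow> 0\<close>.\<close>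
lemma convex_kernel_shift_le:
  fixes E :: "real^'d::finite \<Rightarrow> real^'d"
  assumes k: "kernel E" and c: "convex_map E"
  shows "E (u + vec a) $ i \<le> E u $ i + a"
proof -
  have conv: "convex_on UNIV (\<lambda>u. E u $ i)" using c by (simp add: convex_map_def)
  then have cont: "continuous_on UNIV (\<lambda>u. E u $ i)" by (intro convex_on_continuous) auto
  have lim: "((\<lambda>l. (1 - l) * E ((1 / (1 - l)) *\<^sub>R u) $ i + a) \<longlongrightarrow> (1 - 0) * E ((1 / (1 - 0)) *\<^sub>R u) $ i + a) (at_right 0)"
    by (intro tendsto_intros continuous_on_tendsto_compose[OF cont]) auto
  have "E (u + vec a) $ i \<le> (1 - l) * E ((1 / (1 - l)) *\<^sub>R u) $ i + a" if l: "l \<in> {0<..<1}" for l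
  proof -
    have "E ((1 - l) *\<^sub>R ((1 / (1 - l)) *\<^sub>R u) + l *\<^sub>R vec (a / l)) $ i
       \<le> (1 - l) * E ((1 / (1 - l)) *\<^sub>R u) $ i + l * E (vec (a / l)) $ i"
      by (rule convex_onD[OF conv]) (use l in auto)
    moreover have "l *\<^sub>R vec (a / l) = (vec a :: real^'d)" using l by (simp add: vec_eq_iff)
    moreover have "E (vec (a / l)) = vec (a / l)" using k by (simp add: kernel_def)
    ultimately show ?thesis using l by simp
  qed
  then have "\<forall>\<^sub>F l in at_right 0. E (u + vec a) $ i \<le> (1 - l) * E ((1 / (1 - l)) *\<^sub>R u) $ i + a"
    by (intro eventually_mono[OF eventually_at_right_real[of 0 1]]) auto
  from tendsto_lowerbound[OF lim this] show ?thesis by simp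
qed

lemma convex_kernel_mono_shift:
  fixes E :: "real^'d::finite \<Rightarrow> real^'d"
  assumes k: "kernel E" and c: "convex_map E" and le: "\<And>j. u $ j \<le> v $ j + a"
  shows "E u $ i \<le> E v $ i + a"
proof -
  have "u \<le> v + vec a" using le by (simp add: less_eq_vec_def)
  then have "E u $ i \<le> E (v + vec a) $ i" using k by (simp add: kernel_def less_eq_vec_def)
  then show ?thesis using convex_kernel_shift_le[OF k c, of v a i] by linarith
qed

lemma convex_kernel_nonexpansive:
  fixes E :: "real^'d::finite \<Rightarrow> real^'d"
  assumes k: "kernel E" and c: "convex_map E"
  shows "\<bar>E u $ i - E v $ i\<bar> \<le> norm (u - v)"
proof -
  have "\<bar>(u - v) $ j\<bar> \<le> norm (u - v)" for j by (rule component_le_norm_cart)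
  then have "u $ j \<le> v $ j + norm (u - v)" "v $ j \<le> u $ j + norm (u - v)" for j
    by (simp_all add: abs_le_iff algebra_simps)
  then show ?thesis
    using convex_kernel_mono_shift[OF k c, of u v "norm (u - v)" i] convex_kernel_mono_shift[OF k c, of v u "norm (u - v)" i]
    by (simp add: abs_le_iff)
qed

text \<open>Convexity, constants and order pass to the limit of the difference quotients. For the
  maximum principle, \<open>u\<close> lies below the constant \<open>vec (u $ i)\<close> and a
  kernel keeps it there. Semigroups and chains both reach the generator this way.\<close>

lemma kernel_derivative_generator:
  fixes S :: "real \<Rightarrow> real^'d::finite \<Rightarrow> real^'d"
  assumes k: "\<And>t. 0 \<le> t \<Longrightarrow> kernel (S t)" and c: "\<And>t. 0 \<le> t \<Longrightarrow> convex_map (S t)"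
    and lim: "\<And>u. ((\<lambda>h. (1 / h) *\<^sub>R (S h u - u)) \<longlongrightarrow> Q u) (at_right 0)"
  shows "convex_generator Q"
proof -
  have L: "((\<lambda>h. (S h u $ i - u $ i) / h) \<longlongrightarrow> Q u $ i) (at_right 0)" for u i
    using tendsto_vec_nth[OF lim, of u i] by simp
  have ev: "\<forall>\<^sub>F h in at_right (0::real). h > 0" by (rule eventually_at_right_less)
  have "Q u $ i \<le> 0" if "\<forall>j. u $ j \<le> u $ i" for u i
  proof (rule tendsto_upperbound[OF L])
    show "\<forall>\<^sub>F h in at_right 0. (S h u $ i - u $ i) / h \<le> 0"
      using ev
    proof (rule eventually_mono)
      fix h :: real assume h: "h > 0"
      have "u \<le> vec (u $ i)" using that by (simp add: less_eq_vec_def)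
      then have "S h u \<le> vec (u $ i)" using k[of h] h unfolding kernel_def by (metis less_imp_le)
      then show "(S h u $ i - u $ i) / h \<le> 0" using h by (simp add: less_eq_vec_def divide_nonpos_pos)
    qed
  qed simp
  moreover have "Q (vec a) = 0" for a
  proof (rule tendsto_unique[OF _ lim])
    show "((\<lambda>h. (1 / h) *\<^sub>R (S h (vec a) - vec a)) \<longlongrightarrow> 0) (at_right 0)"
      by (rule tendsto_eventually, rule eventually_mono[OF ev]) (use k in \<open>simp add: kernel_def\<close>)
  qed simp
  moreover have "Q (a *\<^sub>R x + b *\<^sub>R y) $ i \<le> a * Q x $ i + b * Q y $ i"
    if ab: "0 \<le> a" "0 \<le> b" "a + b = 1" for a b x y i
  proof (rule tendsto_le[OF _ _ L])
    show "((\<lambda>h. a * ((S h x $ i - x $ i) / h) + b * ((S h y $ i - y $ i) / h)) \<longlongrightarrow> a * Q x $ i + b * Q y $ i) (at_right 0)"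
      by (intro tendsto_intros L)
    show "\<forall>\<^sub>F h in at_right 0. (S h (a *\<^sub>R x + b *\<^sub>R y) $ i - (a *\<^sub>R x + b *\<^sub>R y) $ i) / h
        \<le> a * ((S h x $ i - x $ i) / h) + b * ((S h y $ i - y $ i) / h)"
      using ev
    proof (rule eventually_mono)
      fix h :: real assume h: "h > 0"
      have "S h (a *\<^sub>R x + b *\<^sub>R y) $ i \<le> a * S h x $ i + b * S h y $ i"
        using c[of h] h ab unfolding convex_map_def convex_on_def by simp
      then have "(S h (a *\<^sub>R x + b *\<^sub>R y) $ i - (a *\<^sub>R x + b *\<^sub>R y) $ i) / h
          \<le> (a * (S h x $ i - x $ i) + b * (S h y $ i - y $ i)) / h"
        using h by (intro divide_right_mono) (auto simp: algebra_simps)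
      then show "(S h (a *\<^sub>R x + b *\<^sub>R y) $ i - (a *\<^sub>R x + b *\<^sub>R y) $ i) / h
          \<le> a * ((S h x $ i - x $ i) / h) + b * ((S h y $ i - y $ i) / h)"
        by (simp add: add_divide_distrib)
    qed
  qed simp
  ultimately show ?thesis
    by (auto simp: convex_generator_def positive_max_principle_def convex_map_def convex_on_def)
qed

text \<open>The semigroup law is used in both orders: S(t + h) u0 = S(h) (S(t) u0) gives the right
  derivative at t, while S(s + h) u0 = S(s) (S(h) u0) and nonexpansiveness of S(s) transport
  continuity at 0 to all times with one modulus.\<close>

lemma convex_markov_semigroup_classical_solution:
  fixes S :: "real \<Rightarrow> real^'d::finite \<Rightarrow> real^'d"
  assumes sg: "semigroup S" and k: "\<And>t. 0 \<le> t \<Longrightarrow> kernel (S t)" and c: "\<And>t. 0 \<le> t \<Longrightarrow> convex_map (S t)"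
    and lim: "\<And>u. ((\<lambda>h. (1 / h) *\<^sub>R (S h u - u)) \<longlongrightarrow> Q u) (at_right 0)"
  shows "classical_solution Q u0 (\<lambda>t. S t u0)"
proof -
  have S0: "S 0 u = u" for u using sg by (simp add: semigroup_def)
  have S_add: "S (s + t) u = S s (S t u)" if "0 \<le> s" "0 \<le> t" for s t u
    using sg that by (simp add: semigroup_def)
  have gen: "convex_generator Q" by (rule kernel_derivative_generator[OF k c lim])
  have right: "((\<lambda>t. S t u0) has_vector_derivative Q (S t u0)) (at t within {t..})" if t: "0 \<le> t" for t
    unfolding has_vector_derivative_right_iff
    by (rule Lim_transform_eventually[OF lim], rule eventually_mono[OF eventually_at_right_less])
      (use S_add[OF _ t] in \<open>simp add: add.commute[of t]\<close>)
  have lim0: "((\<lambda>h. norm (S h u0 - u0)) \<longlongrightarrow> 0) (at_right 0)"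
  proof -
    have "((\<lambda>t. S t u0) \<longlongrightarrow> S 0 u0) (at 0 within {0..})"
      using has_vector_derivative_continuous[OF right[of 0]] by (simp add: continuous_within)
    then have "((\<lambda>t. S t u0) \<longlongrightarrow> S 0 u0) (at_right 0)" by (rule tendsto_within_subset) auto
    then show ?thesis unfolding S0 by (metis LIM_zero tendsto_norm_zero)
  qed
  have cont: "continuous_on {0..} (\<lambda>t. S t u0)"
    unfolding continuous_on_iff
  proof (intro ballI allI impI)
    fix t e :: real assume t: "t \<in> {0..}" and e: "e > 0"
    \<comment> \<open>Nonexpansiveness is componentwise, so passing to the norm costs a factor
      \<open>CARD('d)\<close>; the extra 1 makes the final estimate strict.\<close>
    define e' where "e' = e / (real CARD('d) + 1)"
    have e': "e' > 0" using e by (simp add: e'_def add_nonneg_pos)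
    have "\<forall>\<^sub>F h in at_right 0. norm (S h u0 - u0) < e'" using order_tendstoD(2)[OF lim0 e'] .
    then obtain d where d: "d > 0" "\<And>h. 0 < h \<Longrightarrow> h < d \<Longrightarrow> norm (S h u0 - u0) < e'"
      unfolding eventually_at_right_field by auto
    have *: "norm (S r u0 - S s u0) < e" if rs: "0 \<le> s" "s \<le> r" "r - s < d" for r s
    proof (cases "r = s")
      case False
      then have h: "0 < r - s" using rs by simp
      have "S r u0 = S s (S (r - s) u0)" using S_add[of s "r - s" u0] rs by simp
      then have "\<bar>(S r u0 - S s u0) $ i\<bar> \<le> norm (S (r - s) u0 - u0)" for i
        using convex_kernel_nonexpansive[OF k[OF rs(1)] c[OF rs(1)], of "S (r - s) u0" i u0] by simp
      then have "norm (S r u0 - S s u0) \<le> real CARD('d) * norm (S (r - s) u0 - u0)"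
        by (rule norm_le_card_bound)
      also have "\<dots> \<le> real CARD('d) * e'" using d(2)[OF h rs(3)] by (intro mult_left_mono) auto
      also have "\<dots> < (real CARD('d) + 1) * e'" using e' by (simp add: distrib_right)
      also have "\<dots> = e" by (simp add: e'_def)
      finally show ?thesis .
    qed (use e in simp)
    show "\<exists>d>0. \<forall>s\<in>{0..}. dist s t < d \<longrightarrow> dist (S s u0) (S t u0) < e"
    proof (intro exI[of _ d] conjI ballI impI d(1))
      fix s :: real assume s: "s \<in> {0..}" "dist s t < d"
      then show "dist (S s u0) (S t u0) < e"
        using *[of s t] *[of t s] t by (cases "s \<le> t") (auto simp: dist_norm norm_minus_commute)
    qed
  qed
  have contQ: "continuous_on {0..} (\<lambda>t. Q (S t u0))"
    using continuous_on_compose2[OF generator_continuous[OF gen] cont] by auto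
  show ?thesis
    using right_derivative_continuous_imp_derivative[OF cont contQ right] contQ S0
    by (simp add: classical_solution_def)
qed

section \<open>Convex Markov chains as semigroups\<close>

text \<open>All three are inherited from the affine functionals under the supremum; exact
  preservation of constants is where the vanishing infimum of the penalties enters.\<close>

lemma convex_expectation_props:
  assumes E: "convex_expectation M E"
  shows "X \<in> borel_measurable M \<Longrightarrow> bounded (X ` space M) \<Longrightarrow> Y \<in> borel_measurable M \<Longrightarrow> bounded (Y ` space M)
      \<Longrightarrow> (\<And>w. w \<in> space M \<Longrightarrow> X w \<le> Y w) \<Longrightarrow> E X \<le> E Y"
    and "E (\<lambda>_. a) = a"
    and "X \<in> borel_measurable M \<Longrightarrow> bounded (X ` space M) \<Longrightarrow> Y \<in> borel_measurable M \<Longrightarrow> bounded (Y ` space M)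
      \<Longrightarrow> 0 \<le> s \<Longrightarrow> 0 \<le> t \<Longrightarrow> s + t = 1 \<Longrightarrow> E (\<lambda>w. s * X w + t * Y w) \<le> s * E X + t * E Y"
proof -
  obtain \<P> \<alpha> where *: "\<P> \<noteq> {} \<and> (\<forall>P\<in>\<P>. prob_space P \<and> sets P = sets M) \<and>
        (\<forall>P\<in>\<P>. 0 \<le> \<alpha> P) \<and> (INF P\<in>\<P>. \<alpha> P) = 0 \<and>
        (\<forall>X. X \<in> borel_measurable M \<and> bounded (X ` space M) \<longrightarrow>
             E X = (SUP P\<in>\<P>. integral\<^sup>L P X - \<alpha> P))"
    using E unfolding convex_expectation_def by (elim exE)
  then have ne: "\<P> \<noteq> {}" and P: "\<And>P. P \<in> \<P> \<Longrightarrow> prob_space P" "\<And>P. P \<in> \<P> \<Longrightarrow> sets P = sets M"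
    and \<alpha>: "\<And>P. P \<in> \<P> \<Longrightarrow> 0 \<le> \<alpha> P" "(INF P\<in>\<P>. \<alpha> P) = 0"
    and E_eq: "\<And>X. X \<in> borel_measurable M \<Longrightarrow> bounded (X ` space M) \<Longrightarrow>
             E X = (SUP P\<in>\<P>. integral\<^sup>L P X - \<alpha> P)"
    by auto
  have sp: "space P = space M" if "P \<in> \<P>" for P using P(2)[OF that] by (rule sets_eq_imp_space_eq)
  have int: "integrable P X" if X: "X \<in> borel_measurable M" "bounded (X ` space M)" and "P \<in> \<P>" for P and X :: "'a \<Rightarrow> real"
  proof -
    interpret prob_space P by (rule P) fact
    obtain B where "\<And>w. w \<in> space M \<Longrightarrow> \<bar>X w\<bar> \<le> B" using X(2) by (auto simp: bounded_iff)
    moreover have "X \<in> borel_measurable P" using X(1) measurable_cong_sets[OF P(2)[OF that(3)] refl] by blast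
    ultimately show ?thesis by (intro integrable_const_bound[of _ B]) (auto simp: sp[OF that(3)])
  qed
  have bdd: "bdd_above ((\<lambda>P. integral\<^sup>L P X - \<alpha> P) ` \<P>)"
    if X: "X \<in> borel_measurable M" "bounded (X ` space M)" for X :: "'a \<Rightarrow> real"
  proof -
    obtain B where B: "\<And>w. w \<in> space M \<Longrightarrow> \<bar>X w\<bar> \<le> B" using X(2) by (auto simp: bounded_iff)
    show ?thesis
    proof (rule bdd_aboveI2)
      fix P assume p: "P \<in> \<P>"
      interpret prob_space P by (rule P) fact
      have "integral\<^sup>L P X \<le> integral\<^sup>L P (\<lambda>_. B)"
        by (rule integral_mono) (use int[OF X p] B sp[OF p] in \<open>auto simp: abs_le_iff\<close>)
      then show "integral\<^sup>L P X - \<alpha> P \<le> B" using \<alpha>(1)[OF p] by (simp add: prob_space)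
    qed
  qed
  have le: "integral\<^sup>L P X - \<alpha> P \<le> E X"
    if "X \<in> borel_measurable M" "bounded (X ` space M)" "P \<in> \<P>" for P and X :: "'a \<Rightarrow> real"
    unfolding E_eq[OF that(1,2)] by (rule cSUP_upper[OF that(3) bdd[OF that(1,2)]])
  have least: "E X \<le> b" if "X \<in> borel_measurable M" "bounded (X ` space M)"
    "\<And>P. P \<in> \<P> \<Longrightarrow> integral\<^sup>L P X - \<alpha> P \<le> b" for b and X :: "'a \<Rightarrow> real"
    unfolding E_eq[OF that(1,2)] by (rule cSUP_least[OF ne that(3)])
  show "E X \<le> E Y" if X: "X \<in> borel_measurable M" "bounded (X ` space M)"
    and Y: "Y \<in> borel_measurable M" "bounded (Y ` space M)" and xy: "\<And>w. w \<in> space M \<Longrightarrow> X w \<le> Y w"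
  proof (rule least[OF X])
    fix P assume p: "P \<in> \<P>"
    have "integral\<^sup>L P X \<le> integral\<^sup>L P Y"
      by (rule integral_mono) (use int[OF X p] int[OF Y p] xy sp[OF p] in auto)
    then show "integral\<^sup>L P X - \<alpha> P \<le> E Y" using le[OF Y p] by linarith
  qed
  show "E (\<lambda>_. a) = a"
  proof -
    have "bounded ((\<lambda>_. a) ` space M)" by (rule bounded_subset[of "{a}"]) auto
    then have "E (\<lambda>_. a) = (SUP P\<in>\<P>. integral\<^sup>L P (\<lambda>_. a) - \<alpha> P)" by (intro E_eq) auto
    also have "\<dots> = (SUP P\<in>\<P>. a + - \<alpha> P)"
      by (rule SUP_cong) (use P(1) in \<open>auto simp: prob_space.prob_space\<close>)
    also have "\<dots> = a + (SUP P\<in>\<P>. - \<alpha> P)"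
    proof (rule antisym)
      have b: "bdd_above ((\<lambda>P. - \<alpha> P) ` \<P>)" by (rule bdd_aboveI2[of _ _ 0]) (use \<alpha> in auto)
      have b': "bdd_above ((\<lambda>P. a + - \<alpha> P) ` \<P>)" by (rule bdd_aboveI2[of _ _ a]) (use \<alpha> in auto)
      show "(SUP P\<in>\<P>. a + - \<alpha> P) \<le> a + (SUP P\<in>\<P>. - \<alpha> P)"
        by (rule cSUP_least[OF ne], rule add_left_mono, rule cSUP_upper[OF _ b])
      have "(SUP P\<in>\<P>. - \<alpha> P) \<le> (SUP P\<in>\<P>. a + - \<alpha> P) - a"
      proof (rule cSUP_least[OF ne])
        fix P assume "P \<in> \<P>"
        from cSUP_upper[OF this b'] show "- \<alpha> P \<le> (SUP P\<in>\<P>. a + - \<alpha> P) - a" by linarith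
      qed
      then show "a + (SUP P\<in>\<P>. - \<alpha> P) \<le> (SUP P\<in>\<P>. a + - \<alpha> P)" by linarith
    qed
    also have "(SUP P\<in>\<P>. - \<alpha> P) = 0"
      using \<alpha>(2) by (simp add: Inf_real_def image_image)
    finally show ?thesis by simp
  qed
  show "E (\<lambda>w. s * X w + t * Y w) \<le> s * E X + t * E Y"
    if X: "X \<in> borel_measurable M" "bounded (X ` space M)"
    and Y: "Y \<in> borel_measurable M" "bounded (Y ` space M)" and st: "0 \<le> s" "0 \<le> t" "s + t = 1"
  proof (rule least)
    show "(\<lambda>w. s * X w + t * Y w) \<in> borel_measurable M" using X Y by measurable
    obtain A where A: "\<And>w. w \<in> space M \<Longrightarrow> \<bar>X w\<bar> \<le> A" using X(2) by (auto simp: bounded_iff)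
    obtain B where B: "\<And>w. w \<in> space M \<Longrightarrow> \<bar>Y w\<bar> \<le> B" using Y(2) by (auto simp: bounded_iff)
    have "\<bar>s * X w + t * Y w\<bar> \<le> s * A + t * B" if "w \<in> space M" for w
      using abs_triangle_ineq[of "s * X w" "t * Y w"] mult_left_mono[OF A[OF that] st(1)] mult_left_mono[OF B[OF that] st(2)] st
      by (simp add: abs_mult)
    then show "bounded ((\<lambda>w. s * X w + t * Y w) ` space M)" by (auto simp: bounded_iff)
    fix P assume p: "P \<in> \<P>"
    have "\<alpha> P = s * \<alpha> P + t * \<alpha> P" using st by (metis distrib_right mult_1)
    then have "integral\<^sup>L P (\<lambda>w. s * X w + t * Y w) - \<alpha> P = s * (integral\<^sup>L P X - \<alpha> P) + t * (integral\<^sup>L P Y - \<alpha> P)"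
      using int[OF X p] int[OF Y p] by (simp add: algebra_simps)
    also have "\<dots> \<le> s * E X + t * E Y" by (intro add_mono mult_left_mono le X Y p st)
    finally show "integral\<^sup>L P (\<lambda>w. s * X w + t * Y w) - \<alpha> P \<le> s * E X + t * E Y" .
  qed
qed

lemma measurable_vec_nth_chain:
  fixes u :: "real^'d::finite"
  assumes "Z \<in> measurable M (count_space UNIV)"
  shows "(\<lambda>w. u $ Z w) \<in> borel_measurable M" "bounded ((\<lambda>w. u $ Z w) ` space M)"
proof -
  show "(\<lambda>w. u $ Z w) \<in> borel_measurable M"
    by (rule measurable_compose[OF assms]) simp
  have "finite ((\<lambda>w. u $ Z w) ` space M)" by (rule finite_subset[of _ "range (($) u)"]) auto
  then show "bounded ((\<lambda>w. u $ Z w) ` space M)" by (rule finite_imp_bounded)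
qed

definition chain_semigroup ::
  "('d::finite \<Rightarrow> ('w \<Rightarrow> real) \<Rightarrow> real) \<Rightarrow> (real \<Rightarrow> 'w \<Rightarrow> 'd) \<Rightarrow> real \<Rightarrow> real^'d \<Rightarrow> real^'d" where
  "chain_semigroup E X t u = chain_value E X u t"

text \<open>The semigroup law is the Markov property for payoffs that ignore the past.\<close>

lemma chain_semigroup_props:
  fixes E :: "'d::finite \<Rightarrow> ('w \<Rightarrow> real) \<Rightarrow> real"
  assumes ch: "convex_markov_chain M E X"
  shows "semigroup (chain_semigroup E X)" "kernel (chain_semigroup E X t)" "convex_map (chain_semigroup E X t)"
proof -
  have meas: "X t \<in> measurable M (count_space UNIV)" for t using ch by (simp add: convex_markov_chain_def)
  have ce: "convex_expectation M (E i)" for i using ch by (simp add: convex_markov_chain_def)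
  note mb = measurable_vec_nth_chain[OF meas]
  show "kernel (chain_semigroup E X t)"
    unfolding kernel_def chain_semigroup_def chain_value_def less_eq_vec_def
    by (auto simp: convex_expectation_props(2)[OF ce] vec_eq_iff intro!: convex_expectation_props(1)[OF ce] mb)
  show "convex_map (chain_semigroup E X t)"
    unfolding convex_map_def convex_on_def chain_semigroup_def chain_value_def
    using convex_expectation_props(3)[OF ce mb mb] by simp
  show "semigroup (chain_semigroup E X)"
    unfolding semigroup_def
  proof (intro conjI allI impI)
    show "chain_semigroup E X 0 = (\<lambda>u. u)"
      using ch by (auto simp: convex_markov_chain_def chain_semigroup_def chain_value_def vec_eq_iff fun_eq_iff)
    fix s t :: real assume st: "0 \<le> s" "0 \<le> t"
    show "chain_semigroup E X (s + t) = chain_semigroup E X s \<circ> chain_semigroup E X t"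
    proof
      fix u :: "real^'d"
      have "E i (\<lambda>\<omega>. u $ X (s + t) \<omega>) = E i (\<lambda>\<omega>. E (X s \<omega>) (\<lambda>\<omega>'. u $ X t \<omega>'))" for i
      proof -
        have "\<forall>ts :: real list. \<forall>v0 :: 'd list \<Rightarrow> 'd \<Rightarrow> real.
          0 \<le> s \<and> 0 \<le> t \<and> ts \<noteq> [] \<and> sorted_wrt (<) ts \<and> (\<forall>r\<in>set ts. 0 \<le> r \<and> r \<le> s) \<longrightarrow>
          (\<forall>i. E i (\<lambda>\<omega>. v0 (map (\<lambda>r. X r \<omega>) ts) (X (s + t) \<omega>)) =
             E i (\<lambda>\<omega>. E (X s \<omega>) (\<lambda>\<omega>'. v0 (map (\<lambda>r. X r \<omega>) ts) (X t \<omega>'))))"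
          using ch unfolding convex_markov_chain_def by blast
        \<comment> \<open>The Markov property asks for a nonempty list of observation times, so
          \<open>s\<close> is observed and then ignored by the payoff.\<close>
        from spec[OF spec[OF this, of "[s]"], of "\<lambda>_ j. u $ j"] st show ?thesis by simp
      qed
      then show "chain_semigroup E X (s + t) u = (chain_semigroup E X s \<circ> chain_semigroup E X t) u"
        by (simp add: chain_semigroup_def chain_value_def)
    qed
  qed
qed

section \<open>Affine semigroups and the semigroup envelope\<close>

lemma mat_pow_0: "mat_pow A 0 = mat 1" and mat_pow_Suc: "mat_pow A (Suc k) = A ** mat_pow A k"
  by (auto simp: mat_pow_def)

lemma mat_pow_scaleR: "mat_pow (t *\<^sub>R A) k = t ^ k *\<^sub>R mat_pow A k"
  by (induction k) (auto simp: mat_pow_0 mat_pow_Suc matrix_matrix_mult_def vec_eq_iff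
      sum_distrib_left mult_ac intro!: sum.cong)

text \<open>\<open>B\<close>, the sum of all absolute entries, dominates every absolute row sum, so
  a further factor \<open>A\<close> costs at most a further factor \<open>B\<close>.\<close>

lemma mat_pow_entry_bound:
  fixes A :: "real^'d::finite^'d"
  defines "B \<equiv> (\<Sum>i\<in>UNIV. \<Sum>j\<in>UNIV. \<bar>A $ i $ j\<bar>)"
  shows "\<bar>mat_pow A k $ i $ j\<bar> \<le> B ^ k"
proof (induction k arbitrary: i j)
  case 0
  then show ?case by (simp add: mat_pow_0 mat_def)
next
  case (Suc k)
  have row: "(\<Sum>l\<in>UNIV. \<bar>A $ i $ l\<bar>) \<le> B"
    unfolding B_def by (rule member_le_sum[of i UNIV "\<lambda>i. \<Sum>j\<in>UNIV. \<bar>A $ i $ j\<bar>"]) (auto intro: sum_nonneg)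
  have B0: "0 \<le> B ^ k" using order_trans[OF abs_ge_zero Suc.IH] .
  have "\<bar>mat_pow A (Suc k) $ i $ j\<bar> \<le> (\<Sum>l\<in>UNIV. \<bar>A $ i $ l * mat_pow A k $ l $ j\<bar>)"
    by (simp add: mat_pow_Suc matrix_matrix_mult_def sum_abs)
  also have "\<dots> \<le> (\<Sum>l\<in>UNIV. \<bar>A $ i $ l\<bar> * B ^ k)"
    by (intro sum_mono) (auto simp: abs_mult intro!: mult_left_mono Suc.IH)
  also have "\<dots> \<le> B * B ^ k"
    unfolding sum_distrib_right[symmetric] by (rule mult_right_mono[OF row B0])
  finally show ?case by simp
qed

lemma summable_mat_exp:
  fixes A :: "real^'d::finite^'d"
  shows "summable (\<lambda>k. (1 / fact k) *\<^sub>R mat_pow A k)"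
proof (rule summable_norm_cancel, rule summable_comparison_test')
  define B where "B = (\<Sum>i\<in>UNIV. \<Sum>j\<in>UNIV. \<bar>A $ i $ j\<bar>)"
  let ?c = "real CARD('d) * real CARD('d)"
  show "summable (\<lambda>k. ?c * (inverse (fact k) * B ^ k))" by (intro summable_mult summable_exp)
  fix k :: nat
  have "norm (mat_pow A k) \<le> (\<Sum>i\<in>UNIV. norm (mat_pow A k $ i))"
    unfolding norm_vec_def by (rule L2_set_le_sum) simp
  also have "\<dots> \<le> (\<Sum>i\<in>(UNIV::'d set). real CARD('d) * B ^ k)"
    by (intro sum_mono norm_le_card_bound) (auto simp: B_def mat_pow_entry_bound)
  finally have "norm (mat_pow A k) \<le> ?c * B ^ k" by simp
  then have "inverse (fact k) * norm (mat_pow A k) \<le> inverse (fact k) * (?c * B ^ k)"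
    by (rule mult_left_mono) simp
  then show "norm (norm ((1 / fact k) *\<^sub>R mat_pow A k)) \<le> ?c * (inverse (fact k) * B ^ k)"
    by (simp add: divide_inverse mult_ac)
qed

text \<open>For fixed \<open>x\<close> each component is a real power series in \<open>t\<close>,
  which opens the way to termwise differentiation.\<close>

lemma mat_exp_mult_sums:
  fixes q :: "real^'d::finite^'d"
  shows "(\<lambda>k. (mat_pow q k *v x) $ i / fact k * t ^ k) sums (mat_exp (t *\<^sub>R q) *v x) $ i"
proof -
  have lin: "bounded_linear (\<lambda>M :: real^'d^'d. (M *v x) $ i)"
    by (intro linear_conv_bounded_linear[THEN iffD1] linearI)
      (simp_all add: matrix_vector_mult_def sum.distrib distrib_right sum_distrib_left mult.assoc)
  have "(\<lambda>k. (((1 / fact k) *\<^sub>R mat_pow (t *\<^sub>R q) k) *v x) $ i) sums (mat_exp (t *\<^sub>R q) *v x) $ i"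
    unfolding mat_exp_def by (intro bounded_linear.sums[OF lin] summable_sums summable_mat_exp)
  moreover have "(((1 / fact k) *\<^sub>R mat_pow (t *\<^sub>R q) k) *v x) $ i = (mat_pow q k *v x) $ i / fact k * t ^ k" for k
    by (simp add: mat_pow_scaleR linear_cmul[OF bounded_linear.linear[OF lin]])
  ultimately show ?thesis by simp
qed

lemma mat_exp_has_derivative:
  fixes q :: "real^'d::finite^'d"
  shows "((\<lambda>t. mat_exp (t *\<^sub>R q) *v x) has_vector_derivative q *v (mat_exp (t *\<^sub>R q) *v x)) (at t within S)"
  unfolding has_vector_derivative_vec_iff
proof
  fix i
  define c where "c j k = (mat_pow q k *v x) $ j / fact k" for j k
  have sums: "(\<lambda>k. c j k * s ^ k) sums (mat_exp (s *\<^sub>R q) *v x) $ j" for j s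
    unfolding c_def by (rule mat_exp_mult_sums)
  have eq: "(mat_exp (s *\<^sub>R q) *v x) $ j = (\<Sum>k. c j k * s ^ k)" for j s using sums_unique[OF sums] .
  have "((\<lambda>s. \<Sum>k. c i k * s ^ k) has_real_derivative (\<Sum>k. diffs (c i) k * t ^ k)) (at t)"
    by (rule termdiffs_strong[where K = "norm t + 1"]) (auto intro: sums_summable[OF sums])
  moreover have "(\<lambda>k. diffs (c i) k * t ^ k) sums (q *v (mat_exp (t *\<^sub>R q) *v x)) $ i"
  proof -
    \<comment> \<open>Differentiation shifts coefficients: \<open>Suc k\<close> times
      \<open>c i (Suc k)\<close> is component \<open>i\<close> of \<open>q\<close> applied to the
      vector of the \<open>c j k\<close>.\<close>
    have "diffs (c i) k * t ^ k = (\<Sum>j\<in>UNIV. q $ i $ j * (c j k * t ^ k))" for k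
    proof -
      have "diffs (c i) k = (q *v (mat_pow q k *v x)) $ i / fact k"
        by (simp add: diffs_def c_def mat_pow_Suc matrix_vector_mul_assoc del: of_nat_Suc)
      also have "\<dots> = (\<Sum>j\<in>UNIV. q $ i $ j * c j k)"
        by (simp add: matrix_vector_mult_def[of q] c_def sum_divide_distrib)
      finally show ?thesis by (simp add: sum_distrib_right mult.assoc)
    qed
    then show ?thesis
      unfolding matrix_vector_mult_def[of q] vec_lambda_beta
      by (simp only:) (intro sums_sum sums_mult sums)
  qed
  ultimately show "((\<lambda>s. (mat_exp (s *\<^sub>R q) *v x) $ i) has_real_derivative
      (q *v (mat_exp (t *\<^sub>R q) *v x)) $ i) (at t within S)"
    unfolding eq[abs_def] by (simp add: sums_unique[symmetric] eq[symmetric] has_field_derivative_at_within)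
qed

lemma mat_exp_0: "mat_exp (0 :: real^'d::finite^'d) *v x = x"
proof (subst vec_eq_iff, intro allI)
  fix i
  have "(mat_exp ((0::real) *\<^sub>R 0) *v x) $ i = (mat_pow 0 0 *v x) $ i"
    using sums_unique2[OF mat_exp_mult_sums[of 0 x i 0] powser_sums_zero] by simp
  then show "(mat_exp 0 *v x) $ i = x $ i" by (simp add: mat_pow_0)
qed

lemma affine_sg_0: "affine_sg q f 0 u0 = u0"
  by (simp add: affine_sg_def mat_exp_0)

text \<open>Differentiating the formula leaves a term e^{tq} f; integrating the derivative of e^{sq}
  f over \<open>{0..t}\<close> turns it into f plus q applied to the integral, as the equation
  demands.\<close>

lemma affine_sg_has_derivative:
  assumes t: "0 \<le> t"
  shows "((\<lambda>t. affine_sg q f t u0) has_vector_derivative q *v affine_sg q f t u0 + f) (at t within {0..})"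
proof -
  let ?e = "\<lambda>x t. mat_exp (t *\<^sub>R q) *v x"
  have cont: "continuous_on S (?e f)" for S
    by (rule continuous_on_vector_derivative) (rule mat_exp_has_derivative)
  have lin: "bounded_linear ((*v) q)" by (rule matrix_vector_mul_bounded_linear)
  have "((\<lambda>s. q *v ?e f s) has_integral (?e f t - ?e f 0)) {0..t}"
    by (rule fundamental_theorem_of_calculus[OF t]) (rule mat_exp_has_derivative)
  moreover have "((\<lambda>s. q *v ?e f s) has_integral (q *v integral {0..t} (?e f))) {0..t}"
    using has_integral_linear[OF integrable_integral[OF integrable_continuous_real[OF cont]] lin] by (simp add: o_def)
  ultimately have "?e f t - ?e f 0 = q *v integral {0..t} (?e f)" by (rule has_integral_unique)
  then have "?e f t = f + q *v integral {0..t} (?e f)" by (simp add: mat_exp_0 diff_eq_eq add.commute)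
  moreover have "((\<lambda>t. ?e u0 t + integral {0..t} (?e f)) has_vector_derivative q *v ?e u0 t + ?e f t) (at t within {0..})"
    by (intro derivative_intros mat_exp_has_derivative integral_has_vector_derivative_atLeast cont t)
  ultimately show ?thesis
    unfolding affine_sg_def by (simp add: matrix_vector_right_distrib algebra_simps)
qed

lemma affine_sg_continuous: "continuous_on {0..} (\<lambda>t. affine_sg q f t u0)"
  by (rule continuous_on_vector_derivative, rule affine_sg_has_derivative) simp

lemma affine_sg_mono_shift:
  assumes q: "Q_matrix q" and t: "0 \<le> t" and le: "\<And>i. u $ i \<le> v $ i + c"
  shows "affine_sg q f t u $ i \<le> affine_sg q f t v $ i + c"
proof -
  have "(affine_sg q f t u - affine_sg q f t v) $ i \<le> c"
  proof (rule ode_max_principle[where z = "\<lambda>t. affine_sg q f t u - affine_sg q f t v"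
        and z' = "\<lambda>t. q *v (affine_sg q f t u - affine_sg q f t v)"])
    show "((\<lambda>t. affine_sg q f t u - affine_sg q f t v) has_vector_derivative
        q *v (affine_sg q f t u - affine_sg q f t v)) (at t within {0..})" if "0 \<le> t" for t
      using has_vector_derivative_diff[OF affine_sg_has_derivative[OF that] affine_sg_has_derivative[OF that], of q f u q f v]
      by (simp add: matrix_vector_mult_diff_distrib)
  qed (use Q_matrix_argmax[OF q] t le in \<open>auto simp: affine_sg_0 diff_le_eq add.commute\<close>)
  then show ?thesis by simp
qed

text \<open>The right-hand side \<open>q *v v + f q\<close> lies below \<open>Q v\<close>, so the
  affine orbit is a subsolution.\<close>

lemma affine_sg_le_classical_solution:
  assumes Q: "sup_representation Q P f" and q: "q \<in> P" and u: "classical_solution Q u0 u" and t: "0 \<le> t"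
  shows "affine_sg q (f q) t u0 \<le> u t"
proof -
  have "affine_sg q (f q) t u0 $ i \<le> u t $ i + 0" for i
    by (rule generator_comparison[OF sup_representation_imp_generator[OF Q] affine_sg_has_derivative, of u "\<lambda>t. Q (u t)"])
      (use u t sup_representation_le[OF Q q] in \<open>auto simp: classical_solution_def less_eq_vec_def affine_sg_0\<close>)
  then show ?thesis by (simp add: less_eq_vec_def)
qed

text \<open>The dominating semigroup \<open>T\<close> is neither monotone nor continuous; all that is used is
  \<open>T (s + h) u0 = T h (T s u0) \<ge> S\<^sub>q (h) (T s u0)\<close> together with the monotonicity of \<open>S\<^sub>q\<close>.\<close>
lemma classical_solution_le_dominating_semigroup:
  fixes Q :: "real^'d::finite \<Rightarrow> real^'d"
  assumes Q: "sup_representation Q P f" and u: "classical_solution Q u0 u"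
    and T: "semigroup T" and dom: "\<And>t v q. 0 \<le> t \<Longrightarrow> q \<in> P \<Longrightarrow> affine_sg q (f q) t v \<le> T t v"
    and t: "0 \<le> t" and e: "0 < e"
  shows "\<forall>i. u t $ i \<le> T t u0 $ i + e * t"
proof -
  have qm: "Q_matrix q" if "q \<in> P" for q using Q that by (simp add: sup_representation_def)
  have step: "affine_sg q (f q) h (u s) $ i \<le> T (s + h) u0 $ i + e * s"
    if q: "q \<in> P" and h: "0 \<le> h" "0 \<le> s" and IH: "\<forall>i. u s $ i \<le> T s u0 $ i + e * s" for q h s i
  proof -
    have "affine_sg q (f q) h (u s) $ i \<le> affine_sg q (f q) h (T s u0) $ i + e * s"
      by (rule affine_sg_mono_shift[OF qm[OF q] h(1)]) (use IH in blast)
    moreover have "affine_sg q (f q) h (T s u0) $ i \<le> T h (T s u0) $ i"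
      using dom[OF h(1) q] by (simp add: less_eq_vec_def)
    moreover have "T h (T s u0) = T (s + h) u0"
    proof -
      have "T (h + s) = T h \<circ> T s" using T h by (simp add: semigroup_def)
      then show ?thesis by (simp add: add.commute)
    qed
    ultimately show ?thesis by simp
  qed
  show ?thesis
    using t
  proof (induction t rule: real_induct_closed_open)
    case zero
    then show ?case using T u by (simp add: semigroup_def classical_solution_def)
  next
    case (right s)
    have "\<forall>\<^sub>F h in at_right 0. u (s + h) $ i \<le> T (s + h) u0 $ i + e * (s + h)" for i
    proof -
      \<comment> \<open>The slack \<open>e\<close> pays for a supremum that may not be attained: a
        near-maximiser for component \<open>i\<close> makes the affine orbit plus
        \<open>e * h\<close> grow faster than \<open>u\<close>. Different components may use
        different \<open>q\<close>; finitely many of them still leave a common interval.\<close>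
      have "\<exists>q\<in>P. Q (u s) $ i - e < (q *v u s + f q) $ i"
        using sup_representation_least[OF Q, of "u s" i "Q (u s) $ i - e"] e by force
      then obtain q where q: "q \<in> P" "Q (u s) $ i - e < (q *v u s + f q) $ i" by blast
      define g where "g h = affine_sg q (f q) h (u s) $ i - u (s + h) $ i + e * h" for h
      have "((\<lambda>h. affine_sg q (f q) h (u s)) has_vector_derivative (q *v u s + f q)) (at 0 within {0..})"
        using affine_sg_has_derivative[of 0 q "f q" "u s"] by (simp add: affine_sg_0)
      moreover have "((\<lambda>h. u (s + h)) has_vector_derivative Q (u s)) (at 0 within {0..})"
        using classical_solution_shift[OF u right(1)] by (auto simp: classical_solution_def add.commute[of s])
      ultimately have "(g has_real_derivative ((q *v u s + f q) $ i - Q (u s) $ i + e)) (at 0 within {0..})"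
        unfolding g_def[abs_def] has_vector_derivative_vec_iff
        by (auto intro!: derivative_eq_intros)
      from has_real_derivative_pos_inc_right[OF this] q(2)
      obtain d where d: "d > 0" "\<And>h. 0 < h \<Longrightarrow> h < d \<Longrightarrow> g 0 < g h" by auto
      have "g 0 = 0" by (simp add: g_def affine_sg_0)
      have *: "u (s + h) $ i \<le> T (s + h) u0 $ i + e * (s + h)" if h: "0 < h" "h < d" for h
        using d(2)[OF h] \<open>g 0 = 0\<close> step[OF q(1) _ right, of h i] h unfolding g_def by (simp add: algebra_simps)
      show ?thesis
        by (rule eventually_mono[OF eventually_at_right_real[OF d(1)]]) (use * in auto)
    qed
    then have "\<forall>\<^sub>F h in at_right 0. \<forall>i. u (s + h) $ i \<le> T (s + h) u0 $ i + e * (s + h)"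
      by (simp add: eventually_all_finite)
    then show ?case unfolding eventually_at_right_field by auto
  next
    case (left s)
    obtain q where q: "q \<in> P" using Q by (auto simp: sup_representation_def)
    have contu: "continuous_on {0..} u"
      using u by (auto simp: classical_solution_def continuous_on_eq_continuous_within intro: has_vector_derivative_continuous)
    have ev: "\<forall>\<^sub>F r in at_left s. r \<in> {0<..<s}" by (rule eventually_at_left_real[OF left(1)])
    have u_lim: "(u \<longlongrightarrow> u s) (at_left s)"
      by (rule continuous_on_tendsto_compose[OF contu]) (use left(1) ev in \<open>auto intro: eventually_mono\<close>)
    \<comment> \<open>With the start fixed at \<open>u s\<close>, continuity of the affine semigroup
      in time suffices. Moving the start to \<open>u r\<close> costs
      \<open>norm (u s - u r)\<close>, which vanishes as \<open>r\<close> tends to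
      \<open>s\<close>.\<close>
    have a_lim: "((\<lambda>r. affine_sg q (f q) (s - r) (u s)) \<longlongrightarrow> affine_sg q (f q) (s - s) (u s)) (at_left s)"
    proof (rule continuous_on_tendsto_compose[OF affine_sg_continuous])
      show "((\<lambda>r. s - r) \<longlongrightarrow> s - s) (at_left s)" by (intro tendsto_intros)
    qed (auto intro: eventually_mono[OF ev])
    show ?case
    proof
      fix i
      have "((\<lambda>r. affine_sg q (f q) (s - r) (u s) $ i - norm (u s - u r) - e * r)
          \<longlongrightarrow> affine_sg q (f q) (s - s) (u s) $ i - norm (u s - u s) - e * s) (at_left s)"
        by (intro tendsto_intros a_lim u_lim)
      moreover have "\<forall>\<^sub>F r in at_left s. affine_sg q (f q) (s - r) (u s) $ i - norm (u s - u r) - e * r \<le> T s u0 $ i"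
        using ev
      proof (rule eventually_mono)
        fix r assume r: "r \<in> {0<..<s}"
        have "u s $ j \<le> u r $ j + norm (u s - u r)" for j
          using component_le_norm_cart[of "u s - u r" j] by (simp add: abs_le_iff)
        then have "affine_sg q (f q) (s - r) (u s) $ i \<le> affine_sg q (f q) (s - r) (u r) $ i + norm (u s - u r)"
          by (intro affine_sg_mono_shift[OF qm[OF q]]) (use r in auto)
        moreover have "affine_sg q (f q) (s - r) (u r) $ i \<le> T (r + (s - r)) u0 $ i + e * r"
          by (rule step[OF q]) (use r left(2)[of r] in auto)
        ultimately show "affine_sg q (f q) (s - r) (u s) $ i - norm (u s - u r) - e * r \<le> T s u0 $ i" by simp
      qed
      ultimately have "affine_sg q (f q) (s - s) (u s) $ i - norm (u s - u s) - e * s \<le> T s u0 $ i"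
        by (rule tendsto_upperbound) simp
      then show "u s $ i \<le> T s u0 $ i + e * s" by (simp add: affine_sg_0)
    qed
  qed
qed

lemma classical_semigroup_is_envelope:
  assumes Q: "sup_representation Q P f" and S: "semigroup S"
    and sol: "\<And>u0. classical_solution Q u0 (\<lambda>t. S t u0)"
  shows "semigroup_envelope P f S"
  unfolding semigroup_envelope_def
proof (intro conjI allI impI ballI S)
  show "affine_sg q (f q) t u0 \<le> S t u0" if "0 \<le> t" "q \<in> P" for t u0 q
    by (rule affine_sg_le_classical_solution[OF Q that(2) sol that(1)])
  fix T :: "real \<Rightarrow> real^'a \<Rightarrow> real^'a" and t :: real and u0
  assume T: "semigroup T \<and> (\<forall>t\<ge>0. \<forall>u0. \<forall>q\<in>P. affine_sg q (f q) t u0 \<le> T t u0)" and t: "0 \<le> t"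
  have bound: "S t u0 $ i \<le> T t u0 $ i + e * t" if "0 < e" for e i
    using classical_solution_le_dominating_semigroup[OF Q sol _ _ t that] T by blast
  have "S t u0 $ i \<le> T t u0 $ i" for i
  proof (rule field_le_epsilon)
    fix e :: real assume e: "e > 0"
    have "S t u0 $ i \<le> T t u0 $ i + e / (t + 1) * t" by (rule bound) (use e t in simp)
    moreover have "e / (t + 1) * t \<le> e" using e t by (simp add: field_simps)
    ultimately show "S t u0 $ i \<le> T t u0 $ i + e" by linarith
  qed
  then show "S t u0 \<le> T t u0" by (simp add: less_eq_vec_def)
qed

section \<open>Construction of a convex Markov chain\<close>

definition depends_on :: "real set \<Rightarrow> ((real \<Rightarrow> 'd) \<Rightarrow> 'r) \<Rightarrow> bool" where
  "depends_on J \<phi> \<longleftrightarrow> (\<forall>w w'. (\<forall>t\<in>J. w t = w' t) \<longrightarrow> \<phi> w = \<phi> w')"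

definition cylinder :: "((real \<Rightarrow> 'd) \<Rightarrow> 'r) \<Rightarrow> bool" where
  "cylinder \<phi> \<longleftrightarrow> (\<exists>J. finite J \<and> J \<subseteq> {0..} \<and> depends_on J \<phi>)"

lemma depends_onD: "depends_on J \<phi> \<Longrightarrow> (\<And>t. t \<in> J \<Longrightarrow> w t = w' t) \<Longrightarrow> \<phi> w = \<phi> w'"
  by (auto simp: depends_on_def)

lemma depends_on_mono: "depends_on J \<phi> \<Longrightarrow> J \<subseteq> K \<Longrightarrow> depends_on K \<phi>"
  unfolding depends_on_def by (meson subsetD)

lemma cylinder_compose: "cylinder \<phi> \<Longrightarrow> cylinder (\<lambda>w. h (\<phi> w))"
  unfolding cylinder_def depends_on_def by metis

lemma cylinder_common:
  assumes "cylinder \<phi>" "cylinder \<psi>"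
  obtains J where "finite J" "J \<subseteq> {0..}" "depends_on J \<phi>" "depends_on J \<psi>"
proof -
  obtain J K where "finite J" "J \<subseteq> {0..}" "depends_on J \<phi>" "finite K" "K \<subseteq> {0..}" "depends_on K \<psi>"
    using assms unfolding cylinder_def by blast
  then show ?thesis using that[of "J \<union> K"] by (auto intro: depends_on_mono)
qed

lemma cylinder_compose2: "cylinder \<phi> \<Longrightarrow> cylinder \<psi> \<Longrightarrow> cylinder (\<lambda>w. h (\<phi> w) (\<psi> w))"
  by (erule (1) cylinder_common) (unfold cylinder_def depends_on_def, metis)

lemma cylinder_const: "cylinder (\<lambda>_. c)"
  unfolding cylinder_def depends_on_def by (intro exI[of _ "{}"]) auto

lemma fun_subspace_cylinder: "fun_subspace {\<phi> :: (real \<Rightarrow> 'd) \<Rightarrow> real. cylinder \<phi>}"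
  by (auto simp: fun_subspace_def intro: cylinder_compose cylinder_compose2)

text \<open>The value, at time \<open>s\<close> in state \<open>i\<close>, of the payoff \<open>\<phi>\<close> monitored at the increasing times \<open>ts\<close>; the
  argument path records the states visited so far and is irrelevant at times not in \<open>ts\<close> if \<open>\<phi>\<close> depends
  on \<open>ts\<close> only.\<close>

primrec path_value ::
  "real list \<Rightarrow> (real \<Rightarrow> real^'d::finite \<Rightarrow> real^'d) \<Rightarrow> real \<Rightarrow> 'd \<Rightarrow> ((real \<Rightarrow> 'd) \<Rightarrow> real) \<Rightarrow> (real \<Rightarrow> 'd) \<Rightarrow> real"
where
  "path_value [] S s i \<phi> w = \<phi> w"
| "path_value (t # ts) S s i \<phi> w = S (t - s) (\<chi> j. path_value ts S t j \<phi> (w(t := j))) $ i"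

lemma path_value_cong:
  assumes "depends_on J \<phi>" "\<And>t. t \<in> J \<Longrightarrow> t \<notin> set ts \<Longrightarrow> w t = w' t"
  shows "path_value ts S s i \<phi> w = path_value ts S s i \<phi> w'"
  using assms(2)
proof (induction ts arbitrary: s i w w')
  case Nil
  then show ?case using assms(1) by (auto intro: depends_onD)
next
  case (Cons t ts)
  have "path_value ts S t j \<phi> (w(t := j)) = path_value ts S t j \<phi> (w'(t := j))" for j
    by (rule Cons.IH) (use Cons.prems in auto)
  then show ?case by simp
qed

locale convex_markov_semigroup =
  fixes S :: "real \<Rightarrow> real^'d::finite \<Rightarrow> real^'d"
  assumes sg: "semigroup S" and ker: "\<And>t. 0 \<le> t \<Longrightarrow> kernel (S t)" and conv: "\<And>t. 0 \<le> t \<Longrightarrow> convex_map (S t)"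
begin

lemma S_zero: "S 0 u = u"
  using sg by (simp add: semigroup_def)

lemma S_add: "0 \<le> s \<Longrightarrow> 0 \<le> t \<Longrightarrow> S s (S t u) = S (s + t) u"
  using sg by (simp add: semigroup_def)

lemma S_mono_shift: "0 \<le> t \<Longrightarrow> (\<And>j. u $ j \<le> v $ j + c) \<Longrightarrow> S t u $ i \<le> S t v $ i + c"
  using convex_kernel_mono_shift[OF ker conv] by blast

text \<open>Consistency in the monitoring times. At the last time \<open>S\<close> acts on a
  constant vector and preserves it; at an earlier time the semigroup law merges the two adjacent
  steps.\<close>

lemma path_value_drop:
  assumes dep: "depends_on J \<phi>" and t: "t \<notin> J"
    and "sorted_wrt (<) (xs @ t # ys)" "\<forall>r\<in>set (xs @ t # ys). s \<le> r"
  shows "path_value (xs @ t # ys) S s i \<phi> w = path_value (xs @ ys) S s i \<phi> w"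
  using assms(3,4)
proof (induction xs arbitrary: s i w)
  case Nil
  then have st: "s \<le> t" by simp
  have eq: "path_value ys S t j \<phi> (w(t := j)) = path_value ys S t j \<phi> w" for j
    by (rule path_value_cong[OF dep]) (use t in auto)
  show ?case
  proof (cases ys)
    case Nil
    have "(\<chi> j. \<phi> w) = (vec (\<phi> w) :: real^'d)" by (simp add: vec_eq_iff)
    then show ?thesis using eq Nil ker[of "t - s"] st by (simp add: kernel_def)
  next
    case (Cons r zs)
    then have tr: "t < r" using Nil.prems by simp
    let ?w = "\<chi> k. path_value zs S r k \<phi> (w(r := k))"
    have "path_value (t # ys) S s i \<phi> w = S (t - s) (\<chi> j. path_value ys S t j \<phi> w) $ i"
      by (simp add: eq)
    also have "(\<chi> j. path_value ys S t j \<phi> w) = S (r - t) ?w" by (simp add: vec_eq_iff Cons)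
    also have "S (t - s) (S (r - t) ?w) = S (r - s) ?w" using st tr by (simp add: S_add)
    finally show ?thesis by (simp add: Cons)
  qed
next
  case (Cons r xs)
  have "path_value (xs @ t # ys) S r j \<phi> (w(r := j)) = path_value (xs @ ys) S r j \<phi> (w(r := j))" for j
    by (rule Cons.IH) (use Cons.prems in \<open>auto simp: less_imp_le\<close>)
  then show ?case by simp
qed

lemma path_value_insert:
  assumes dep: "depends_on J \<phi>" and J: "finite J" "J \<subseteq> {0..}" and t: "0 \<le> t"
  shows "path_value (sorted_list_of_set (insert t J)) S 0 i \<phi> w = path_value (sorted_list_of_set J) S 0 i \<phi> w"
proof (cases "t \<in> J")
  case True
  then show ?thesis by (simp add: insert_absorb)
next
  case False
  let ?L = "sorted_list_of_set (insert t J)"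
  have set: "set ?L = insert t J" using J by (simp del: sorted_list_of_set.fold_insort_key.remove sorted_list_of_set_insert_remove)
  then obtain xs ys where L: "?L = xs @ t # ys" by (metis insertI1 split_list)
  have sorted: "sorted_wrt (<) ?L" by (rule strict_sorted_list_of_set)
  have "distinct ?L" by simp
  then have "xs @ ys = remove1 t ?L" unfolding L by (simp add: remove1_append)
  also have "\<dots> = sorted_list_of_set (insert t J - {t})" using J by (simp add: sorted_list_of_set_remove)
  also have "insert t J - {t} = J" using False by simp
  finally have eq: "xs @ ys = sorted_list_of_set J" .
  show ?thesis unfolding L eq[symmetric]
  proof (rule path_value_drop[OF dep False])
    show "\<forall>r\<in>set (xs @ t # ys). 0 \<le> r" using set J t unfolding L by auto
  qed (use sorted in \<open>simp add: L\<close>)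
qed

lemma path_value_union:
  assumes dep: "depends_on J \<phi>" and J: "finite J" "J \<subseteq> {0..}" and K: "finite K" "K \<subseteq> {0..}"
  shows "path_value (sorted_list_of_set (K \<union> J)) S 0 i \<phi> w = path_value (sorted_list_of_set J) S 0 i \<phi> w"
  using K
proof (induction K rule: finite_induct)
  case (insert t K)
  have "path_value (sorted_list_of_set (insert t (K \<union> J))) S 0 i \<phi> w = path_value (sorted_list_of_set (K \<union> J)) S 0 i \<phi> w"
    by (rule path_value_insert) (use insert J dep in \<open>auto intro: depends_on_mono\<close>)
  then show ?case using insert by simp
qed simp

text \<open>For a cylinder function neither the chosen set of times nor the \<open>undefined\<close>
  path affects the value; this is \<open>path_expectation_eq\<close>.\<close>

definition path_expectation :: "'d \<Rightarrow> ((real \<Rightarrow> 'd) \<Rightarrow> real) \<Rightarrow> real" where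
  "path_expectation i \<phi> =
     path_value (sorted_list_of_set (SOME J. finite J \<and> J \<subseteq> {0..} \<and> depends_on J \<phi>)) S 0 i \<phi> (\<lambda>_. undefined)"

text \<open>Two admissible sets of times are compared through their union, to which both can be
  enlarged without changing the value.\<close>

lemma path_expectation_eq:
  assumes J: "finite J" "J \<subseteq> {0..}" "depends_on J \<phi>"
  shows "path_expectation i \<phi> = path_value (sorted_list_of_set J) S 0 i \<phi> w"
proof -
  define K where "K = (SOME J. finite J \<and> J \<subseteq> {0..} \<and> depends_on J \<phi>)"
  have K: "finite K \<and> K \<subseteq> {0..} \<and> depends_on K \<phi>"
    unfolding K_def by (rule someI[of _ J]) (use J in blast)
  have "path_expectation i \<phi> = path_value (sorted_list_of_set K) S 0 i \<phi> (\<lambda>_. undefined)"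
    by (simp add: path_expectation_def K_def)
  also have "\<dots> = path_value (sorted_list_of_set K) S 0 i \<phi> w"
    by (rule path_value_cong[of K]) (use K in auto)
  also have "\<dots> = path_value (sorted_list_of_set (J \<union> K)) S 0 i \<phi> w"
    by (rule path_value_union[symmetric]) (use J K in auto)
  also have "\<dots> = path_value (sorted_list_of_set J) S 0 i \<phi> w"
    using path_value_union[of J \<phi> K i w] J K by (simp add: Un_commute)
  finally show ?thesis .
qed

lemma path_expectation_list:
  assumes "sorted_wrt (<) ts" "set ts \<subseteq> {0..}" "depends_on (set ts) \<phi>"
  shows "path_expectation i \<phi> = path_value ts S 0 i \<phi> w"
proof -
  have "sorted_list_of_set (set ts) = ts"
    using assms(1) by (simp add: sorted_list_of_set.idem_if_sorted_distinct strict_sorted_iff)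
  then show ?thesis using path_expectation_eq[of "set ts" \<phi> i w] assms by simp
qed

lemma path_value_mono_shift:
  assumes le: "\<And>w. \<phi> w \<le> \<psi> w + c" and "sorted_wrt (<) ts" "\<forall>r\<in>set ts. s \<le> r"
  shows "path_value ts S s i \<phi> w \<le> path_value ts S s i \<psi> w + c"
  using assms(2,3)
proof (induction ts arbitrary: s i w)
  case (Cons t ts)
  have "path_value ts S t j \<phi> (w(t := j)) \<le> path_value ts S t j \<psi> (w(t := j)) + c" for j
    by (rule Cons.IH) (use Cons.prems in \<open>auto simp: less_imp_le\<close>)
  then show ?case using Cons.prems by (simp add: S_mono_shift)
qed (use le in simp)

lemma path_value_convex:
  assumes a: "0 \<le> a" "a \<le> 1" and "sorted_wrt (<) ts" "\<forall>r\<in>set ts. s \<le> r"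
  shows "path_value ts S s i (\<lambda>w. (1 - a) * \<phi> w + a * \<psi> w) w
     \<le> (1 - a) * path_value ts S s i \<phi> w + a * path_value ts S s i \<psi> w"
  using assms(3,4)
proof (induction ts arbitrary: s i w)
  case (Cons t ts)
  let ?v = "\<lambda>\<phi>. \<chi> j. path_value ts S t j \<phi> (w(t := j))"
  have IH: "path_value ts S t j (\<lambda>w. (1 - a) * \<phi> w + a * \<psi> w) (w(t := j))
     \<le> (1 - a) * path_value ts S t j \<phi> (w(t := j)) + a * path_value ts S t j \<psi> (w(t := j))" for j
    by (rule Cons.IH) (use Cons.prems in \<open>auto simp: less_imp_le\<close>)
  have st: "0 \<le> t - s" using Cons.prems by simp
  have "S (t - s) (?v (\<lambda>w. (1 - a) * \<phi> w + a * \<psi> w)) $ i \<le> S (t - s) ((1 - a) *\<^sub>R ?v \<phi> + a *\<^sub>R ?v \<psi>) $ i + 0"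
    by (rule S_mono_shift[OF st]) (use IH in simp)
  also have "S (t - s) ((1 - a) *\<^sub>R ?v \<phi> + a *\<^sub>R ?v \<psi>) $ i \<le> (1 - a) * S (t - s) (?v \<phi>) $ i + a * S (t - s) (?v \<psi>) $ i"
    by (rule convex_onD[of UNIV "\<lambda>u. S (t - s) u $ i"]) (use conv[OF st] a in \<open>auto simp: convex_map_def\<close>)
  finally show ?case by simp
qed simp

lemma path_expectation_mono_shift:
  assumes "cylinder \<phi>" "cylinder \<psi>" "\<And>w. \<phi> w \<le> \<psi> w + c"
  shows "path_expectation i \<phi> \<le> path_expectation i \<psi> + c"
proof -
  obtain J where J: "finite J" "J \<subseteq> {0..}" "depends_on J \<phi>" "depends_on J \<psi>"
    using cylinder_common[OF assms(1,2)] .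
  show ?thesis
    unfolding path_expectation_eq[OF J(1,2,3), of i "\<lambda>_. undefined"] path_expectation_eq[OF J(1,2,4), of i "\<lambda>_. undefined"]
    by (rule path_value_mono_shift[OF assms(3)]) (use J in \<open>auto intro: strict_sorted_list_of_set\<close>)
qed

lemma path_expectation_convex:
  assumes "cylinder \<phi>" "cylinder \<psi>" "0 \<le> a" "a \<le> 1"
  shows "path_expectation i (\<lambda>w. (1 - a) * \<phi> w + a * \<psi> w) \<le> (1 - a) * path_expectation i \<phi> + a * path_expectation i \<psi>"
proof -
  obtain J where J: "finite J" "J \<subseteq> {0..}" "depends_on J \<phi>" "depends_on J \<psi>"
    using cylinder_common[OF assms(1,2)] .
  have dep: "depends_on J (\<lambda>w. (1 - a) * \<phi> w + a * \<psi> w)" using J(3,4) unfolding depends_on_def by metis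
  let ?w = "\<lambda>_. undefined"
  show ?thesis
    unfolding path_expectation_eq[OF J(1,2,3), of i ?w] path_expectation_eq[OF J(1,2,4), of i ?w]
      path_expectation_eq[OF J(1,2) dep, of i ?w]
    by (rule path_value_convex) (use J assms in \<open>auto intro: strict_sorted_list_of_set\<close>)
qed

lemma path_expectation_const: "path_expectation i (\<lambda>_. c) = c"
  using path_expectation_list[of "[]" "\<lambda>_. c" i "\<lambda>_. undefined"] by (simp add: depends_on_def)

lemma path_expectation_single:
  assumes "0 \<le> t"
  shows "path_expectation i (\<lambda>w. g (w t)) = S t (\<chi> j. g j) $ i"
  using path_expectation_list[of "[t]" "\<lambda>w. g (w t)" i "\<lambda>_. undefined"] assms by (simp add: depends_on_def)

text \<open>The recursion evaluates the last time interval first: \<open>\<psi>\<close> is the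
  value, seen from time \<open>s\<close>, of the payoff still open until
  \<open>s + t\<close>.\<close>

lemma path_value_last:
  assumes "\<And>w. S t (\<chi> k. \<phi> (w(s + t := k))) $ (w s) = \<psi> w"
  shows "path_value (xs @ [s, s + t]) S r i \<phi> w = path_value (xs @ [s]) S r i \<psi> w"
proof (induction xs arbitrary: r i w)
  case Nil
  have "S t (\<chi> k. \<phi> (w(s := j, s + t := k))) $ j = \<psi> (w(s := j))" for j
    using assms[of "w(s := j)"] by simp
  then show ?case by simp
qed simp

end

section \<open>Cylinder sets and measures on the path space\<close>

definition cylinder_algebra :: "(real \<Rightarrow> 'd) set set" where
  "cylinder_algebra = {A. cylinder (\<lambda>w. w \<in> A)}"

lemma cylinder_algebra_algebra: "algebra UNIV (cylinder_algebra :: (real \<Rightarrow> 'd) set set)"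
  unfolding algebra_iff_Un cylinder_algebra_def
  by (auto simp: cylinder_const intro: cylinder_compose cylinder_compose2)

lemma cylinder_openin:
  fixes A :: "(real \<Rightarrow> 'd) set"
  assumes "A \<in> cylinder_algebra"
  shows "openin (product_topology (\<lambda>_. discrete_topology UNIV) UNIV) A"
proof -
  obtain J where J: "finite J" "depends_on J (\<lambda>w. w \<in> A)"
    using assms unfolding cylinder_algebra_def cylinder_def by blast
  let ?B = "\<lambda>w. PiE UNIV (\<lambda>t. if t \<in> J then {w t} else UNIV)"
  have "openin (product_topology (\<lambda>_. discrete_topology UNIV) UNIV) (?B w)" for w :: "real \<Rightarrow> 'd"
  proof (rule product_topology_basis)
    have "{t. (if t \<in> J then {w t} else UNIV) \<noteq> (UNIV :: 'd set)} \<subseteq> J" by auto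
    then show "finite {t. (if t \<in> J then {w t} else UNIV) \<noteq> topspace (discrete_topology (UNIV :: 'd set))}"
      using J(1) by (simp add: finite_subset)
  qed auto
  moreover have "A = (\<Union>w\<in>A. ?B w)"
  proof (rule set_eqI, rule iffI)
    fix w' assume "w' \<in> (\<Union>w\<in>A. ?B w)"
    then obtain w where w: "w \<in> A" "w' \<in> ?B w" by blast
    have "w' t = w t" if "t \<in> J" for t using PiE_mem[OF w(2), of t] that by simp
    then show "w' \<in> A" using depends_onD[OF J(2), of w' w] w(1) by simp
  next
    fix w assume "w \<in> A"
    moreover have "w \<in> ?B w" by (auto simp: PiE_def extensional_def)
    ultimately show "w \<in> (\<Union>w\<in>A. ?B w)" by blast
  qed
  ultimately show ?thesis by (metis (no_types, lifting) openin_clauses(3) imageE)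
qed

text \<open>Complements of cylinder sets are cylinder sets, so each \<open>A n\<close> is closed in
  a product of finite discrete spaces. That product is compact, and the finite intersection property
  applies.\<close>

lemma cylinder_decseq_empty:
  fixes A :: "nat \<Rightarrow> (real \<Rightarrow> 'd::finite) set"
  assumes A: "range A \<subseteq> cylinder_algebra" and dec: "decseq A" and empty: "(\<Inter>n. A n) = {}"
  shows "\<exists>n. A n = {}"
proof (rule ccontr)
  let ?X = "product_topology (\<lambda>_::real. discrete_topology (UNIV :: 'd set)) UNIV"
  assume ne: "\<not> (\<exists>n. A n = {})"
  interpret algebra UNIV "cylinder_algebra :: (real \<Rightarrow> 'd) set set" by (rule cylinder_algebra_algebra)
  have top: "topspace ?X = UNIV" by (auto simp: PiE_UNIV_domain)
  have "compact_space ?X" by (simp add: compact_space_product_topology compact_space_discrete_topology)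
  moreover have "\<forall>C\<in>range A. closedin ?X C"
  proof
    fix C assume "C \<in> range A"
    then have "UNIV - C \<in> cylinder_algebra" using A by auto
    then show "closedin ?X C" using cylinder_openin by (auto simp: closedin_def top)
  qed
  moreover have "\<Inter>F \<noteq> {}" if F: "finite F" "F \<subseteq> range A" for F
  proof -
    obtain N where N: "finite N" "F = A ` N" using finite_subset_image[OF F] by blast
    have "A (Max (insert 0 N)) \<subseteq> A k" if "k \<in> N" for k
      by (rule decseqD[OF dec], rule Max_ge) (use N(1) that in auto)
    then have "A (Max (insert 0 N)) \<subseteq> \<Inter>F" unfolding N(2) by blast
    then show ?thesis using ne by blast
  qed
  ultimately have "\<Inter>(range A) \<noteq> {}" unfolding compact_space_fip by blast
  then show False using empty by blast
qed

definition cylinder_space :: "(real \<Rightarrow> 'd) measure" where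
  "cylinder_space = sigma UNIV cylinder_algebra"

lemma sets_cylinder_space: "sets cylinder_space = sigma_sets UNIV cylinder_algebra"
  and space_cylinder_space: "space cylinder_space = UNIV"
  by (auto simp: cylinder_space_def)

lemma cylinder_measurable:
  assumes "cylinder \<phi>" "space N = UNIV"
  shows "\<phi> \<in> measurable cylinder_space N"
proof (rule measurableI)
  fix A
  have "\<phi> -` A \<in> cylinder_algebra"
    unfolding cylinder_algebra_def vimage_def using cylinder_compose[OF assms(1), of "\<lambda>x. x \<in> A"] by simp
  then show "\<phi> -` A \<inter> space cylinder_space \<in> sets cylinder_space"
    by (simp add: sets_cylinder_space space_cylinder_space sigma_sets.Basic)
qed (use assms in auto)

text \<open>Finitely many times and states leave finitely many values, which reduces integrals of
  cylinder functions to finite sums over level sets.\<close>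

lemma cylinder_finite_range:
  fixes \<phi> :: "(real \<Rightarrow> 'd::finite) \<Rightarrow> 'r"
  assumes "cylinder \<phi>"
  shows "finite (range \<phi>)"
proof -
  obtain J where J: "finite J" "depends_on J \<phi>" using assms by (auto simp: cylinder_def)
  have "range \<phi> \<subseteq> \<phi> ` (PiE J (\<lambda>_. UNIV))"
  proof
    fix y assume "y \<in> range \<phi>"
    then obtain w where "y = \<phi> w" by blast
    also have "\<phi> w = \<phi> (restrict w J)" by (rule depends_onD[OF J(2)]) simp
    finally show "y \<in> \<phi> ` (PiE J (\<lambda>_. UNIV))" by auto
  qed
  then show ?thesis using J(1) by (meson finite_PiE finite finite_imageI finite_subset)
qed

text \<open>Cylinder sets are clopen in a compact product space, so every additive set function on them is
  continuous at the empty set and Caratheodory's theorem applies.\<close>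

lemma positive_functional_measure:
  fixes L :: "((real \<Rightarrow> 'd::finite) \<Rightarrow> real) \<Rightarrow> real"
  assumes lin: "linear_on_fun {\<phi>. cylinder \<phi>} L"
    and pos: "\<And>\<phi>. cylinder \<phi> \<Longrightarrow> (\<And>w. 0 \<le> \<phi> w) \<Longrightarrow> 0 \<le> L \<phi>" and one: "L (\<lambda>_. 1) = 1"
  obtains P where "prob_space P" "sets P = sets cylinder_space"
    "\<And>\<phi>. cylinder \<phi> \<Longrightarrow> integral\<^sup>L P \<phi> = L \<phi>"
proof -
  let ?C = "cylinder_algebra :: (real \<Rightarrow> 'd) set set"
  interpret algebra UNIV ?C by (rule cylinder_algebra_algebra)
  have add: "L (\<lambda>x. f x + g x) = L f + L g" if "cylinder f" "cylinder g" for f g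
    using lin that unfolding linear_on_fun_def by blast
  have hom: "L (\<lambda>x. c * f x) = c * L f" if "cylinder f" for f c
    using lin that unfolding linear_on_fun_def by blast
  have zero: "L (\<lambda>_. 0) = 0" using hom[OF cylinder_const, of 0 0] by simp
  have ind: "cylinder (indicat_real A)" if "A \<in> ?C" for A
    using cylinder_compose[of "\<lambda>w. w \<in> A" "\<lambda>b. if b then 1 else 0"] that
    by (simp add: cylinder_algebra_def indicator_def[abs_def] of_bool_def)
  define m where "m A = L (indicat_real A)" for A
  have m0: "0 \<le> m A" if "A \<in> ?C" for A unfolding m_def by (rule pos[OF ind[OF that]]) simp
  have m_empty: "m {} = 0" using zero by (simp add: m_def indicator_def[abs_def])
  have madd: "m (A \<union> B) = m A + m B" if "A \<in> ?C" "B \<in> ?C" "A \<inter> B = {}" for A B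
  proof -
    have "indicat_real (A \<union> B) = (\<lambda>w. indicat_real A w + indicat_real B w)"
      using that(3) by (auto simp: indicator_def fun_eq_iff)
    then show ?thesis unfolding m_def using add[OF ind[OF that(1)] ind[OF that(2)]] by simp
  qed
  have "\<exists>\<mu>. (\<forall>s\<in>?C. \<mu> s = ennreal (m s)) \<and> measure_space UNIV (sigma_sets UNIV ?C) \<mu>"
  proof (rule caratheodory_empty_continuous)
    show "positive ?C (\<lambda>s. ennreal (m s))" by (simp add: positive_def m_empty)
    show "Measure_Space.additive ?C (\<lambda>s. ennreal (m s))"
      by (auto simp: Measure_Space.additive_def madd m0 ennreal_plus)
    show "ennreal (m A) \<noteq> \<infinity>" for A by simp
    fix A :: "nat \<Rightarrow> (real \<Rightarrow> 'd) set" assume A: "range A \<subseteq> ?C" "decseq A" "(\<Inter>n. A n) = {}"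
    obtain n where n: "A n = {}" using cylinder_decseq_empty[OF A] by blast
    have "\<forall>\<^sub>F k in sequentially. ennreal (m (A k)) = 0"
    proof (rule eventually_sequentiallyI[of n])
      fix k assume "n \<le> k"
      then have "A k = {}" using decseqD[OF A(2)] n by blast
      then show "ennreal (m (A k)) = 0" by (simp add: m_empty)
    qed
    then show "(\<lambda>k. ennreal (m (A k))) \<longlonglongrightarrow> 0" by (rule tendsto_eventually)
  qed
  then obtain \<mu> where \<mu>: "\<And>s. s \<in> ?C \<Longrightarrow> \<mu> s = ennreal (m s)" and ms: "measure_space UNIV (sigma_sets UNIV ?C) \<mu>"
    by blast
  define P where "P = measure_of UNIV ?C \<mu>"
  have sets: "sets P = sigma_sets UNIV ?C" by (simp add: P_def)
  have space: "space P = UNIV" by (simp add: P_def)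
  have emeasure: "emeasure P A = ennreal (m A)" if "A \<in> ?C" for A
  proof -
    have "emeasure P A = \<mu> A"
      by (rule emeasure_measure_of[OF P_def])
        (use ms that in \<open>auto simp: measure_space_def sets sigma_sets.Basic\<close>)
    then show ?thesis using \<mu>[OF that] by simp
  qed
  have "m UNIV = 1" using one by (simp add: m_def indicator_def[abs_def])
  then have prob: "prob_space P" by (intro prob_spaceI) (simp add: space emeasure)
  interpret prob_space P by (rule prob)
  have meas: "measure P A = m A" if "A \<in> ?C" for A
    using emeasure[OF that] m0[OF that] by (simp add: measure_def)
  have L_sum: "cylinder (\<lambda>w. \<Sum>y\<in>Y. f y w) \<and> L (\<lambda>w. \<Sum>y\<in>Y. f y w) = (\<Sum>y\<in>Y. L (f y))"
    if "finite Y" "\<And>y. y \<in> Y \<Longrightarrow> cylinder (f y)" for Y :: "real set" and f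
    using that
  proof (induction Y rule: finite_induct)
    case empty
    then show ?case by (simp add: zero cylinder_const)
  next
    case (insert a Y)
    then show ?case using cylinder_compose2[of "f a" "\<lambda>w. \<Sum>y\<in>Y. f y w" "(+)"] by (simp add: add)
  qed
  have "integral\<^sup>L P \<phi> = L \<phi>" if \<phi>: "cylinder \<phi>" for \<phi>
  proof -
    have fin: "finite (range \<phi>)" by (rule cylinder_finite_range[OF \<phi>])
    have C: "\<phi> -` {y} \<in> ?C" for y
      unfolding cylinder_algebra_def vimage_def using cylinder_compose[OF \<phi>, of "\<lambda>x. x \<in> {y}"] by simp
    have dec: "\<phi> = (\<lambda>w. \<Sum>y\<in>range \<phi>. y * indicat_real (\<phi> -` {y}) w)"
    proof
      fix w
      have "(\<Sum>y\<in>range \<phi>. y * indicat_real (\<phi> -` {y}) w) = (\<Sum>y\<in>range \<phi>. if y = \<phi> w then y else 0)"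
        by (rule sum.cong) (auto simp: indicator_def)
      then show "\<phi> w = (\<Sum>y\<in>range \<phi>. y * indicat_real (\<phi> -` {y}) w)"
        using fin by simp
    qed
    have "L \<phi> = (\<Sum>y\<in>range \<phi>. L (\<lambda>w. y * indicat_real (\<phi> -` {y}) w))"
      by (subst dec, rule conjunct2[OF L_sum[OF fin]]) (rule cylinder_compose[OF ind[OF C]])
    also have "\<dots> = (\<Sum>y\<in>range \<phi>. y * m (\<phi> -` {y}))"
      unfolding m_def by (intro sum.cong refl hom ind C)
    also have "\<dots> = (\<Sum>y\<in>range \<phi>. integral\<^sup>L P (\<lambda>w. y * indicat_real (\<phi> -` {y}) w))"
      by (simp add: meas[OF C] space)
    also have "\<dots> = integral\<^sup>L P (\<lambda>w. \<Sum>y\<in>range \<phi>. y * indicat_real (\<phi> -` {y}) w)"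
      by (rule Bochner_Integration.integral_sum[symmetric])
        (use C sets in \<open>auto intro!: integrable_mult_right integrable_real_indicator simp: emeasure_eq_measure\<close>)
    finally show ?thesis using dec by simp
  qed
  then show ?thesis using that[OF prob] sets sets_cylinder_space by auto
qed

section \<open>Dual representation and the Markov property\<close>

context convex_markov_semigroup
begin

text \<open>The convex conjugate of \<open>path_expectation i\<close>, tested on cylinder
  functions.\<close>

definition penalty :: "'d \<Rightarrow> (real \<Rightarrow> 'd) measure \<Rightarrow> real" where
  "penalty i P = (SUP \<phi>\<in>{\<phi>. cylinder \<phi>}. integral\<^sup>L P \<phi> - path_expectation i \<phi>)"

text \<open>Boundedness expresses that the penalty is finite; otherwise the real-valued supremum in
  \<open>penalty\<close> would carry no meaning.\<close>

definition priors :: "'d \<Rightarrow> (real \<Rightarrow> 'd) measure set" where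
  "priors i = {P. prob_space P \<and> sets P = sets cylinder_space \<and>
     bdd_above ((\<lambda>\<phi>. integral\<^sup>L P \<phi> - path_expectation i \<phi>) ` {\<phi>. cylinder \<phi>})}"

definition chain_expectation :: "'d \<Rightarrow> ((real \<Rightarrow> 'd) \<Rightarrow> real) \<Rightarrow> real" where
  "chain_expectation i X = (SUP P\<in>priors i. integral\<^sup>L P X - penalty i P)"

lemma penalty_ge:
  "P \<in> priors i \<Longrightarrow> cylinder \<phi> \<Longrightarrow> integral\<^sup>L P \<phi> - path_expectation i \<phi> \<le> penalty i P"
  unfolding penalty_def by (rule cSUP_upper) (auto simp: priors_def)

text \<open>The subgradient inequality at \<open>v\<close>, tested in the direction w - v, says that
  \<open>v\<close> maximises the expression whose supremum is the penalty of the representing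
  measure.\<close>

lemma optimal_prior:
  assumes v: "cylinder v"
  shows "\<exists>P\<in>priors i. penalty i P = integral\<^sup>L P v - path_expectation i v"
proof -
  have "\<exists>L. linear_on_fun {\<phi>. cylinder \<phi>} L \<and>
      (\<forall>w\<in>{\<phi>. cylinder \<phi>}. L w \<le> path_expectation i (\<lambda>x. v x + w x) - path_expectation i v)"
    by (rule convex_subgradient_fun[OF fun_subspace_cylinder]) (use v path_expectation_convex in auto)
  then obtain L where lin: "linear_on_fun {\<phi>. cylinder \<phi>} L"
    and L: "\<And>w. cylinder w \<Longrightarrow> L w \<le> path_expectation i (\<lambda>x. v x + w x) - path_expectation i v"
    by auto
  have add: "L (\<lambda>x. f x + g x) = L f + L g" if "cylinder f" "cylinder g" for f g
    using lin that unfolding linear_on_fun_def by blast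
  have hom: "L (\<lambda>x. c * f x) = c * L f" if "cylinder f" for f c
    using lin that unfolding linear_on_fun_def by blast
  \<comment> \<open>The common source of positivity and normalisation: \<open>c = 0\<close> at
    \<open>- \<phi>\<close> gives the former, \<open>c = 1\<close> and \<open>c = -1\<close> at
    constants the latter.\<close>
  have upper: "L w \<le> c" if w: "cylinder w" "\<And>x. w x \<le> c" for w c
  proof -
    have "path_expectation i (\<lambda>x. v x + w x) \<le> path_expectation i v + c"
      by (rule path_expectation_mono_shift) (use v w in \<open>auto intro: cylinder_compose2\<close>)
    then show ?thesis using L[OF w(1)] by linarith
  qed
  have neg: "L (\<lambda>x. - f x) = - L f" if "cylinder f" for f using hom[OF that, of "-1"] by simp
  have pos: "0 \<le> L \<phi>" if "cylinder \<phi>" "\<And>w. 0 \<le> \<phi> w" for \<phi>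
    using upper[of "\<lambda>x. - \<phi> x" 0] that neg[of \<phi>] cylinder_compose[OF that(1), of uminus] by simp
  have one: "L (\<lambda>_. 1) = 1"
  proof -
    have "L (\<lambda>_. 1) \<le> 1" "L (\<lambda>_. - 1) \<le> -1" by (rule upper; simp add: cylinder_const)+
    then show ?thesis using neg[OF cylinder_const, of 1] by simp
  qed
  obtain P where P: "prob_space P" "sets P = sets cylinder_space" "\<And>\<phi>. cylinder \<phi> \<Longrightarrow> integral\<^sup>L P \<phi> = L \<phi>"
    by (rule positive_functional_measure[OF lin pos one]) (assumption | rule that | blast)+
  have le: "integral\<^sup>L P w - path_expectation i w \<le> integral\<^sup>L P v - path_expectation i v" if w: "cylinder w" for w
  proof -
    have "cylinder (\<lambda>x. w x + (-1) * v x)" by (rule cylinder_compose2[OF w v])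
    from L[OF this] have "L (\<lambda>x. w x + (-1) * v x) \<le> path_expectation i w - path_expectation i v" by simp
    moreover have "L (\<lambda>x. w x + (-1) * v x) = L w + L (\<lambda>x. (-1) * v x)"
      by (rule add[OF w cylinder_compose[OF v]])
    ultimately show ?thesis using neg[OF v] P(3) v w by simp
  qed
  have "P \<in> priors i" 
    unfolding priors_def using P(1,2) le by (auto intro!: bdd_aboveI2[where M = "integral\<^sup>L P v - path_expectation i v"])
  moreover have "penalty i P = integral\<^sup>L P v - path_expectation i v"
    unfolding penalty_def by (rule cSup_eq_maximum) (use v le in auto)
  ultimately show ?thesis by blast
qed

text \<open>One inequality is Fenchel-Young, in the form \<open>penalty_ge\<close>; the optimal
  prior of \<open>v\<close> turns it into an equality.\<close>

lemma chain_expectation_cylinder: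
  assumes v: "cylinder v"
  shows "chain_expectation i v = path_expectation i v"
  unfolding chain_expectation_def
proof (rule cSup_eq_maximum)
  obtain P where "P \<in> priors i" "penalty i P = integral\<^sup>L P v - path_expectation i v"
    using optimal_prior[OF v] by blast
  then show "path_expectation i v \<in> (\<lambda>P. integral\<^sup>L P v - penalty i P) ` priors i" by force
  show "x \<le> path_expectation i v" if "x \<in> (\<lambda>P. integral\<^sup>L P v - penalty i P) ` priors i" for x
    using that penalty_ge[OF _ v] by force
qed

lemma convex_expectation_chain: "convex_expectation cylinder_space (chain_expectation i)"
  unfolding convex_expectation_def
proof (intro exI conjI)
  have nonneg: "0 \<le> penalty i P" if "P \<in> priors i" for P
    using penalty_ge[OF that cylinder_const, of 0] by (simp add: path_expectation_const)
  \<comment> \<open>The optimal prior of the zero function has penalty 0, so the infimum is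
    attained.\<close>
  obtain P0 where P0: "P0 \<in> priors i" "penalty i P0 = 0"
    using optimal_prior[OF cylinder_const, of i 0] by (auto simp: path_expectation_const)
  show "priors i \<noteq> {}" using P0 by blast
  show "\<forall>P\<in>priors i. prob_space P \<and> sets P = sets cylinder_space" by (simp add: priors_def)
  show "\<forall>P\<in>priors i. 0 \<le> penalty i P" using nonneg by blast
  show "(INF P\<in>priors i. penalty i P) = 0"
    by (rule cInf_eq_minimum) (use P0 nonneg in force)+
qed (simp add: chain_expectation_def)

text \<open>A chain must have measurable coordinates at negative times as well, whereas cylinders only see
  nonnegative times; hence the truncation.\<close>

definition coordinate :: "real \<Rightarrow> (real \<Rightarrow> 'd) \<Rightarrow> 'd" where
  "coordinate t w = w (max 0 t)"

text \<open>Both sides concern cylinder functions, where the expectation is the backward recursion;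
  they differ only in whether its step over the last interval has already been carried out.\<close>

lemma chain_markov_property:
  fixes ts :: "real list" and v0 :: "'d list \<Rightarrow> 'd \<Rightarrow> real"
  assumes st: "0 \<le> s" "0 \<le> t" and ts: "sorted_wrt (<) ts" "\<forall>r\<in>set ts. 0 \<le> r \<and> r \<le> s"
  shows "chain_expectation i (\<lambda>w. v0 (map (\<lambda>r. coordinate r w) ts) (coordinate (s + t) w)) =
    chain_expectation i (\<lambda>w. chain_expectation (coordinate s w) (\<lambda>w'. v0 (map (\<lambda>r. coordinate r w) ts) (coordinate t w')))"
proof -
  have map_eq: "map (\<lambda>r. coordinate r w) ts = map w ts" for w
    using ts(2) by (auto simp: coordinate_def max_def)
  define \<phi> where "\<phi> w = v0 (map w ts) (w (s + t))" for w
  define \<psi> where "\<psi> w = S t (\<chi> j. v0 (map w ts) j) $ (w s)" for w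
  have co: "coordinate s w = w s" "coordinate t w = w t" "coordinate (s + t) w = w (s + t)" for w
    using st by (auto simp: coordinate_def max_def)
  have inner: "chain_expectation k (\<lambda>w'. g (w' t)) = S t (\<chi> j. g j) $ k" for k g
  proof -
    have "cylinder (\<lambda>w' :: real \<Rightarrow> 'd. g (w' t))"
      unfolding cylinder_def by (rule exI[of _ "{t}"]) (use st in \<open>auto simp: depends_on_def\<close>)
    then show ?thesis using chain_expectation_cylinder path_expectation_single[OF st(2)] by simp
  qed
  \<comment> \<open>\<open>ts\<close> may or may not end in \<open>s\<close>; filtering
    \<open>s\<close> out and appending it again gives a strictly increasing list that covers all
    observation times.\<close>
  let ?A = "filter (\<lambda>r. r < s) ts @ [s]" and ?B = "filter (\<lambda>r. r < s) ts @ [s, s + t]"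
  have sub: "set ts \<subseteq> set ?A" using ts(2) by auto
  have map_eq_on_past: "map w ts = map w' ts" if "\<And>r. r \<in> set ?A \<Longrightarrow> w r = w' r" for w w' :: "real \<Rightarrow> 'd"
    using sub that by (auto simp del: set_append)
  have dep\<phi>: "depends_on (set ?B) \<phi>"
    unfolding depends_on_def \<phi>_def
  proof (intro allI impI)
    fix w w' :: "real \<Rightarrow> 'd" assume past: "\<forall>r\<in>set ?B. w r = w' r"
    have "map w ts = map w' ts" by (rule map_eq_on_past) (use past in auto)
    moreover have "w (s + t) = w' (s + t)" using past by simp
    ultimately show "v0 (map w ts) (w (s + t)) = v0 (map w' ts) (w' (s + t))" by (simp only:)
  qed
  have dep\<psi>: "depends_on (set ?A) \<psi>"
    unfolding depends_on_def \<psi>_def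
  proof (intro allI impI)
    fix w w' :: "real \<Rightarrow> 'd" assume past: "\<forall>r\<in>set ?A. w r = w' r"
    have "map w ts = map w' ts" by (rule map_eq_on_past) (use past in auto)
    moreover have "w s = w' s" using past by simp
    ultimately show "S t (\<chi> j. v0 (map w ts) j) $ w s = S t (\<chi> j. v0 (map w' ts) j) $ w' s" by (simp only:)
  qed
  have fin: "set ?A \<subseteq> {0..}" "set ?B \<subseteq> {0..}" using ts(2) st by auto
  have cyl: "cylinder \<phi>" "cylinder \<psi>"
    unfolding cylinder_def using dep\<phi> dep\<psi> fin by (meson List.finite_set)+
  have eq: "path_expectation i \<phi> = path_expectation i \<psi>"
  \<comment> \<open>For \<open>t = 0\<close> the list \<open>?B\<close> repeats \<open>s\<close> and
    is not strictly increasing, but then \<open>\<phi>\<close> and \<open>\<psi>\<close> coincide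
    because \<open>S 0\<close> is the identity.\<close>
  proof (cases "t = 0")
    case True
    then have "\<phi> = \<psi>" by (simp add: \<phi>_def \<psi>_def S_zero fun_eq_iff)
    then show ?thesis by simp
  next
    case False
    then have t: "0 < t" using st by simp
    have sorted: "sorted_wrt (<) ?A" "sorted_wrt (<) ?B"
      using ts(1) t by (auto simp: sorted_wrt_append sorted_wrt_filter)
    have "S t (\<chi> k. \<phi> (w(s + t := k))) $ (w s) = \<psi> w" for w
    proof -
      have "map (w(s + t := k)) ts = map w ts" for k using ts(2) t by auto
      then show ?thesis unfolding \<phi>_def \<psi>_def by (simp only: fun_upd_same)
    qed
    from path_value_last[of t \<phi> s \<psi>, OF this] show ?thesis
      using path_expectation_list[OF sorted(1) fin(1) dep\<psi>, of i "\<lambda>_. undefined"]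
        path_expectation_list[OF sorted(2) fin(2) dep\<phi>, of i "\<lambda>_. undefined"] by simp
  qed
  show ?thesis
    unfolding map_eq co inner
    using eq chain_expectation_cylinder[OF cyl(1), of i] chain_expectation_cylinder[OF cyl(2), of i]
    by (simp add: \<phi>_def[abs_def] \<psi>_def[abs_def])
qed

lemma cylinder_coordinate: "cylinder (\<lambda>w. g (coordinate t w))"
  unfolding cylinder_def coordinate_def by (rule exI[of _ "{max 0 t}"]) (auto simp: depends_on_def)

lemma chain_value_chain_expectation:
  assumes "0 \<le> t"
  shows "chain_value chain_expectation coordinate u t = S t u"
proof -
  have "chain_expectation i (\<lambda>w. u $ coordinate t w) = S t u $ i" for i
    using chain_expectation_cylinder[OF cylinder_coordinate, of i "($) u" t]
      path_expectation_single[OF assms, of i "($) u"] assms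
    by (simp add: coordinate_def max_def)
  then show ?thesis by (simp add: chain_value_def vec_eq_iff)
qed

lemma convex_markov_chain_exists: "convex_markov_chain cylinder_space chain_expectation coordinate"
  unfolding convex_markov_chain_def
proof (intro conjI allI impI)
  show "coordinate t \<in> measurable cylinder_space (count_space UNIV)" for t
    using cylinder_measurable[OF cylinder_coordinate[of "\<lambda>x. x"]] by simp
  show "convex_expectation cylinder_space (chain_expectation i)" for i by (rule convex_expectation_chain)
  show "chain_expectation i (\<lambda>w. u0 $ coordinate 0 w) = u0 $ i" for u0 :: "real^'d" and i
    using chain_value_chain_expectation[of 0 u0] by (simp add: chain_value_def vec_eq_iff S_zero)
qed (rule chain_markov_property; blast)

end

section \<open>Equivalence of the characterisations\<close>

lemma semigroup_derivative_imp_generator: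
  fixes S :: "real \<Rightarrow> real^'d::finite \<Rightarrow> real^'d"
  assumes "convex_semigroup S" "markovian_semigroup S"
    and "\<And>u0. ((\<lambda>h. (1 / h) *\<^sub>R (S h u0 - u0)) \<longlongrightarrow> Q u0) (at_right 0)"
  shows "convex_generator Q"
  by (rule kernel_derivative_generator[of S]) (use assms in \<open>auto simp: convex_semigroup_def markovian_semigroup_def\<close>)

lemma chain_derivative_imp_generator:
  fixes E :: "'d::finite \<Rightarrow> ('w \<Rightarrow> real) \<Rightarrow> real"
  assumes ch: "convex_markov_chain M E X"
    and "\<And>u0. ((\<lambda>h. (1 / h) *\<^sub>R (chain_value E X u0 h - u0)) \<longlongrightarrow> Q u0) (at_right 0)"
  shows "convex_generator Q"
  by (rule kernel_derivative_generator[of "chain_semigroup E X"])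
    (use assms chain_semigroup_props[OF ch] in \<open>auto simp: chain_semigroup_def\<close>)

lemma chain_value_classical_solution:
  fixes E :: "'d::finite \<Rightarrow> ('w \<Rightarrow> real) \<Rightarrow> real"
  assumes ch: "convex_markov_chain M E X"
    and "\<And>u0. ((\<lambda>h. (1 / h) *\<^sub>R (chain_value E X u0 h - u0)) \<longlongrightarrow> Q u0) (at_right 0)"
  shows "classical_solution Q u0 (chain_value E X u0)"
  using convex_markov_semigroup_classical_solution[OF chain_semigroup_props[OF ch], of Q u0] assms(2)
  by (simp add: chain_semigroup_def)

lemma generator_imp_chain:
  fixes Q :: "real^'d::finite \<Rightarrow> real^'d"
  assumes Q: "convex_generator Q"
  shows "\<exists>(M :: (real \<Rightarrow> 'd) measure) E X. convex_markov_chain M E X \<and>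
    (\<forall>u0. ((\<lambda>h. (1 / h) *\<^sub>R (chain_value E X u0 h - u0)) \<longlongrightarrow> Q u0) (at_right 0))"
proof -
  interpret convex_markov_semigroup "generated_semigroup Q"
    using generated_semigroup_semigroup[OF Q] generated_semigroup_markovian[OF Q] generated_semigroup_convex[OF Q]
    by unfold_locales (auto simp: markovian_semigroup_def convex_semigroup_def)
  have "((\<lambda>h. (1 / h) *\<^sub>R (chain_value chain_expectation coordinate u0 h - u0)) \<longlongrightarrow> Q u0) (at_right 0)" for u0
    by (rule Lim_transform_eventually[OF generated_semigroup_deriv_0[OF Q]],
        rule eventually_mono[OF eventually_at_right_less])
      (simp add: chain_value_chain_expectation)
  then show ?thesis using convex_markov_chain_exists by blast
qed

text \<open>A chain is shown to exist on the path space, while the converse and the identification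
  of solutions cover chains over an arbitrary type \<open>'w\<close>; HOL cannot quantify over types
  inside a formula, which is why chains occur in separate clauses.\<close>

theorem mainTheorem1:
  fixes Q :: "real^'d::finite \<Rightarrow> real^'d"
  shows
   "(convex_map Q \<and> Q_operator Q \<longleftrightarrow>
       convex_map Q \<and> positive_max_principle Q \<and> (\<forall>\<alpha>::real. Q (vec \<alpha>) = 0)) \<and>
    (convex_map Q \<and> Q_operator Q \<longleftrightarrow>
       (\<exists>P f. sup_representation Q P f)) \<and>
    (convex_map Q \<and> Q_operator Q \<longleftrightarrow>
       (\<exists>S. semigroup S \<and> unif_cont_semigroup S \<and> convex_semigroup S \<and> markovian_semigroup S \<and>
            (\<forall>u0. ((\<lambda>h. (1 / h) *\<^sub>R (S h u0 - u0)) \<longlongrightarrow> Q u0) (at_right 0)))) \<and>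
    (convex_map Q \<and> Q_operator Q \<longleftrightarrow>
       (\<exists>(M :: (real \<Rightarrow> 'd) measure) E X. convex_markov_chain M E X \<and>
          (\<forall>u0. ((\<lambda>h. (1 / h) *\<^sub>R (chain_value E X u0 h - u0)) \<longlongrightarrow> Q u0) (at_right 0)))) \<and>
    (\<forall>(M :: 'w measure) E X. convex_markov_chain M E X \<and>
          (\<forall>u0. ((\<lambda>h. (1 / h) *\<^sub>R (chain_value E X u0 h - u0)) \<longlongrightarrow> Q u0) (at_right 0))
       \<longrightarrow> convex_map Q \<and> Q_operator Q) \<and>
    (convex_map Q \<and> Q_operator Q \<longrightarrow>
       (\<forall>(M :: 'w measure) E X S P f u0.
          convex_markov_chain M E X \<and>
          (\<forall>u0. ((\<lambda>h. (1 / h) *\<^sub>R (chain_value E X u0 h - u0)) \<longlongrightarrow> Q u0) (at_right 0)) \<and>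
          semigroup S \<and> unif_cont_semigroup S \<and> convex_semigroup S \<and> markovian_semigroup S \<and>
          (\<forall>u0. ((\<lambda>h. (1 / h) *\<^sub>R (S h u0 - u0)) \<longlongrightarrow> Q u0) (at_right 0)) \<and>
          sup_representation Q P f
        \<longrightarrow> classical_solution Q u0 (chain_value E X u0) \<and>
            (\<forall>v. classical_solution Q u0 v \<longrightarrow> (\<forall>t\<ge>0. v t = chain_value E X u0 t)) \<and>
            (\<forall>t\<ge>0. chain_value E X u0 t = S t u0) \<and>
            semigroup_envelope P f S))"
  unfolding convex_Q_operator_iff_generator
proof (intro conjI)
  show "convex_generator Q \<longleftrightarrow>
      convex_map Q \<and> positive_max_principle Q \<and> (\<forall>\<alpha>::real. Q (vec \<alpha>) = 0)"
    by (simp only: convex_generator_def)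
  show "convex_generator Q \<longleftrightarrow> (\<exists>P f. sup_representation Q P f)"
    using generator_imp_sup_representation sup_representation_imp_generator by blast
  show "convex_generator Q \<longleftrightarrow>
      (\<exists>S. semigroup S \<and> unif_cont_semigroup S \<and> convex_semigroup S \<and> markovian_semigroup S \<and>
        (\<forall>u0. ((\<lambda>h. (1 / h) *\<^sub>R (S h u0 - u0)) \<longlongrightarrow> Q u0) (at_right 0)))"
  proof
    assume Q: "convex_generator Q"
    show "\<exists>S. semigroup S \<and> unif_cont_semigroup S \<and> convex_semigroup S \<and> markovian_semigroup S \<and>
        (\<forall>u0. ((\<lambda>h. (1 / h) *\<^sub>R (S h u0 - u0)) \<longlongrightarrow> Q u0) (at_right 0))"
      using generated_semigroup_semigroup[OF Q] generated_semigroup_unif_cont[OF Q] generated_semigroup_convex[OF Q]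
        generated_semigroup_markovian[OF Q] generated_semigroup_deriv_0[OF Q]
      by (intro exI[of _ "generated_semigroup Q"]) simp
  qed (auto intro: semigroup_derivative_imp_generator)
  show "convex_generator Q \<longleftrightarrow>
      (\<exists>(M :: (real \<Rightarrow> 'd) measure) E X. convex_markov_chain M E X \<and>
        (\<forall>u0. ((\<lambda>h. (1 / h) *\<^sub>R (chain_value E X u0 h - u0)) \<longlongrightarrow> Q u0) (at_right 0)))"
    using generator_imp_chain chain_derivative_imp_generator by blast
  show "\<forall>(M :: 'w measure) E X. convex_markov_chain M E X \<and>
      (\<forall>u0. ((\<lambda>h. (1 / h) *\<^sub>R (chain_value E X u0 h - u0)) \<longlongrightarrow> Q u0) (at_right 0)) \<longrightarrow> convex_generator Q"
    using chain_derivative_imp_generator by blast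
next
  show "convex_generator Q \<longrightarrow>
       (\<forall>(M :: 'w measure) E X S P f u0.
          convex_markov_chain M E X \<and>
          (\<forall>u0. ((\<lambda>h. (1 / h) *\<^sub>R (chain_value E X u0 h - u0)) \<longlongrightarrow> Q u0) (at_right 0)) \<and>
          semigroup S \<and> unif_cont_semigroup S \<and> convex_semigroup S \<and> markovian_semigroup S \<and>
          (\<forall>u0. ((\<lambda>h. (1 / h) *\<^sub>R (S h u0 - u0)) \<longlongrightarrow> Q u0) (at_right 0)) \<and>
          sup_representation Q P f
        \<longrightarrow> classical_solution Q u0 (chain_value E X u0) \<and>
            (\<forall>v. classical_solution Q u0 v \<longrightarrow> (\<forall>t\<ge>0. v t = chain_value E X u0 t)) \<and>
            (\<forall>t\<ge>0. chain_value E X u0 t = S t u0) \<and>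
            semigroup_envelope P f S)"
  proof (intro allI impI, elim conjE)
    fix M :: "'w measure" and E X S P f u0
    assume Q: "convex_generator Q" and chain: "convex_markov_chain M E X"
      "\<forall>u0. ((\<lambda>h. (1 / h) *\<^sub>R (chain_value E X u0 h - u0)) \<longlongrightarrow> Q u0) (at_right 0)"
      and S: "semigroup S" "convex_semigroup S" "markovian_semigroup S"
      "\<forall>u0. ((\<lambda>h. (1 / h) *\<^sub>R (S h u0 - u0)) \<longlongrightarrow> Q u0) (at_right 0)"
      and rep: "sup_representation Q P f"
    have sol_chain: "classical_solution Q u0 (chain_value E X u0)"
      using chain_value_classical_solution[OF chain(1)] chain(2) by blast
    have sol_S: "classical_solution Q v (\<lambda>t. S t v)" for v
      by (rule convex_markov_semigroup_classical_solution[OF S(1)])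
        (use S in \<open>auto simp: convex_semigroup_def markovian_semigroup_def\<close>)
    show "classical_solution Q u0 (chain_value E X u0) \<and>
        (\<forall>v. classical_solution Q u0 v \<longrightarrow> (\<forall>t\<ge>0. v t = chain_value E X u0 t)) \<and>
        (\<forall>t\<ge>0. chain_value E X u0 t = S t u0) \<and> semigroup_envelope P f S"
      using sol_chain classical_solution_unique[OF Q _ sol_chain] classical_solution_unique[OF Q sol_chain sol_S]
        classical_semigroup_is_envelope[OF rep S(1) sol_S]
      by blast
  qed
qed

end
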